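(* There exist compactly supported functions $f,g\in L^2(\mathbb{R}_+)$ such that the pair $\{f,g\}$ identifies minimum phase preserving operators on $L^2(\mathbb{R}_+)$; that is, whenever $A_1,A_2:L^2(\mathbb{R}_+)\to L^2(\mathbb{R}_+)$ are minimum phase preserving linear operators with $A_1f=A_2f$ and $A_1g=A_2g$, then $A_1=A_2$.
   Context: $L^2(\mathbb{R}_+)$ is the complex Hilbert space of square-integrable functions on $\mathbb{R}_+=[0,\infty)$, $\mathbb{D}$ is the open unit disk, and $\mathbb{C}_+$ is the open right half plane. $H^2_{\mathbb{D}}$ and $H^2_{\mathbb{C}_+}$ are the Hardy spaces on $\mathbb{D}$ and $\mathbb{C}_+$. The Fourier-Laplace transform $\mathcal{F}:L^2(\mathbb{R}_+)\to H^2_{\mathbb{C}_+}$ is the isometry \[ (\mathcal{F}g)(z)=\frac{1}{\sqrt{2\pi}}\int_0^\infty g(t)e^{-zt}\,dt . \] A function $f\in H^2_{\mathbb{D}}$ is outer if it is not identically zero and $\log|f(0)|=\frac{1}{2\pi}\int_0^{2\pi}\log|f(e^{i\theta})|\,d\theta$ (with $f(e^{i\theta})$ denoting boundary values). A function $F\in H^2_{\mathbb{C}_+}$ is outer if and only if the function $z\mapsto \frac{2\sqrt{\pi}}{1+z}F\left(\frac{1-z}{1+z}\right)$, which belongs to $H^2_{\mathbb{D}}$, is outer. A function $f\in L^2(\mathbb{R}_+)$ is minimum phase if $\mathcal{F}f\in H^2_{\mathbb{C}_+}$ is outer. A linear operator $A:L^2(\mathbb{R}_+)\to L^2(\mathbb{R}_+)$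 is minimum phase preserving if $Af$ is minimum phase for every minimum phase $f\in L^2(\mathbb{R}_+)$. *)

theory Defs
  imports "HOL-Complex_Analysis.Complex_Analysis"
begin

section \<open>The space of square-integrable functions on the half line\<close>

text \<open>Every Lebesgue measurable function agrees almost everywhere with a Borel measurable one, so
  the a.e.-classes over this measure are the usual ones.\<close>

abbreviation halfline :: "real measure" where
  "halfline \<equiv> restrict_space lborel {0..}"

definition square_integrable :: "(real \<Rightarrow> complex) \<Rightarrow> bool" where
  "square_integrable f \<longleftrightarrow>
     f \<in> borel_measurable halfline \<and> integrable halfline (\<lambda>t. (cmod (f t))\<^sup>2)"

lemma square_integrable_zero: "square_integrable (\<lambda>_. 0)"
  by (simp add: square_integrable_def)

lemma square_integrable_scale:
  assumes "square_integrable f"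
  shows "square_integrable (\<lambda>t. c * f t)"
  using assms by (auto simp: square_integrable_def norm_mult power_mult_distrib)

lemma square_integrable_add:
  assumes f: "square_integrable f" and g: "square_integrable g"
  shows "square_integrable (\<lambda>t. f t + g t)"
proof -
  have [measurable]: "f \<in> borel_measurable halfline" "g \<in> borel_measurable halfline"
    using f g by (auto simp: square_integrable_def)
  have bound: "(cmod (f t + g t))\<^sup>2 \<le> 2 * (cmod (f t))\<^sup>2 + 2 * (cmod (g t))\<^sup>2" for t
  proof -
    have "(cmod (f t + g t))\<^sup>2 \<le> (cmod (f t) + cmod (g t))\<^sup>2"
      by (intro power_mono norm_triangle_ineq) auto
    also have "\<dots> \<le> 2 * (cmod (f t))\<^sup>2 + 2 * (cmod (g t))\<^sup>2"
      using sum_squares_bound[of "cmod (f t)" "cmod (g t)"] by (simp add: power2_sum)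
    finally show ?thesis .
  qed
  have "integrable halfline (\<lambda>t. 2 * (cmod (f t))\<^sup>2 + 2 * (cmod (g t))\<^sup>2)"
    using f g by (auto simp: square_integrable_def)
  then have "integrable halfline (\<lambda>t. (cmod (f t + g t))\<^sup>2)"
    by (rule Bochner_Integration.integrable_bound) (use bound in auto)
  then show ?thesis
    by (simp add: square_integrable_def)
qed

definition L2_rel :: "(real \<Rightarrow> complex) \<Rightarrow> (real \<Rightarrow> complex) \<Rightarrow> bool" where
  "L2_rel f g \<longleftrightarrow>
     square_integrable f \<and> square_integrable g \<and> (AE t in halfline. f t = g t)"

quotient_type L2 = "real \<Rightarrow> complex" / partial: L2_rel
proof (rule part_equivpI)
  show "\<exists>f. L2_rel f f"
    using square_integrable_zero by (auto simp: L2_rel_def)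
  show "symp L2_rel"
    by (rule sympI) (auto simp: L2_rel_def elim!: eventually_mono)
  show "transp L2_rel"
    by (rule transpI) (auto simp: L2_rel_def elim: eventually_elim2)
qed

instantiation L2 :: ab_group_add
begin

lift_definition zero_L2 :: L2 is "\<lambda>_. 0"
  by (simp add: L2_rel_def square_integrable_zero)

lift_definition plus_L2 :: "L2 \<Rightarrow> L2 \<Rightarrow> L2" is "\<lambda>f g t. f t + g t"
  by (auto simp: L2_rel_def intro: square_integrable_add elim: eventually_elim2)

lift_definition uminus_L2 :: "L2 \<Rightarrow> L2" is "\<lambda>f t. - f t"
  using square_integrable_scale[where c = "- 1"] by (auto simp: L2_rel_def)

definition minus_L2 :: "L2 \<Rightarrow> L2 \<Rightarrow> L2" where
  "minus_L2 f g = f + - g"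

instance
proof
  fix f g h :: L2
  show "f + g + h = f + (g + h)"
    by transfer (auto simp: L2_rel_def add.assoc intro!: square_integrable_add)
  show "f + g = g + f"
    by transfer (auto simp: L2_rel_def add.commute intro!: square_integrable_add)
  show "0 + f = f"
    by transfer (auto simp: L2_rel_def)
  show "- f + f = 0"
    by transfer (auto simp: L2_rel_def square_integrable_zero)
  show "f - g = f + - g"
    by (rule minus_L2_def)
qed

end

lift_definition scale_L2 :: "complex \<Rightarrow> L2 \<Rightarrow> L2" is "\<lambda>c f t. c * f t"
  by (auto simp: L2_rel_def intro: square_integrable_scale)

interpretation L2: vector_space scale_L2
proof
  fix a b :: complex and f g :: L2
  show "scale_L2 a (f + g) = scale_L2 a f + scale_L2 a g"
    by transfer (auto simp: L2_rel_def distrib_left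
        intro!: square_integrable_add square_integrable_scale)
  show "scale_L2 (a + b) f = scale_L2 a f + scale_L2 b f"
    by transfer (auto simp: L2_rel_def distrib_right
        intro!: square_integrable_add square_integrable_scale)
  show "scale_L2 a (scale_L2 b f) = scale_L2 (a * b) f"
    by transfer (auto simp: L2_rel_def mult.assoc intro!: square_integrable_scale)
  show "scale_L2 1 f = f"
    by transfer (auto simp: L2_rel_def)
qed

text \<open>Compactness of the essential support.\<close>

lift_definition compactly_supported :: "L2 \<Rightarrow> bool" is
  "\<lambda>f. \<exists>K. compact K \<and> K \<subseteq> {0..} \<and> (AE t in halfline. t \<notin> K \<longrightarrow> f t = 0)"
proof -
  fix f g
  assume "L2_rel f g"
  then have "AE t in halfline. f t = g t"
    by (simp add: L2_rel_def)
  then have "(AE t in halfline. t \<notin> K \<longrightarrow> f t = 0) \<longleftrightarrow> (AE t in halfline. t \<notin> K \<longrightarrow> g t = 0)" for K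
    by (intro eventually_cong) auto
  then show "(\<exists>K. compact K \<and> K \<subseteq> {0..} \<and> (AE t in halfline. t \<notin> K \<longrightarrow> f t = 0)) \<longleftrightarrow>
      (\<exists>K. compact K \<and> K \<subseteq> {0..} \<and> (AE t in halfline. t \<notin> K \<longrightarrow> g t = 0))"
    by simp
qed

text \<open>Only the values at \<open>z\<close> with positive real part are meaningful; elsewhere the integral may
  fail to converge.\<close>

lift_definition fourier_laplace :: "L2 \<Rightarrow> complex \<Rightarrow> complex" is
  "\<lambda>g z. 1 / of_real (sqrt (2 * pi)) * (\<integral>t. g t * exp (- z * of_real t) \<partial>halfline)"
proof -
  fix f g :: "real \<Rightarrow> complex"
  assume "L2_rel f g"
  then have f: "f \<in> borel_measurable halfline" and g: "g \<in> borel_measurable halfline"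
    and ae: "AE t in halfline. f t = g t"
    by (auto simp: L2_rel_def square_integrable_def)
  have e: "(\<lambda>t. exp (- z * of_real t)) \<in> borel_measurable halfline" for z :: complex
    by (intro measurable_restrict_space1) simp
  have "(\<integral>t. f t * exp (- z * of_real t) \<partial>halfline)
      = (\<integral>t. g t * exp (- z * of_real t) \<partial>halfline)" for z :: complex
    using ae by (intro integral_cong_AE borel_measurable_times f g e) (auto elim: eventually_mono)
  then show "(\<lambda>z. 1 / of_real (sqrt (2 * pi)) * (\<integral>t. f t * exp (- z * of_real t) \<partial>halfline)) =
      (\<lambda>z. 1 / of_real (sqrt (2 * pi)) * (\<integral>t. g t * exp (- z * of_real t) \<partial>halfline))"
    by simp
qed


section \<open>Hardy spaces and outer functions\<close>

text \<open>Functions on the disk or the half plane are total functions whose values outside the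
  respective domain are ignored.\<close>

definition hardy_disk :: "(complex \<Rightarrow> complex) set" where
  "hardy_disk = {f. f holomorphic_on ball 0 1 \<and>
     (SUP r\<in>{0<..<1}. \<integral>\<^sup>+\<theta>\<in>{0..2 * pi}. ennreal ((cmod (f (of_real r * cis \<theta>)))\<^sup>2) \<partial>lborel) < \<infinity>}"

definition hardy_halfplane :: "(complex \<Rightarrow> complex) set" where
  "hardy_halfplane = {F. F holomorphic_on {z. Re z > 0} \<and>
     (SUP x\<in>{0<..}. \<integral>\<^sup>+y. ennreal ((cmod (F (Complex x y)))\<^sup>2) \<partial>lborel) < \<infinity>}"

text \<open>For a function in the Hardy space of the disk the radial limit exists for almost every
  \<open>\<theta>\<close>; at the other angles \<^const>\<open>Lim\<close> has an unspecified value.\<close>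

definition boundary_value :: "(complex \<Rightarrow> complex) \<Rightarrow> real \<Rightarrow> complex" where
  "boundary_value f \<theta> = Lim (at_left 1) (\<lambda>r. f (of_real r * cis \<theta>))"

text \<open>If \<open>f\<close> in the Hardy space is not identically zero, then the logarithm of the modulus of its
  boundary values is integrable, so the defining identity forces \<open>f 0 \<noteq> 0\<close>. Both facts are spelled
  out since \<^term>\<open>ln 0 = (0::real)\<close> and since the integral of a non-integrable function is \<open>0\<close>.
  The condition \<open>f 0 \<noteq> 0\<close> subsumes that \<open>f\<close> is not identically zero.\<close>

definition outer_disk :: "(complex \<Rightarrow> complex) \<Rightarrow> bool" where
  "outer_disk f \<longleftrightarrow> f \<in> hardy_disk \<and> f 0 \<noteq> 0 \<and>
     set_integrable lborel {0..2 * pi} (\<lambda>\<theta>. ln (cmod (boundary_value f \<theta>))) \<and>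
     ln (cmod (f 0)) = 1 / (2 * pi) * (LINT \<theta>:{0..2 * pi}|lborel. ln (cmod (boundary_value f \<theta>)))"

definition outer_halfplane :: "(complex \<Rightarrow> complex) \<Rightarrow> bool" where
  "outer_halfplane F \<longleftrightarrow> F \<in> hardy_halfplane \<and>
     outer_disk (\<lambda>z. 2 * of_real (sqrt pi) / (1 + z) * F ((1 - z) / (1 + z)))"


section \<open>Minimum phase preserving operators\<close>

definition minimum_phase :: "L2 \<Rightarrow> bool" where
  "minimum_phase f \<longleftrightarrow> outer_halfplane (fourier_laplace f)"

text \<open>Linear operators are defined on the whole space and are not required to be bounded.\<close>

definition minimum_phase_preserving :: "(L2 \<Rightarrow> L2) \<Rightarrow> bool" where
  "minimum_phase_preserving A \<longleftrightarrow>
     Vector_Spaces.linear scale_L2 scale_L2 A \<and> (\<forall>f. minimum_phase f \<longrightarrow> minimum_phase (A f))"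

end

theory Submission
  imports Defs "HOL-Probability.Probability"
begin

text \<open>
  Let \<open>\<zeta>\<close> be the variable in the half plane and put \<open>\<zeta> = (1 - z) / (1 + z)\<close>. In the variable \<open>z\<close> the
  Fourier-Laplace transform becomes a linear bijection \<open>disk_transform\<close> from \<^typ>\<open>L2\<close> onto the Hardy space of
  the disk, which takes the Laguerre functions to the monomials (\<open>disk_transform_hardy\<close>,
  \<open>disk_transform_surj\<close>, \<open>disk_transform_inj\<close>). Minimum phase elements correspond to outer
  functions; Plancherel's inequality provides the membership in the Hardy space of the half plane.

  Fix a point \<open>a\<close> of the disk and a minimum phase preserving operator \<open>A\<close>. An outer function has no zeros
  (\<open>outer_disk_nonzero\<close>), so the linear functional that takes the transform of \<open>u\<close> to the value at \<open>a\<close> of the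
  transform of \<open>A u\<close> does not vanish on outer functions. A theorem of Gleason-Kahane-Zelazko type
  (\<open>outer_functional\<close>) says that such a functional is a nonzero multiple \<open>c\<close> of the evaluation at a point
  \<open>w\<close> of the disk. So \<open>A\<close> is determined by the values of \<open>c\<close> and \<open>w\<close> for every \<open>a\<close>.

  Two functions suffice to recover \<open>c\<close> and \<open>w\<close>. The Laplace transforms of the indicator function of
  \<open>[0, 1]\<close> and of its product with \<open>exp (- 2 pi \<i> t)\<close> are \<open>(1 - exp (- \<zeta>)) / \<zeta>\<close> and
  \<open>(1 - exp (- \<zeta>)) / (\<zeta> + 2 pi \<i>)\<close>. They have no zeros in the half plane, and their quotient is a Moebius
  transformation, hence injective. The images of the two functions therefore determine first \<open>w\<close> and then
  \<open>c\<close>.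

  Outer functions are defined by means of radial limits, so both facts about them rest on an
  inequality for the maximal function of Poisson integrals in mean square (\<open>valid_256\<close>), proved by
  comparing the linearised maximal operator with its adjoint. It yields the radial limits almost
  everywhere (\<open>radial_limit_AE\<close>) and a square-integrable majorant for passing to the limit along radii. In
  this way one obtains a supply of outer functions, the exponentials of Hardy space functions
  (\<open>exp_hardy_boundary\<close>), and Jensen's inequality (\<open>jensen_hardy\<close>), from which the absence of zeros follows.
  The Herglotz integral of the maximal function shows that the Hardy space is spanned by outer functions
  with real part at least 1 (\<open>positive_hardy_span\<close>). This set is closed under addition, which is what makes
  the functional computable on it.
\<close>

section \<open>Means over the circle\<close>

text \<open>Arc length, normalised to a probability measure so that integrals are means. It is a measure on the
  whole real line with the Borel sets, which makes measurability on the circle plain Borel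
  measurability.\<close>

definition circ :: "real measure" where
  "circ = uniform_measure lborel {0..2 * pi}"

lemma sets_circ [simp, measurable_cong]: "sets circ = sets borel"
  and space_circ [simp]: "space circ = UNIV"
  by (simp_all add: circ_def)

interpretation circ: prob_space circ
  unfolding circ_def by (rule prob_space_uniform_measure) auto

interpretation circ2: pair_prob_space circ circ ..

lemma circ_density: "circ = density lborel (\<lambda>x. ennreal (indicator {0..2 * pi} x / (2 * pi)))"
proof -
  have "indicator {0..2 * pi} x / ennreal (2 * pi) = ennreal (indicator {0..2 * pi} x / (2 * pi))" for x
    by (subst divide_ennreal [symmetric]) (auto simp: ennreal_indicator)
  then show ?thesis
    unfolding circ_def uniform_measure_def by simp
qed

lemma integral_circ:
  fixes f :: "real \<Rightarrow> 'a::{banach, second_countable_topology}"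
  assumes [measurable]: "f \<in> borel_measurable borel"
  shows "(\<integral>\<theta>. f \<theta> \<partial>circ) = (1 / (2 * pi)) *\<^sub>R (LINT \<theta>:{0..2 * pi}|lborel. f \<theta>)"
  unfolding circ_density set_lebesgue_integral_def
  by (subst integral_density) (auto simp flip: integral_scaleR_right intro!: Bochner_Integration.integral_cong)

lemma integrable_circ:
  fixes f :: "real \<Rightarrow> 'a::{banach, second_countable_topology}"
  assumes [measurable]: "f \<in> borel_measurable borel"
  shows "integrable circ f \<longleftrightarrow> set_integrable lborel {0..2 * pi} f"
proof -
  have "integrable circ f \<longleftrightarrow> integrable lborel (\<lambda>x. (1 / (2 * pi)) *\<^sub>R (indicator {0..2 * pi} x *\<^sub>R f x))"
    unfolding circ_density by (subst integrable_density) auto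
  also have "\<dots> \<longleftrightarrow> set_integrable lborel {0..2 * pi} f"
  proof -
    have "integrable lborel (\<lambda>x. indicat_real {0..2 * pi} x *\<^sub>R f x)"
      if "integrable lborel (\<lambda>x. (1 / (2 * pi)) *\<^sub>R (indicat_real {0..2 * pi} x *\<^sub>R f x))"
      using integrable_scaleR_right[OF that, of "2 * pi"] by simp
    moreover have "integrable lborel (\<lambda>x. (1 / (2 * pi)) *\<^sub>R (indicat_real {0..2 * pi} x *\<^sub>R f x))"
      if "integrable lborel (\<lambda>x. indicat_real {0..2 * pi} x *\<^sub>R f x)"
      using integrable_scaleR_right[OF that, of "1 / (2 * pi)"] .
    ultimately show ?thesis
      unfolding set_integrable_def by blast
  qed
  finally show ?thesis .
qed

lemma integrable_circ_bounded:
  fixes f :: "real \<Rightarrow> 'a::{banach, second_countable_topology}"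
  assumes "f \<in> borel_measurable borel" "\<And>\<theta>. norm (f \<theta>) \<le> B"
  shows "integrable circ f"
  by (rule circ.integrable_const_bound[where B = B]) (use assms in auto)

lemma measurable_cis [measurable]: "cis \<in> borel_measurable borel"
  by (intro borel_measurable_continuous_onI continuous_intros)

lemma integrable_circ_cis:
  fixes f :: "complex \<Rightarrow> 'a::{banach, second_countable_topology}"
  assumes "continuous_on (sphere 0 1) f"
  shows "integrable circ (\<lambda>\<theta>. f (cis \<theta>))" "(\<lambda>\<theta>. f (cis \<theta>)) \<in> borel_measurable borel"
proof -
  have c: "continuous_on UNIV (\<lambda>\<theta>. f (cis \<theta>))"
    by (rule continuous_on_compose2[OF assms]) (auto intro!: continuous_intros)
  then show "(\<lambda>\<theta>. f (cis \<theta>)) \<in> borel_measurable borel"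
    by (rule borel_measurable_continuous_onI)
  have "bounded (f ` sphere 0 1)"
    using assms by (intro compact_imp_bounded compact_continuous_image) auto
  then obtain B where "\<And>z. z \<in> sphere 0 1 \<Longrightarrow> norm (f z) \<le> B"
    unfolding bounded_iff by (metis imageI)
  then show "integrable circ (\<lambda>\<theta>. f (cis \<theta>))"
    by (intro integrable_circ_bounded[where B = B] borel_measurable_continuous_onI c) auto
qed

lemma cauchy_circ:
  assumes f: "f holomorphic_on cball 0 1" and w: "cmod w < 1"
  shows "(\<integral>\<theta>. f (cis \<theta>) * (cis \<theta> / (cis \<theta> - w)) \<partial>circ) = f w"
proof -
  have "((\<lambda>u. f u / (u - w)) has_contour_integral (2 * of_real pi * \<i> * f w)) (circlepath 0 1)"
    using Cauchy_integral_circlepath_simple[OF f, of w] w by simp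
  then have *: "((\<lambda>x. f (cis x) / (cis x - w) * (\<i> * cis x)) has_integral 2 * of_real pi * \<i> * f w) {0..2 * pi}"
    unfolding circlepath_def by (subst (asm) has_contour_integral_part_circlepath_iff) (auto simp: cis_conv_exp mult_ac)
  have cont: "continuous_on (sphere 0 1) (\<lambda>z. f z * (z / (z - w)))"
    using w by (intro continuous_intros continuous_on_subset[OF holomorphic_on_imp_continuous_on[OF f]]) auto
  have "((\<lambda>x. -\<i> * (f (cis x) / (cis x - w) * (\<i> * cis x))) has_integral - \<i> * (2 * of_real pi * \<i> * f w)) {0..2 * pi}"
    by (intro has_integral_mult_right *)
  then have "((\<lambda>\<theta>. f (cis \<theta>) * (cis \<theta> / (cis \<theta> - w))) has_integral 2 * of_real pi * f w) {0..2 * pi}"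
    by (simp add: field_simps)
  moreover have si: "set_integrable lborel {0..2 * pi} (\<lambda>\<theta>. f (cis \<theta>) * (cis \<theta> / (cis \<theta> - w)))"
    using integrable_circ_cis[OF cont] by (subst integrable_circ[symmetric])
  ultimately have "(LINT \<theta>:{0..2 * pi}|lborel. f (cis \<theta>) * (cis \<theta> / (cis \<theta> - w))) = 2 * of_real pi * f w"
    using set_borel_integral_eq_integral(2)[OF si] by (metis integral_unique)
  then show ?thesis
    using integrable_circ_cis(2)[OF cont] by (subst integral_circ) (auto simp: scaleR_conv_of_real)
qed

lemma mean_value_circ:
  assumes f: "f holomorphic_on cball 0 1"
  shows "(\<integral>\<theta>. f (cis \<theta>) \<partial>circ) = f 0"
  using cauchy_circ[OF f, of 0] by simp

definition poisson :: "complex \<Rightarrow> real \<Rightarrow> real" where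
  "poisson a \<theta> = (1 - (cmod a)\<^sup>2) / (cmod (cis \<theta> - a))\<^sup>2"

lemma poisson_nonneg: "cmod a < 1 \<Longrightarrow> 0 \<le> poisson a \<theta>"
  by (auto simp: poisson_def abs_square_le_1)

lemma measurable_poisson [measurable]:
  assumes [measurable]: "a \<in> borel_measurable M" "b \<in> borel_measurable M"
  shows "(\<lambda>x. poisson (a x) (b x)) \<in> borel_measurable M"
  unfolding poisson_def by measurable

lemma poisson_le:
  assumes "cmod a \<le> \<rho>" "\<rho> < 1"
  shows "poisson a \<theta> \<le> 1 / (1 - \<rho>)\<^sup>2"
proof -
  have "1 - \<rho> \<le> cmod (cis \<theta> - a)"
    using norm_triangle_ineq2[of "cis \<theta>" a] assms by simp
  then have "(1 - \<rho>)\<^sup>2 \<le> (cmod (cis \<theta> - a))\<^sup>2"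
    using assms by (intro power_mono) auto
  then show ?thesis
    unfolding poisson_def using assms by (intro frac_le) auto
qed

section \<open>The Poisson kernel\<close>

lemma one_minus_cnj_mult_nonzero:
  assumes "cmod a < 1" "cmod w \<le> 1"
  shows "1 - cnj a * w \<noteq> 0"
proof
  assume "1 - cnj a * w = 0"
  then have "cmod (cnj a * w) = 1" by (metis norm_one right_minus_eq)
  moreover have "cmod (cnj a * w) < 1"
    using assms mult_left_le[of "cmod w" "cmod a"] by (auto simp: norm_mult)
  ultimately show False by simp
qed

text \<open>For \<open>w = cis \<theta>\<close> the kernel is \<open>(1 - |z|\<^sup>2) w / ((w - z) (1 - cnj z w))\<close>. The identity is therefore
  Cauchy's formula at \<open>z\<close> for the function \<open>f w (1 - |z|\<^sup>2) / (1 - cnj z w)\<close>.\<close>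

lemma poisson_circ:
  assumes f: "f holomorphic_on cball 0 1" and z: "cmod z < 1"
  shows "(\<integral>\<theta>. poisson z \<theta> *\<^sub>R f (cis \<theta>) \<partial>circ) = f z"
proof -
  define g where "g = (\<lambda>w. f w * (1 - z * cnj z) / (1 - cnj z * w))"
  have nz: "1 - cnj z * w \<noteq> 0" if "cmod w \<le> 1" for w
    by (rule one_minus_cnj_mult_nonzero) fact+
  have "g holomorphic_on cball 0 1"
    unfolding g_def using nz by (intro holomorphic_intros f) auto
  from cauchy_circ[OF this z]
  have "(\<integral>\<theta>. g (cis \<theta>) * (cis \<theta> / (cis \<theta> - z)) \<partial>circ) = g z" .
  moreover have "g z = f z"
    using nz[of z] z by (simp add: g_def mult.commute)
  moreover have "g (cis \<theta>) * (cis \<theta> / (cis \<theta> - z)) = poisson z \<theta> *\<^sub>R f (cis \<theta>)" for \<theta>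
  proof -
    have n1: "cis \<theta> - z \<noteq> 0" using z by auto
    have "of_real ((cmod (cis \<theta> - z))\<^sup>2) = (cis \<theta> - z) * cnj (cis \<theta> - z)"
      by (rule complex_norm_square)
    also have "\<dots> * cis \<theta> = (cis \<theta> - z) * (1 - cnj z * cis \<theta>)"
      by (simp add: algebra_simps cis_cnj cis_mult)
    finally have e: "(cis \<theta> - z) * (1 - cnj z * cis \<theta>) = of_real ((cmod (cis \<theta> - z))\<^sup>2) * cis \<theta>" ..
    have e2: "1 - z * cnj z = of_real (1 - (cmod z)\<^sup>2)"
      by (simp add: complex_norm_square flip: of_real_power)
    have "g (cis \<theta>) * (cis \<theta> / (cis \<theta> - z)) = f (cis \<theta>) * of_real (1 - (cmod z)\<^sup>2) * cis \<theta> / ((cis \<theta> - z) * (1 - cnj z * cis \<theta>))"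
      unfolding g_def e2 by (simp add: mult_ac)
    also have "\<dots> = poisson z \<theta> *\<^sub>R f (cis \<theta>)"
      unfolding e using n1 by (simp add: poisson_def scaleR_conv_of_real)
    finally show ?thesis .
  qed
  ultimately show ?thesis by simp
qed

text \<open>On the circle \<^term>\<open>poisson b\<close> is the real part of \<open>H w = (1 + cnj b w) / (1 - cnj b w)\<close>, and \<open>H\<close> is
  holomorphic beyond the closed disk. The value is \<open>Re (H a)\<close>.\<close>

lemma poisson_semigroup:
  assumes a: "cmod a < 1" and b: "cmod b < 1"
  shows "(\<integral>\<theta>. poisson a \<theta> * poisson b \<theta> \<partial>circ) = (1 - (cmod a * cmod b)\<^sup>2) / (cmod (1 - cnj b * a))\<^sup>2"
proof -
  define H where "H = (\<lambda>w. (1 + cnj b * w) / (1 - cnj b * w))"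
  have nz: "1 - cnj b * w \<noteq> 0" if "cmod w \<le> 1" for w
    by (rule one_minus_cnj_mult_nonzero) fact+
  have hol: "H holomorphic_on cball 0 1"
    unfolding H_def using nz by (intro holomorphic_intros) auto
  have ReH: "Re (H w) = (1 - (cmod w * cmod b)\<^sup>2) / (cmod (1 - cnj b * w))\<^sup>2" for w
  proof -
    have "H w = (1 + cnj b * w) * cnj (1 - cnj b * w) / of_real ((cmod (1 - cnj b * w))\<^sup>2)"
      unfolding H_def complex_div_cnj[of "1 + cnj b * w"] by simp
    then have "Re (H w) = Re ((1 + cnj b * w) * cnj (1 - cnj b * w)) / (cmod (1 - cnj b * w))\<^sup>2"
      by (simp only: Re_divide_of_real)
    also have "Re ((1 + cnj b * w) * cnj (1 - cnj b * w)) = 1 - (cmod w * cmod b)\<^sup>2"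
      by (simp add: cmod_def algebra_simps power2_eq_square power_mult_distrib)
    finally show ?thesis .
  qed
  have n: "cmod (1 - cnj b * cis \<theta>) = cmod (cis \<theta> - b)" for \<theta>
  proof -
    have "1 - cnj b * cis \<theta> = cis \<theta> * cnj (cis \<theta> - b)"
      by (simp add: algebra_simps cis_cnj cis_mult)
    then show ?thesis by (simp add: norm_mult del: complex_cnj_diff)
  qed
  have "integrable circ (\<lambda>\<theta>. poisson a \<theta> *\<^sub>R H (cis \<theta>))"
    unfolding poisson_def using a
    by (intro integrable_circ_cis(1)[of "\<lambda>z. ((1 - (cmod a)\<^sup>2) / (cmod (z - a))\<^sup>2) *\<^sub>R H z"] continuous_intros
        continuous_on_subset[OF holomorphic_on_imp_continuous_on[OF hol]]) auto
  then have "(\<integral>\<theta>. Re (poisson a \<theta> *\<^sub>R H (cis \<theta>)) \<partial>circ) = Re (H a)"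
    using poisson_circ[OF hol a] by (subst integral_Re) auto
  moreover have "Re (poisson a \<theta> *\<^sub>R H (cis \<theta>)) = poisson a \<theta> * poisson b \<theta>" for \<theta>
    by (simp add: ReH n poisson_def)
  ultimately show ?thesis by (simp add: ReH)
qed

text \<open>The smaller of the two radii governs the kernel. If \<open>r \<le> s\<close> and \<open>e = cis (\<alpha> - \<beta>)\<close>, then
  \<open>1 - (r s)\<^sup>2 \<le> 2 (1 - r\<^sup>2)\<close> and \<open>|1 - r e| \<le> 2 |1 - r s e|\<close>, which gives the factor \<open>2 * 4\<close>.\<close>

lemma poisson_kernel_bound:
  assumes r: "0 \<le> r" "r < 1" and s: "0 \<le> s" "s < 1"
  shows "(1 - (r * s)\<^sup>2) / (cmod (1 - cnj (of_real s * cis \<beta>) * (of_real r * cis \<alpha>)))\<^sup>2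
     \<le> 8 * poisson (of_real r * cis \<alpha>) \<beta> + 8 * poisson (of_real s * cis \<beta>) \<alpha>"
proof -
  define e where "e = cis (\<alpha> - \<beta>)"
  have e1: "cmod e = 1" by (simp add: e_def)
  have K: "1 - cnj (of_real s * cis \<beta>) * (of_real r * cis \<alpha>) = 1 - of_real (r * s) * e"
    by (simp add: e_def cis_cnj cis_mult mult_ac)
  have P1: "cmod (cis \<beta> - of_real r * cis \<alpha>) = cmod (1 - of_real r * e)"
  proof -
    have "cis \<beta> - of_real r * cis \<alpha> = cis \<beta> * (1 - of_real r * e)"
      by (simp add: e_def algebra_simps cis_mult)
    then show ?thesis by (simp add: norm_mult)
  qed
  have P2: "cmod (cis \<alpha> - of_real s * cis \<beta>) = cmod (1 - of_real s * e)"
  proof -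
    have "cis \<alpha> - of_real s * cis \<beta> = cis \<alpha> * cnj (1 - of_real s * e)"
      by (simp add: e_def algebra_simps cis_mult cis_cnj)
    then show ?thesis by (simp add: norm_mult del: complex_cnj_diff)
  qed
  have main: "(1 - (r * s)\<^sup>2) / (cmod (1 - of_real (r * s) * e))\<^sup>2 \<le> 8 * ((1 - r\<^sup>2) / (cmod (1 - of_real r * e))\<^sup>2)"
    if "0 \<le> r" "r \<le> s" "s < 1" for r s :: real
  proof -
    have "r * s \<le> r" "r * s < 1" using that by (auto simp: mult_left_le intro: le_less_trans[of _ r])
    have "cmod (1 - of_real r * e) \<le> cmod (1 - of_real (r * s) * e) + cmod (of_real (r * s - r) * e)"
      using norm_triangle_ineq[of "1 - of_real (r * s) * e" "of_real (r * s - r) * e"]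
      by (simp add: algebra_simps)
    also have "cmod (of_real (r * s - r) * e) = r - r * s"
      using \<open>r * s \<le> r\<close> by (simp only: norm_mult e1 norm_of_real) simp
    also have "\<dots> \<le> 1 - r * s" using that by simp
    also have "\<dots> \<le> cmod (1 - of_real (r * s) * e)"
      using norm_triangle_ineq2[of 1 "of_real (r * s) * e"] that by (simp add: norm_mult e1)
    finally have le: "cmod (1 - of_real r * e) \<le> 2 * cmod (1 - of_real (r * s) * e)" by simp
    have pos: "0 < cmod (1 - of_real r * e)"
      by (rule less_le_trans[of _ "1 - r"])
        (use norm_triangle_ineq2[of 1 "of_real r * e"] that in \<open>simp_all add: norm_mult e1\<close>)
    have q: "(cmod (1 - of_real r * e))\<^sup>2 \<le> 4 * (cmod (1 - of_real (r * s) * e))\<^sup>2"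
      using power_mono[OF le, of 2] by (simp add: power_mult_distrib)
    have "r\<^sup>2 * (1 - s\<^sup>2) \<le> 1 * (1 - s\<^sup>2)"
      using that by (intro mult_right_mono) (auto simp: abs_square_le_1 power_le_one)
    moreover have "r\<^sup>2 \<le> s\<^sup>2" using that by (intro power_mono) auto
    ultimately have p: "1 - (r * s)\<^sup>2 \<le> 2 * (1 - r\<^sup>2)"
      by (simp add: algebra_simps power_mult_distrib)
    have "(1 - (r * s)\<^sup>2) / (cmod (1 - of_real (r * s) * e))\<^sup>2 \<le> (2 * (1 - r\<^sup>2)) / ((cmod (1 - of_real r * e))\<^sup>2 / 4)"
      using p q pos that by (intro frac_le) (auto simp: power_le_one)
    then show ?thesis by simp
  qed
  have nn: "0 \<le> (1 - r\<^sup>2) / (cmod (1 - of_real r * e))\<^sup>2" if "0 \<le> r" "r < 1" for r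
    using that by (auto simp: power_le_one)
  have m1: "cmod (of_real r * cis \<alpha>) = r" "cmod (of_real s * cis \<beta>) = s"
    using r s by (simp_all add: norm_mult)
  show ?thesis
    unfolding K poisson_def P1 P2 m1
  proof (cases "r \<le> s")
    case True
    then show "(1 - (r * s)\<^sup>2) / (cmod (1 - of_real (r * s) * e))\<^sup>2
      \<le> 8 * ((1 - r\<^sup>2) / (cmod (1 - of_real r * e))\<^sup>2) + 8 * ((1 - s\<^sup>2) / (cmod (1 - of_real s * e))\<^sup>2)"
      using main[OF r(1) True s(2)] nn[OF s] by linarith
  next
    case False
    then show "(1 - (r * s)\<^sup>2) / (cmod (1 - of_real (r * s) * e))\<^sup>2
      \<le> 8 * ((1 - r\<^sup>2) / (cmod (1 - of_real r * e))\<^sup>2) + 8 * ((1 - s\<^sup>2) / (cmod (1 - of_real s * e))\<^sup>2)"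
      using main[of s r] nn[OF r] r s unfolding mult.commute[of s r] by linarith
  qed
qed

section \<open>A maximal inequality for Poisson integrals\<close>

lemma Cauchy_Schwarz_integral:
  fixes f g :: "'a \<Rightarrow> real"
  assumes [measurable]: "f \<in> borel_measurable M" "g \<in> borel_measurable M"
    and f2: "integrable M (\<lambda>x. (f x)\<^sup>2)" and g2: "integrable M (\<lambda>x. (g x)\<^sup>2)"
  shows "integrable M (\<lambda>x. f x * g x)"
    and "(\<integral>x. f x * g x \<partial>M)\<^sup>2 \<le> (\<integral>x. (f x)\<^sup>2 \<partial>M) * (\<integral>x. (g x)\<^sup>2 \<partial>M)"
proof -
  have bd: "\<bar>f x * g x\<bar> \<le> (f x)\<^sup>2 + (g x)\<^sup>2" for x
  proof -
    have "2 * (\<bar>f x\<bar> * \<bar>g x\<bar>) \<le> (f x)\<^sup>2 + (g x)\<^sup>2"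
      using sum_squares_bound[of "\<bar>f x\<bar>" "\<bar>g x\<bar>"] by (simp add: mult.assoc)
    moreover have "0 \<le> \<bar>f x\<bar> * \<bar>g x\<bar>" by simp
    ultimately show ?thesis unfolding abs_mult by linarith
  qed
  show fg: "integrable M (\<lambda>x. f x * g x)"
    by (rule Bochner_Integration.integrable_bound[OF Bochner_Integration.integrable_add[OF f2 g2]])
      (use bd in auto)
  define A where "A = (\<integral>x. (f x)\<^sup>2 \<partial>M)"
  define B where "B = (\<integral>x. f x * g x \<partial>M)"
  define C where "C = (\<integral>x. (g x)\<^sup>2 \<partial>M)"
  have q: "0 \<le> A - 2 * t * B + t\<^sup>2 * C" for t
  proof -
    have "0 \<le> (\<integral>x. (f x - t * g x)\<^sup>2 \<partial>M)" by simp
    also have "(\<lambda>x. (f x - t * g x)\<^sup>2) = (\<lambda>x. (f x)\<^sup>2 - 2 * t * (f x * g x) + t\<^sup>2 * (g x)\<^sup>2)"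
      by (simp add: fun_eq_iff power2_eq_square algebra_simps)
    also have "(\<integral>x. (f x)\<^sup>2 - 2 * t * (f x * g x) + t\<^sup>2 * (g x)\<^sup>2 \<partial>M) = A - 2 * t * B + t\<^sup>2 * C"
      using f2 g2 fg by (simp add: A_def B_def C_def)
    finally show ?thesis .
  qed
  have "C \<ge> 0" by (simp add: C_def)
  have "B\<^sup>2 \<le> A * C"
  proof (cases "C = 0")
    case True
    have "B = 0"
    proof (rule ccontr)
      assume "B \<noteq> 0"
      then show False using q[of "(A + 1) / (2 * B)"] True by simp
    qed
    then show ?thesis using True by simp
  next
    case False
    then have "0 \<le> (A - 2 * (B / C) * B + (B / C)\<^sup>2 * C) * C"
      using q[of "B / C"] \<open>C \<ge> 0\<close> by simp
    also have "\<dots> = A * C - B\<^sup>2"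
      using False by (simp add: field_simps power2_eq_square)
    finally show ?thesis by simp
  qed
  then show "(\<integral>x. f x * g x \<partial>M)\<^sup>2 \<le> (\<integral>x. (f x)\<^sup>2 \<partial>M) * (\<integral>x. (g x)\<^sup>2 \<partial>M)"
    by (simp add: A_def B_def C_def)
qed

definition bounded_measurable :: "(real \<Rightarrow> real) \<Rightarrow> bool" where
  "bounded_measurable h \<longleftrightarrow> h \<in> borel_measurable borel \<and> (\<exists>B. \<forall>x. \<bar>h x\<bar> \<le> B)"

lemma bounded_measurableD [measurable_dest]: "bounded_measurable h \<Longrightarrow> h \<in> borel_measurable borel"
  by (simp add: bounded_measurable_def)

lemma bounded_measurable_mult:
  assumes "bounded_measurable f" "bounded_measurable g"
  shows "bounded_measurable (\<lambda>x. f x * g x)"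
proof -
  obtain A B where "\<And>x. \<bar>f x\<bar> \<le> A" "\<And>x. \<bar>g x\<bar> \<le> B"
    using assms by (auto simp: bounded_measurable_def)
  then have "\<bar>f x * g x\<bar> \<le> A * B" for x
    unfolding abs_mult by (intro mult_mono) (auto intro: order_trans[OF abs_ge_zero])
  then show ?thesis
    using assms by (auto simp: bounded_measurable_def)
qed

lemma bounded_measurable_integrable: "bounded_measurable f \<Longrightarrow> integrable circ f"
  by (auto simp: bounded_measurable_def intro!: integrable_circ_bounded)

lemma bounded_measurable_square_integrable:
  "bounded_measurable f \<Longrightarrow> integrable circ (\<lambda>x. (f x)\<^sup>2)"
  using bounded_measurable_integrable[OF bounded_measurable_mult[of f f]] by (simp add: power2_eq_square)

lemma bounded_measurable_integral:
  assumes [measurable]: "case_prod k \<in> borel_measurable (borel \<Otimes>\<^sub>M borel)"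
    and K: "\<And>x y. \<bar>k x y\<bar> \<le> K" and h: "bounded_measurable h"
  shows "bounded_measurable (\<lambda>x. \<integral>y. k x y * h y \<partial>circ)"
proof -
  have [measurable]: "h \<in> borel_measurable borel" using h by measurable
  obtain B where B: "\<And>x. \<bar>h x\<bar> \<le> B" using h by (auto simp: bounded_measurable_def)
  have b: "\<bar>k x y * h y\<bar> \<le> K * B" for x y
    unfolding abs_mult by (intro mult_mono K B) (auto intro: order_trans[OF abs_ge_zero K])
  have "\<bar>\<integral>y. k x y * h y \<partial>circ\<bar> \<le> K * B" for x
  proof -
    have i: "integrable circ (\<lambda>y. k x y * h y)"
      by (rule integrable_circ_bounded[where B = "K * B"]) (use b in auto)
    have "\<bar>\<integral>y. k x y * h y \<partial>circ\<bar> \<le> (\<integral>y. \<bar>k x y * h y\<bar> \<partial>circ)"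
      by (rule integral_abs_bound)
    also have "\<dots> \<le> (\<integral>y. K * B \<partial>circ)"
      by (intro integral_mono integrable_abs i b) auto
    finally show ?thesis by (simp add: circ.prob_space[simplified])
  qed
  then show ?thesis by (auto simp: bounded_measurable_def)
qed

lemma fubini_circ:
  fixes k :: "real \<Rightarrow> real \<Rightarrow> real"
  assumes [measurable]: "case_prod k \<in> borel_measurable (borel \<Otimes>\<^sub>M borel)"
    and B: "\<And>x y. \<bar>k x y\<bar> \<le> B"
  shows "(\<integral>x. \<integral>y. k x y \<partial>circ \<partial>circ) = (\<integral>y. \<integral>x. k x y \<partial>circ \<partial>circ)"
proof -
  have "integrable (circ \<Otimes>\<^sub>M circ) (case_prod k)"
    by (rule circ2.P.integrable_const_bound[where B = B]) (use B in auto)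
  then show ?thesis
    by (rule circ2.Fubini_integral[symmetric])
qed

text \<open>A measurable choice of a radius at every angle turns the supremum over all radii into a linear
  operator. The bound \<open>\<rho>\<close> makes every integral finite at the outset; the final constant 256 is independent
  of it.\<close>

locale radius_selection =
  fixes r :: "real \<Rightarrow> real" and \<rho> :: real
  assumes r_measurable [measurable]: "r \<in> borel_measurable borel"
    and r_nonneg: "0 \<le> r \<theta>" and r_le: "r \<theta> \<le> \<rho>" and rho_less: "\<rho> < 1"
begin

definition pt :: "real \<Rightarrow> complex" where "pt \<theta> = of_real (r \<theta>) * cis \<theta>"

lemma pt_measurable [measurable]: "pt \<in> borel_measurable borel"
  unfolding pt_def by measurable

lemma norm_pt: "cmod (pt \<theta>) = r \<theta>"
  using r_nonneg[of \<theta>] by (simp add: pt_def norm_mult)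

lemma norm_pt_less: "cmod (pt \<theta>) < 1"
  using r_le[of \<theta>] rho_less by (simp add: norm_pt)

definition kernel_bound :: real where "kernel_bound = 1 / (1 - \<rho>)\<^sup>2"

lemma kernel_bounds: "0 \<le> poisson (pt \<theta>) \<phi>" "poisson (pt \<theta>) \<phi> \<le> kernel_bound" "\<bar>poisson (pt \<theta>) \<phi>\<bar> \<le> kernel_bound"
proof -
  show 1: "0 \<le> poisson (pt \<theta>) \<phi>"
    by (rule poisson_nonneg[OF norm_pt_less])
  show "poisson (pt \<theta>) \<phi> \<le> kernel_bound"
    unfolding kernel_bound_def by (rule poisson_le) (auto simp: norm_pt r_le rho_less)
  then show "\<bar>poisson (pt \<theta>) \<phi>\<bar> \<le> kernel_bound"
    using 1 by simp
qed

definition T :: "(real \<Rightarrow> real) \<Rightarrow> real \<Rightarrow> real" where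
  "T h \<theta> = (\<integral>\<phi>. poisson (pt \<theta>) \<phi> * h \<phi> \<partial>circ)"

definition S :: "(real \<Rightarrow> real) \<Rightarrow> real \<Rightarrow> real" where
  "S h \<phi> = (\<integral>\<theta>. poisson (pt \<theta>) \<phi> * h \<theta> \<partial>circ)"

lemma bounded_measurable_poisson: 
  "bounded_measurable (\<lambda>\<phi>. poisson (pt \<theta>) \<phi>)" "bounded_measurable (\<lambda>\<theta>. poisson (pt \<theta>) \<phi>)"
  using kernel_bounds(3) unfolding bounded_measurable_def by (auto intro!: exI[of _ kernel_bound])

lemma bounded_measurable_T: "bounded_measurable h \<Longrightarrow> bounded_measurable (T h)"
  unfolding T_def
  by (rule bounded_measurable_integral[where k = "\<lambda>\<theta> \<phi>. poisson (pt \<theta>) \<phi>", OF _ kernel_bounds(3)])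
    measurable

lemma bounded_measurable_S: "bounded_measurable h \<Longrightarrow> bounded_measurable (S h)"
  unfolding S_def
  by (rule bounded_measurable_integral[where k = "\<lambda>\<phi> \<theta>. poisson (pt \<theta>) \<phi>", OF _ kernel_bounds(3)])
    measurable

lemma T_S_adjoint:
  assumes u: "bounded_measurable u" and v: "bounded_measurable v"
  shows "(\<integral>\<theta>. u \<theta> * T v \<theta> \<partial>circ) = (\<integral>\<phi>. v \<phi> * S u \<phi> \<partial>circ)"
proof -
  have [measurable]: "u \<in> borel_measurable borel" "v \<in> borel_measurable borel" using u v by measurable
  obtain A B where A: "\<And>x. \<bar>u x\<bar> \<le> A" and B: "\<And>x. \<bar>v x\<bar> \<le> B"
    using u v by (auto simp: bounded_measurable_def)
  have "\<bar>u \<theta> * (poisson (pt \<theta>) \<phi> * v \<phi>)\<bar> \<le> A * (kernel_bound * B)" for \<theta> \<phi>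
    unfolding abs_mult by (intro mult_mono kernel_bounds A B) 
     (auto intro: order_trans[OF abs_ge_zero kernel_bounds(3)] order_trans[OF abs_ge_zero A])
  then have "(\<integral>\<theta>. \<integral>\<phi>. u \<theta> * (poisson (pt \<theta>) \<phi> * v \<phi>) \<partial>circ \<partial>circ) 
      = (\<integral>\<phi>. \<integral>\<theta>. u \<theta> * (poisson (pt \<theta>) \<phi> * v \<phi>) \<partial>circ \<partial>circ)"
    by (intro fubini_circ) auto
  moreover have "(\<integral>\<theta>. u \<theta> * (poisson (pt \<theta>) \<phi> * v \<phi>) \<partial>circ) = v \<phi> * S u \<phi>" for \<phi>
    unfolding S_def by (subst integral_mult_right_zero[symmetric]) (simp add: mult_ac)
  ultimately show ?thesis by (simp add: T_def)
qed

text \<open>By the semigroup property the composition has the kernel estimated in \<open>poisson_kernel_bound\<close>, which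
  splits into the kernels of the two operators.\<close>

lemma T_S:
  assumes u: "bounded_measurable u" and nn: "\<And>x. 0 \<le> u x"
  shows "T (S u) \<theta> \<le> 8 * T u \<theta> + 8 * S u \<theta>"
proof -
  have [measurable]: "u \<in> borel_measurable borel" using u by measurable
  obtain A where A: "\<And>x. \<bar>u x\<bar> \<le> A"
    using u by (auto simp: bounded_measurable_def)
  have "\<bar>poisson (pt \<theta>) \<phi> * (poisson (pt t) \<phi> * u t)\<bar> \<le> kernel_bound * (kernel_bound * A)" for t \<phi>
    unfolding abs_mult by (intro mult_mono kernel_bounds A) 
     (auto intro: order_trans[OF abs_ge_zero kernel_bounds(3)] order_trans[OF abs_ge_zero A])
  then have "(\<integral>\<phi>. \<integral>t. poisson (pt \<theta>) \<phi> * (poisson (pt t) \<phi> * u t) \<partial>circ \<partial>circ) 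
      = (\<integral>t. \<integral>\<phi>. poisson (pt \<theta>) \<phi> * (poisson (pt t) \<phi> * u t) \<partial>circ \<partial>circ)"
    by (intro fubini_circ) auto
  then have eq: "T (S u) \<theta> = (\<integral>t. (\<integral>\<phi>. poisson (pt \<theta>) \<phi> * poisson (pt t) \<phi> \<partial>circ) * u t \<partial>circ)"
    by (simp add: T_def S_def mult.assoc flip: integral_mult_left_zero)
  have K: "(\<integral>\<phi>. poisson (pt \<theta>) \<phi> * poisson (pt t) \<phi> \<partial>circ) \<le> 8 * poisson (pt \<theta>) t + 8 * poisson (pt t) \<theta>" for t
    unfolding poisson_semigroup[OF norm_pt_less norm_pt_less] norm_pt 
    using poisson_kernel_bound[of "r \<theta>" "r t" t \<theta>] r_nonneg r_le rho_less unfolding pt_def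
    by (meson le_less_trans)
  have i1: "integrable circ (\<lambda>t. poisson (pt \<theta>) t * u t)" "integrable circ (\<lambda>t. poisson (pt t) \<theta> * u t)"
    by (intro bounded_measurable_integrable bounded_measurable_mult u bounded_measurable_poisson)+
  have "T (S u) \<theta> \<le> (\<integral>t. (8 * poisson (pt \<theta>) t + 8 * poisson (pt t) \<theta>) * u t \<partial>circ)"
    unfolding eq
  proof (rule integral_mono')
    show "integrable circ (\<lambda>t. (8 * poisson (pt \<theta>) t + 8 * poisson (pt t) \<theta>) * u t)"
      using i1 by (simp add: distrib_right mult.assoc)
    show "(\<integral>\<phi>. poisson (pt \<theta>) \<phi> * poisson (pt t) \<phi> \<partial>circ) * u t \<le> (8 * poisson (pt \<theta>) t + 8 * poisson (pt t) \<theta>) * u t" for t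
      by (intro mult_right_mono K nn)
    show "0 \<le> (8 * poisson (pt \<theta>) t + 8 * poisson (pt t) \<theta>) * u t" for t
      by (intro mult_nonneg_nonneg add_nonneg_nonneg kernel_bounds nn) auto
  qed
  also have "\<dots> = 8 * T u \<theta> + 8 * S u \<theta>"
    using i1 by (simp add: distrib_right mult.assoc T_def S_def)
  finally show ?thesis .
qed

text \<open>The admissible bounds for the square of the operator norm of \<^term>\<open>T\<close>.\<close>

definition valid :: "real \<Rightarrow> bool" where
  "valid C \<longleftrightarrow> 0 \<le> C \<and> (\<forall>h. bounded_measurable h \<longrightarrow> (\<forall>x. 0 \<le> h x) \<longrightarrow>
     (\<integral>\<theta>. (T h \<theta>)\<^sup>2 \<partial>circ) \<le> C * (\<integral>\<theta>. (h \<theta>)\<^sup>2 \<partial>circ))"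

lemma T_nonneg: "(\<And>x. 0 \<le> h x) \<Longrightarrow> 0 \<le> T h \<theta>"
  unfolding T_def by (intro integral_nonneg_AE AE_I2 mult_nonneg_nonneg kernel_bounds) auto

text \<open>For \<open>g = T h\<close> and the adjoint \<^term>\<open>S\<close> one has \<open>\<parallel>g\<parallel>\<^sup>2 = \<langle>h, S g\<rangle>\<close> and
  \<open>\<parallel>S g\<parallel>\<^sup>2 = \<langle>g, T (S g)\<rangle> \<le> 16 \<langle>g, T g\<rangle> \<le> 16 sqrt C \<parallel>g\<parallel>\<^sup>2\<close>. Thus a bound for \<^term>\<open>T\<close> yields a bound for \<open>T T*\<close> that
  involves only its square root.\<close>

lemma valid_improve:
  assumes C: "valid C"
  shows "valid (16 * sqrt C)"
  unfolding valid_def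
proof (intro conjI allI impI)
  show "0 \<le> 16 * sqrt C" using C by (simp add: valid_def)
  fix h assume h: "bounded_measurable h" and nn: "\<forall>x. 0 \<le> h x"
  define g where "g = T h"
  define X where "X = (\<integral>\<theta>. (g \<theta>)\<^sup>2 \<partial>circ)"
  define N where "N = (\<integral>\<theta>. (h \<theta>)\<^sup>2 \<partial>circ)"
  have g: "bounded_measurable g" and gnn: "\<And>x. 0 \<le> g x"
    unfolding g_def using bounded_measurable_T[OF h] T_nonneg nn by auto
  have meas[measurable]: "g \<in> borel_measurable circ" "h \<in> borel_measurable circ" "T g \<in> borel_measurable circ"
      "S g \<in> borel_measurable circ"
    using g h bounded_measurable_T[OF g] bounded_measurable_S[OF g] by (auto simp: bounded_measurable_def)
  note sq = bounded_measurable_square_integrable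
  have "0 \<le> X" "0 \<le> N" by (simp_all add: X_def N_def)
  have "X = (\<integral>\<theta>. g \<theta> * T h \<theta> \<partial>circ)" by (simp add: X_def g_def power2_eq_square)
  also have "\<dots> = (\<integral>\<phi>. h \<phi> * S g \<phi> \<partial>circ)" by (rule T_S_adjoint[OF g h])
  finally have 1: "X\<^sup>2 \<le> N * (\<integral>\<phi>. (S g \<phi>)\<^sup>2 \<partial>circ)"
    using Cauchy_Schwarz_integral(2)[OF meas(2,4) sq[OF h] sq[OF bounded_measurable_S[OF g]]] by (simp add: N_def)
  have "(\<integral>\<phi>. (S g \<phi>)\<^sup>2 \<partial>circ) = (\<integral>\<theta>. g \<theta> * T (S g) \<theta> \<partial>circ)"
    using T_S_adjoint[OF g bounded_measurable_S[OF g]] by (simp add: power2_eq_square)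
  also have "\<dots> \<le> (\<integral>\<theta>. g \<theta> * (8 * T g \<theta> + 8 * S g \<theta>) \<partial>circ)"
  proof (rule integral_mono)
    show "integrable circ (\<lambda>\<theta>. g \<theta> * T (S g) \<theta>)"
      by (intro bounded_measurable_integrable bounded_measurable_mult g bounded_measurable_T bounded_measurable_S)
    show "integrable circ (\<lambda>\<theta>. g \<theta> * (8 * T g \<theta> + 8 * S g \<theta>))"
      by (simp add: distrib_left mult.left_commute[of _ 8] bounded_measurable_integrable bounded_measurable_mult g bounded_measurable_T bounded_measurable_S)
  qed (auto intro!: mult_left_mono T_S[OF g gnn] gnn)
  also have "\<dots> = 8 * (\<integral>\<theta>. g \<theta> * T g \<theta> \<partial>circ) + 8 * (\<integral>\<theta>. g \<theta> * S g \<theta> \<partial>circ)"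
    by (simp add: distrib_left mult.left_commute[of _ 8] bounded_measurable_integrable bounded_measurable_mult g bounded_measurable_T bounded_measurable_S)
  also have "(\<integral>\<theta>. g \<theta> * S g \<theta> \<partial>circ) = (\<integral>\<theta>. g \<theta> * T g \<theta> \<partial>circ)"
    using T_S_adjoint[OF g g] by simp
  finally have 2: "(\<integral>\<phi>. (S g \<phi>)\<^sup>2 \<partial>circ) \<le> 16 * (\<integral>\<theta>. g \<theta> * T g \<theta> \<partial>circ)" by simp
  have "(\<integral>\<theta>. g \<theta> * T g \<theta> \<partial>circ)\<^sup>2 \<le> X * (\<integral>\<theta>. (T g \<theta>)\<^sup>2 \<partial>circ)"
    using Cauchy_Schwarz_integral(2)[OF meas(1,3) sq[OF g] sq[OF bounded_measurable_T[OF g]]] by (simp add: X_def)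
  also have "\<dots> \<le> X * (C * X)"
    using C g gnn \<open>0 \<le> X\<close> by (intro mult_left_mono) (auto simp: valid_def X_def)
  finally have "(\<integral>\<theta>. g \<theta> * T g \<theta> \<partial>circ) \<le> sqrt (X * (C * X))"
    by (rule real_le_rsqrt)
  also have "\<dots> = sqrt C * X"
    using \<open>0 \<le> X\<close> by (simp add: real_sqrt_mult)
  finally have 3: "(\<integral>\<phi>. (S g \<phi>)\<^sup>2 \<partial>circ) \<le> 16 * sqrt C * X" using 2 by simp
  have "X\<^sup>2 \<le> N * (16 * sqrt C * X)"
    using 1 3 \<open>0 \<le> N\<close> by (meson mult_left_mono order_trans)
  then have "X \<le> 16 * sqrt C * N"
    using \<open>0 \<le> X\<close> \<open>0 \<le> N\<close> C by (cases "X = 0") (auto simp: power2_eq_square valid_def mult_ac)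
  then show "(\<integral>\<theta>. (T h \<theta>)\<^sup>2 \<partial>circ) \<le> 16 * sqrt C * (\<integral>\<theta>. (h \<theta>)\<^sup>2 \<partial>circ)"
    by (simp add: X_def N_def g_def)
qed

lemma valid_ex: "\<exists>C. valid C"
proof -
  have "valid (kernel_bound\<^sup>2)"
    unfolding valid_def
  proof (intro conjI allI impI)
    fix h assume h: "bounded_measurable h" and nn: "\<forall>x. 0 \<le> h x"
    have [measurable]: "h \<in> borel_measurable borel" using h by measurable
    define N where "N = (\<integral>\<theta>. (h \<theta>)\<^sup>2 \<partial>circ)"
    have "(T h \<theta>)\<^sup>2 \<le> kernel_bound\<^sup>2 * N" for \<theta>
    proof -
      have b: "bounded_measurable (\<lambda>\<phi>. poisson (pt \<theta>) \<phi>)" by (rule bounded_measurable_poisson)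
      have "(T h \<theta>)\<^sup>2 \<le> (\<integral>\<phi>. (poisson (pt \<theta>) \<phi>)\<^sup>2 \<partial>circ) * N"
        unfolding T_def N_def
        by (intro Cauchy_Schwarz_integral bounded_measurable_square_integrable h b) auto
      also have "(\<integral>\<phi>. (poisson (pt \<theta>) \<phi>)\<^sup>2 \<partial>circ) \<le> (\<integral>\<phi>. kernel_bound\<^sup>2 \<partial>circ)"
        using bounded_measurable_square_integrable[OF b] by (intro integral_mono power_mono kernel_bounds) auto
      finally show ?thesis by (simp add: N_def mult_right_mono circ.prob_space[simplified])
    qed
    then have "(\<integral>\<theta>. (T h \<theta>)\<^sup>2 \<partial>circ) \<le> (\<integral>\<theta>. kernel_bound\<^sup>2 * N \<partial>circ)"
      by (intro integral_mono bounded_measurable_square_integrable bounded_measurable_T h) auto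
    then show "(\<integral>\<theta>. (T h \<theta>)\<^sup>2 \<partial>circ) \<le> kernel_bound\<^sup>2 * (\<integral>\<theta>. (h \<theta>)\<^sup>2 \<partial>circ)"
      by (simp add: N_def circ.prob_space[simplified])
  qed simp
  then show ?thesis ..
qed

text \<open>The least admissible constant satisfies \<open>c \<le> 16 sqrt c\<close>.\<close>

lemma valid_256: "valid 256"
proof -
  define V where "V = {C. valid C}"
  define c where "c = Inf V"
  have ne: "V \<noteq> {}" using valid_ex by (auto simp: V_def)
  have bb: "bdd_below V" by (rule bdd_belowI[of _ 0]) (auto simp: V_def valid_def)
  have c0: "0 \<le> c" unfolding c_def by (rule cInf_greatest[OF ne]) (auto simp: V_def valid_def)
  have "valid c"
    unfolding valid_def
  proof (intro conjI allI impI c0)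
    fix h assume h: "bounded_measurable h" and nn: "\<forall>x. 0 \<le> h x"
    define X where "X = (\<integral>\<theta>. (T h \<theta>)\<^sup>2 \<partial>circ)"
    define N where "N = (\<integral>\<theta>. (h \<theta>)\<^sup>2 \<partial>circ)"
    have X: "X \<le> C * N" if "C \<in> V" for C using that h nn by (auto simp: V_def valid_def X_def N_def)
    have "0 \<le> N" by (simp add: N_def)
    have "X \<le> c * N"
    proof (cases "N = 0")
      case True
      then show ?thesis using X ne by auto
    next
      case False
      then have "X / N \<le> C" if "C \<in> V" for C using X[OF that] \<open>0 \<le> N\<close> by (simp add: field_simps)
      then have "X / N \<le> c" unfolding c_def by (intro cInf_greatest ne)
      then show ?thesis using False \<open>0 \<le> N\<close> by (simp add: field_simps)
    qed
    then show "(\<integral>\<theta>. (T h \<theta>)\<^sup>2 \<partial>circ) \<le> c * (\<integral>\<theta>. (h \<theta>)\<^sup>2 \<partial>circ)" by (simp add: X_def N_def)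
  qed
  then have "16 * sqrt c \<in> V" using valid_improve by (simp add: V_def)
  then have "c \<le> 16 * sqrt c" unfolding c_def using bb by (simp add: cInf_lower)
  then have "sqrt c * sqrt c \<le> 16 * sqrt c" using c0 by simp
  then have "sqrt c \<le> 16" using c0 mult_le_cancel_right[of "sqrt c" "sqrt c" 16] by (cases "c = 0") auto
  then have "c \<le> 256" using c0 sqrt_le_D[of c 16] by simp
  show ?thesis
    unfolding valid_def
  proof (intro conjI allI impI)
    fix h assume "bounded_measurable h" "\<forall>x. 0 \<le> h x"
    then have "(\<integral>\<theta>. (T h \<theta>)\<^sup>2 \<partial>circ) \<le> c * (\<integral>\<theta>. (h \<theta>)\<^sup>2 \<partial>circ)" using \<open>valid c\<close> by (auto simp: valid_def)
    also have "\<dots> \<le> 256 * (\<integral>\<theta>. (h \<theta>)\<^sup>2 \<partial>circ)" by (intro mult_right_mono \<open>c \<le> 256\<close>) simp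
    finally show "(\<integral>\<theta>. (T h \<theta>)\<^sup>2 \<partial>circ) \<le> 256 * (\<integral>\<theta>. (h \<theta>)\<^sup>2 \<partial>circ)" .
  qed simp
qed

lemma maximal_holomorphic_closed:
  assumes f: "f holomorphic_on cball 0 1"
  shows "(\<integral>\<theta>. (cmod (f (pt \<theta>)))\<^sup>2 \<partial>circ) \<le> 256 * (\<integral>\<theta>. (cmod (f (cis \<theta>)))\<^sup>2 \<partial>circ)"
proof -
  define h where "h = (\<lambda>\<theta>. cmod (f (cis \<theta>)))"
  have cont: "continuous_on (cball 0 1) f" by (rule holomorphic_on_imp_continuous_on[OF f])
  then have "compact (f ` cball 0 1)" by (intro compact_continuous_image) auto
  then obtain B where B: "\<And>z. z \<in> cball 0 1 \<Longrightarrow> cmod (f z) \<le> B"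
    unfolding compact_eq_bounded_closed bounded_iff by (metis imageI)
  have cont2: "continuous_on (sphere 0 1) (\<lambda>z. cmod (f z))" 
    by (intro continuous_intros continuous_on_subset[OF cont]) auto
  have h: "bounded_measurable h" 
    unfolding bounded_measurable_def h_def using integrable_circ_cis(2)[OF cont2] B by (auto intro!: exI[of _ B])
  have le: "cmod (f (pt \<theta>)) \<le> T h \<theta>" for \<theta>
  proof -
    have "cmod (f (pt \<theta>)) = cmod (\<integral>\<phi>. poisson (pt \<theta>) \<phi> *\<^sub>R f (cis \<phi>) \<partial>circ)"
      by (simp add: poisson_circ[OF f norm_pt_less])
    also have "\<dots> \<le> (\<integral>\<phi>. cmod (poisson (pt \<theta>) \<phi> *\<^sub>R f (cis \<phi>)) \<partial>circ)"
      by (rule integral_norm_bound)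
    also have "\<dots> = T h \<theta>"
      by (simp add: T_def h_def kernel_bounds(1))
    finally show ?thesis .
  qed
  have "(\<integral>\<theta>. (cmod (f (pt \<theta>)))\<^sup>2 \<partial>circ) \<le> (\<integral>\<theta>. (T h \<theta>)\<^sup>2 \<partial>circ)"
    by (intro integral_mono' bounded_measurable_square_integrable bounded_measurable_T h power_mono le) auto
  also have "\<dots> \<le> 256 * (\<integral>\<theta>. (h \<theta>)\<^sup>2 \<partial>circ)"
    using valid_256 h unfolding valid_def by (auto simp: h_def)
  finally show ?thesis by (simp add: h_def)
qed

end

section \<open>Maximal functions in the Hardy space of the disk\<close>

lemma dilate_in_ball: "0 \<le> r \<Longrightarrow> r < 1 \<Longrightarrow> cmod z \<le> 1 \<Longrightarrow> of_real r * z \<in> ball 0 1"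
  using mult_left_le[of "cmod z" r] by (auto simp: norm_mult)

lemma holomorphic_on_dilate:
  assumes "f holomorphic_on ball 0 1" "0 \<le> r" "r < 1"
  shows "(\<lambda>z. f (of_real r * z)) holomorphic_on cball 0 1"
proof -
  have "(f \<circ> (\<lambda>z. of_real r * z)) holomorphic_on cball 0 1"
    using assms dilate_in_ball
    by (intro holomorphic_on_compose_gen[OF _ assms(1)] holomorphic_intros) auto
  then show ?thesis by (simp add: o_def)
qed

lemma integrable_circ_holomorphic:
  assumes f: "f holomorphic_on ball 0 1" and r: "0 \<le> r" "r < 1"
  shows "(\<lambda>\<theta>. f (of_real r * cis \<theta>)) \<in> borel_measurable borel"
    and "integrable circ (\<lambda>\<theta>. f (of_real r * cis \<theta>))"
    and "integrable circ (\<lambda>\<theta>. (cmod (f (of_real r * cis \<theta>)))\<^sup>2)"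
proof -
  have c: "continuous_on (sphere 0 1) (\<lambda>z. f (of_real r * z))"
    by (rule continuous_on_subset[OF holomorphic_on_imp_continuous_on[OF holomorphic_on_dilate[OF f r]]]) auto
  show "(\<lambda>\<theta>. f (of_real r * cis \<theta>)) \<in> borel_measurable borel" "integrable circ (\<lambda>\<theta>. f (of_real r * cis \<theta>))"
    using integrable_circ_cis[OF c] by auto
  show "integrable circ (\<lambda>\<theta>. (cmod (f (of_real r * cis \<theta>)))\<^sup>2)"
    using c by (intro integrable_circ_cis(1)[of "\<lambda>z. (cmod (f (of_real r * z)))\<^sup>2"] continuous_intros)
qed

lemma nn_integral_circle_eq:
  assumes f: "f holomorphic_on ball 0 1" and r: "0 \<le> r" "r < 1"
  shows "(\<integral>\<^sup>+\<theta>\<in>{0..2 * pi}. ennreal ((cmod (f (of_real r * cis \<theta>)))\<^sup>2) \<partial>lborel)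
    = ennreal (2 * pi * (\<integral>\<theta>. (cmod (f (of_real r * cis \<theta>)))\<^sup>2 \<partial>circ))"
proof -
  let ?g = "\<lambda>\<theta>. (cmod (f (of_real r * cis \<theta>)))\<^sup>2"
  have [measurable]: "?g \<in> borel_measurable borel"
    using integrable_circ_holomorphic(1)[OF f r] by measurable
  have "set_integrable lborel {0..2 * pi} ?g"
    using integrable_circ_holomorphic(3)[OF f r] by (simp add: integrable_circ)
  then have "(\<integral>\<^sup>+\<theta>\<in>{0..2 * pi}. ennreal (?g \<theta>) \<partial>lborel) = ennreal (LINT \<theta>:{0..2 * pi}|lborel. ?g \<theta>)"
    unfolding set_integrable_def set_lebesgue_integral_def
    by (subst nn_integral_eq_integral[symmetric]) (auto intro!: nn_integral_cong split: split_indicator)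
  then show ?thesis by (simp add: integral_circ)
qed

lemma hardy_disk_iff:
  "f \<in> hardy_disk \<longleftrightarrow> f holomorphic_on ball 0 1 \<and>
     (\<exists>B. \<forall>r. 0 \<le> r \<and> r < 1 \<longrightarrow> (\<integral>\<theta>. (cmod (f (of_real r * cis \<theta>)))\<^sup>2 \<partial>circ) \<le> B)" (is "_ \<longleftrightarrow> _ \<and> ?R")
proof (cases "f holomorphic_on ball 0 1")
  case f: True
  define A where "A = (\<lambda>r. \<integral>\<theta>. (cmod (f (of_real r * cis \<theta>)))\<^sup>2 \<partial>circ)"
  define S where "S = (SUP r\<in>{0<..<1}. \<integral>\<^sup>+\<theta>\<in>{0..2 * pi}. ennreal ((cmod (f (of_real r * cis \<theta>)))\<^sup>2) \<partial>lborel)"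
  have S: "S = (SUP r\<in>{0<..<1}. ennreal (2 * pi * A r))"
    unfolding S_def A_def by (intro SUP_cong refl nn_integral_circle_eq f) auto
  have A0: "0 \<le> A r" for r by (simp add: A_def)
  have "S < \<infinity> \<longleftrightarrow> ?R"
  proof
    assume fin: "S < \<infinity>"
    then obtain B where B: "S = ennreal B" "0 \<le> B" by (cases S) auto
    have "A r \<le> B" if "0 < r" "r < 1" for r
    proof -
      have "ennreal (2 * pi * A r) \<le> ennreal B"
        unfolding B(1)[symmetric] S using that by (intro SUP_upper) auto
      then have "2 * pi * A r \<le> B" using B(2) by simp
      moreover have "1 * A r \<le> 2 * pi * A r"
        using pi_ge_two A0 by (intro mult_right_mono) auto
      ultimately show ?thesis by simp
    qed
    then have "\<forall>r. 0 \<le> r \<and> r < 1 \<longrightarrow> A r \<le> max B (A 0)"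
      by (metis max.cobounded1 max.cobounded2 order_le_less order_trans)
    then show ?R unfolding A_def by blast
  next
    assume ?R
    then obtain B where B: "\<And>r. 0 \<le> r \<Longrightarrow> r < 1 \<Longrightarrow> A r \<le> B" unfolding A_def by blast
    have "S \<le> ennreal (2 * pi * B)"
      unfolding S by (rule SUP_least) (auto intro!: ennreal_leI B)
    then show "S < \<infinity>" by (auto intro: le_less_trans)
  qed
  then show ?thesis using f by (simp add: hardy_disk_def S_def)
qed (auto simp: hardy_disk_def)

lemma hardy_disk_holomorphic: "f \<in> hardy_disk \<Longrightarrow> f holomorphic_on ball 0 1"
  by (simp add: hardy_disk_def)

text \<open>The radius among \<open>0, q 0, \<dots>, q (m - 1)\<close> at which the modulus of \<open>f\<close> is largest. Comparisons alone
  determine it, so it depends measurably on the angle.\<close>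

primrec record_radius :: "(complex \<Rightarrow> complex) \<Rightarrow> (nat \<Rightarrow> real) \<Rightarrow> nat \<Rightarrow> real \<Rightarrow> real" where
  "record_radius f q 0 \<theta> = 0"
| "record_radius f q (Suc m) \<theta> =
     (if cmod (f (of_real (record_radius f q m \<theta>) * cis \<theta>)) < cmod (f (of_real (q m) * cis \<theta>))
      then q m else record_radius f q m \<theta>)"

lemma rational_sequence:
  fixes r b :: real
  assumes "r < b"
  obtains x where "\<And>n. x n \<in> \<rat>" "\<And>n. r < x n" "\<And>n. x n < b" "x \<longlonglongrightarrow> r"
proof -
  have "\<exists>x\<in>\<rat>. r < x \<and> x < r + (b - r) / real (Suc n)" for n
    using assms by (intro Rats_dense_in_real) auto
  then obtain x where x: "\<And>n. x n \<in> \<rat>" "\<And>n. r < x n" "\<And>n. x n < r + (b - r) / real (Suc n)"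
    by metis
  have "x n < b" for n
  proof -
    have "(b - r) / real (Suc n) \<le> (b - r) / 1" using assms by (intro divide_left_mono) auto
    then show ?thesis using x(3)[of n] by simp
  qed
  moreover have "x \<longlonglongrightarrow> r"
  proof (rule tendsto_sandwich[of "\<lambda>n. r" x _ "\<lambda>n. r + (b - r) / real (Suc n)"])
    have "(\<lambda>n. r + (b - r) / real (Suc n)) \<longlonglongrightarrow> r + 0"
      by (intro tendsto_add tendsto_const LIMSEQ_Suc[OF lim_const_over_n])
    then show "(\<lambda>n. r + (b - r) / real (Suc n)) \<longlonglongrightarrow> r" by simp
    show "\<forall>\<^sub>F n in sequentially. r \<le> x n" 
      by (intro always_eventually allI less_imp_le x)
    show "\<forall>\<^sub>F n in sequentially. x n \<le> r + (b - r) / real (Suc n)"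
      by (intro always_eventually allI less_imp_le x)
    show "(\<lambda>n. r) \<longlonglongrightarrow> r" by simp
  qed
  ultimately show thesis using that x by blast
qed

text \<open>The record radii along an enumeration of the rationals of \<open>[0, 1)\<close> are radius selections, and the
  constant of \<open>maximal_holomorphic_closed\<close> is the same for all of them. Monotone convergence gives the
  supremum over all rational radii; continuity along a radius gives the rest.\<close>

lemma maximal_theorem:
  assumes f: "f holomorphic_on ball 0 1"
    and B: "\<And>r. 0 \<le> r \<Longrightarrow> r < 1 \<Longrightarrow> (\<integral>\<theta>. (cmod (f (of_real r * cis \<theta>)))\<^sup>2 \<partial>circ) \<le> B"
  shows "\<exists>M. M \<in> borel_measurable borel \<and> (\<forall>\<theta>. 0 \<le> M \<theta>) \<and> integrable circ (\<lambda>\<theta>. (M \<theta>)\<^sup>2) \<and>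
     (\<integral>\<theta>. (M \<theta>)\<^sup>2 \<partial>circ) \<le> 256 * B \<and>
     (AE \<theta> in circ. \<forall>r. 0 \<le> r \<and> r < 1 \<longrightarrow> cmod (f (of_real r * cis \<theta>)) \<le> M \<theta>)"
proof -
  define f0 where "f0 = (\<lambda>z. if z \<in> ball 0 1 then f z else 0)"
  have [measurable]: "f0 \<in> borel_measurable borel"
    unfolding f0_def using holomorphic_on_imp_continuous_on[OF f]
    by (intro borel_measurable_continuous_on_if) auto
  define Q where "Q = \<rat> \<inter> {0..<1::real}"
  have cQ: "countable Q" unfolding Q_def by (intro countable_Int1 countable_rat)
  have neQ: "Q \<noteq> {}" unfolding Q_def by (auto intro!: exI[of _ 0])
  define q where "q = from_nat_into Q"
  have q: "0 \<le> q m" "q m < 1" for m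
    using from_nat_into[OF neQ, of m] by (auto simp: Q_def q_def)
  have qsurj: "\<exists>m. x = q m" if "x \<in> \<rat>" "0 \<le> x" "x < 1" for x
    using from_nat_into_surj[OF cQ, of x] that by (auto simp: Q_def q_def)
  define R where "R = record_radius f0 q"
  have f0: "f0 (of_real x * cis \<theta>) = f (of_real x * cis \<theta>)" if "0 \<le> x" "x < 1" for x \<theta>
    using that by (simp add: f0_def norm_mult)
  have R_meas [measurable]: "R m \<in> borel_measurable borel" for m
    unfolding R_def by (induction m) simp_all
  have R_bd: "\<exists>\<rho>. 0 \<le> \<rho> \<and> \<rho> < 1 \<and> (\<forall>\<theta>. 0 \<le> R m \<theta> \<and> R m \<theta> \<le> \<rho>)" for m
  proof (induction m)
    case 0
    then show ?case by (auto simp: R_def intro!: exI[of _ 0])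
  next
    case (Suc m)
    then obtain \<rho> where "0 \<le> \<rho>" "\<rho> < 1" "\<forall>\<theta>. 0 \<le> R m \<theta> \<and> R m \<theta> \<le> \<rho>" by blast
    then show ?case using q[of m] 
      by (intro exI[of _ "max \<rho> (q m)"]) (auto simp: R_def intro: max.coboundedI1)
  qed
  define G where "G = (\<lambda>m \<theta>. (cmod (f0 (of_real (R m \<theta>) * cis \<theta>)))\<^sup>2)"
  have [measurable]: "G m \<in> borel_measurable borel" for m
    unfolding G_def by measurable
  have G_step: "G m \<theta> \<le> G (Suc m) \<theta>" and G_q: "(cmod (f0 (of_real (q m) * cis \<theta>)))\<^sup>2 \<le> G (Suc m) \<theta>" for m \<theta>
    unfolding G_def R_def by (auto intro!: power_mono)
  have inc: "incseq (\<lambda>m \<theta>. ennreal (G m \<theta>))"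
    by (intro incseq_SucI le_funI ennreal_leI G_step)
  have GB: "(\<integral>\<^sup>+\<theta>. ennreal (G m \<theta>) \<partial>circ) \<le> ennreal (256 * B)" for m
  proof -
    obtain \<rho> where \<rho>: "0 \<le> \<rho>" "\<rho> < 1" "\<And>\<theta>. 0 \<le> R m \<theta>" "\<And>\<theta>. R m \<theta> \<le> \<rho>" using R_bd[of m] by blast
    \<comment> \<open>Dilating by \<open>s\<close> makes \<open>f\<close> holomorphic on the closed disk; the radii are rescaled accordingly.\<close>
    define s where "s = (1 + \<rho>) / 2"
    have s: "0 < s" "s < 1" "\<rho> < s" using \<rho> by (auto simp: s_def)
    interpret radius_selection "\<lambda>\<theta>. R m \<theta> / s" "\<rho> / s"
      using \<rho> s by unfold_locales (auto simp: field_simps)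
    let ?g = "\<lambda>z. f (of_real s * z)"
    have hol: "?g holomorphic_on cball 0 1" using s by (intro holomorphic_on_dilate[OF f]) auto
    have eq: "(cmod (?g (pt \<theta>)))\<^sup>2 = G m \<theta>" for \<theta>
      using s f0[of "R m \<theta>"] \<rho> by (simp add: pt_def G_def le_less_trans[OF \<rho>(4)])
    have "bounded (?g ` cball 0 1)"
      by (intro compact_imp_bounded compact_continuous_image holomorphic_on_imp_continuous_on[OF hol]) auto
    then obtain K where K: "\<And>z. z \<in> cball 0 1 \<Longrightarrow> cmod (?g z) \<le> K"
      unfolding bounded_iff by (metis imageI)
    have int: "integrable circ (G m)"
    proof (rule integrable_circ_bounded[where B = "K\<^sup>2"])
      fix \<theta>
      have "pt \<theta> \<in> cball 0 1" using norm_pt_less[of \<theta>] by simp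
      then show "norm (G m \<theta>) \<le> K\<^sup>2"
        unfolding eq[symmetric] using K by (auto intro!: power_mono)
    qed simp
    have "(\<integral>\<theta>. G m \<theta> \<partial>circ) \<le> 256 * (\<integral>\<theta>. (cmod (f (of_real s * cis \<theta>)))\<^sup>2 \<partial>circ)"
      using maximal_holomorphic_closed[OF hol] by (simp add: eq)
    also have "\<dots> \<le> 256 * B" using B[of s] s by simp
    finally show ?thesis
      using int by (subst nn_integral_eq_integral) (auto simp: G_def intro!: ennreal_leI)
  qed
  define U where "U = (\<lambda>\<theta>. SUP m. ennreal (G m \<theta>))"
  have [measurable]: "U \<in> borel_measurable borel" unfolding U_def by measurable
  have UB: "(\<integral>\<^sup>+\<theta>. U \<theta> \<partial>circ) \<le> ennreal (256 * B)"
    unfolding U_def by (subst nn_integral_monotone_convergence_SUP) (auto intro!: SUP_least GB inc)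
  then have fin: "AE \<theta> in circ. U \<theta> \<noteq> \<infinity>"
    by (intro nn_integral_PInf_AE) (auto simp: top_unique)
  define M where "M = (\<lambda>\<theta>. sqrt (enn2real (U \<theta>)))"
  have [measurable]: "M \<in> borel_measurable borel" unfolding M_def by measurable
  have M2: "ennreal ((M \<theta>)\<^sup>2) = U \<theta>" if "U \<theta> \<noteq> \<infinity>" for \<theta>
    using that by (simp add: M_def less_top)
  have "(\<integral>\<^sup>+\<theta>. ennreal ((M \<theta>)\<^sup>2) \<partial>circ) = (\<integral>\<^sup>+\<theta>. U \<theta> \<partial>circ)"
    using fin M2 by (intro nn_integral_cong_AE) auto
  with UB have MB: "(\<integral>\<^sup>+\<theta>. ennreal ((M \<theta>)\<^sup>2) \<partial>circ) \<le> ennreal (256 * B)" by simp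
  then have int: "integrable circ (\<lambda>\<theta>. (M \<theta>)\<^sup>2)"
    by (intro integrableI_bounded) (auto intro: le_less_trans)
  have B0: "0 \<le> B" using order_trans[OF _ B[of 0]] by simp
  have "(\<integral>\<theta>. (M \<theta>)\<^sup>2 \<partial>circ) \<le> 256 * B"
    using MB int B0 by (subst (asm) nn_integral_eq_integral) auto
  moreover have "AE \<theta> in circ. \<forall>r. 0 \<le> r \<and> r < 1 \<longrightarrow> cmod (f (of_real r * cis \<theta>)) \<le> M \<theta>"
    using fin
  proof eventually_elim
    case (elim \<theta>)
    have rat: "cmod (f (of_real x * cis \<theta>)) \<le> M \<theta>" if x: "x \<in> \<rat>" "0 \<le> x" "x < 1" for x
    proof -
      obtain m where m: "x = q m" using qsurj[OF x] by blast
      have "ennreal ((cmod (f (of_real x * cis \<theta>)))\<^sup>2) \<le> ennreal (G (Suc m) \<theta>)"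
        using G_q[where m=m and \<theta>=\<theta>] f0[OF x(2,3)] by (intro ennreal_leI) (simp add: m)
      also have "\<dots> \<le> U \<theta>" unfolding U_def by (rule SUP_upper) simp
      also have "\<dots> = ennreal ((M \<theta>)\<^sup>2)" using M2 elim by simp
      finally have "(cmod (f (of_real x * cis \<theta>)))\<^sup>2 \<le> (M \<theta>)\<^sup>2" by simp
      then show ?thesis by (rule power2_le_imp_le) (simp add: M_def)
    qed
    show ?case
    proof (intro allI impI, elim conjE)
      fix r :: real assume r: "0 \<le> r" "r < 1"
      obtain x where x: "\<And>n. x n \<in> \<rat>" "\<And>n. r < x n" "\<And>n. x n < 1" "x \<longlonglongrightarrow> r"
        using rational_sequence[OF r(2)] by blast
      have x1: "0 \<le> x n" for n using x(2)[of n] r by simp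
      from x(4) have "(\<lambda>n. of_real (x n) * cis \<theta>) \<longlonglongrightarrow> of_real r * cis \<theta>"
        by (intro tendsto_intros)
      moreover have "isCont f (of_real r * cis \<theta>)"
        using holomorphic_on_imp_continuous_on[OF f] r by (auto simp: continuous_on_eq_continuous_at norm_mult)
      ultimately have "(\<lambda>n. f (of_real (x n) * cis \<theta>)) \<longlonglongrightarrow> f (of_real r * cis \<theta>)"
        by (metis isCont_tendsto_compose)
      then have "(\<lambda>n. cmod (f (of_real (x n) * cis \<theta>))) \<longlonglongrightarrow> cmod (f (of_real r * cis \<theta>))"
        by (rule tendsto_norm)
      then show "cmod (f (of_real r * cis \<theta>)) \<le> M \<theta>"
        by (rule LIMSEQ_le_const2) (auto intro!: rat x x1)
    qed
  qed
  ultimately show ?thesis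
    using int by (intro exI[of _ M]) (auto simp: M_def)
qed

lemma maximal_hardy:
  assumes "f \<in> hardy_disk"
  obtains M where "M \<in> borel_measurable borel" "\<And>\<theta>. 0 \<le> M \<theta>" "integrable circ (\<lambda>\<theta>. (M \<theta>)\<^sup>2)"
    "AE \<theta> in circ. \<forall>r. 0 \<le> r \<and> r < 1 \<longrightarrow> cmod (f (of_real r * cis \<theta>)) \<le> M \<theta>"
proof -
  obtain B where f: "f holomorphic_on ball 0 1"
    and B: "\<And>r. 0 \<le> r \<Longrightarrow> r < 1 \<Longrightarrow> (\<integral>\<theta>. (cmod (f (of_real r * cis \<theta>)))\<^sup>2 \<partial>circ) \<le> B"
    using assms unfolding hardy_disk_iff by blast
  show thesis
    using maximal_theorem[OF f B] that by blast
qed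

section \<open>Parseval's identity and Taylor coefficients\<close>

lemma integral_cis_mult: "(\<integral>\<theta>. cis \<theta> ^ m * cnj (cis \<theta> ^ n) \<partial>circ) = (if m = n then 1 else 0)"
proof -
  have *: "(\<integral>\<theta>. cis \<theta> ^ m * cnj (cis \<theta> ^ n) \<partial>circ) = (if m = n then 1 else 0)" if "n \<le> m" for m n
  proof -
    have "cis \<theta> ^ m * cnj (cis \<theta> ^ n) = cis \<theta> ^ (m - n)" for \<theta>
    proof -
      have "cis \<theta> ^ m = cis \<theta> ^ (m - n) * cis \<theta> ^ n" using that by (simp flip: power_add)
      moreover have "cis \<theta> ^ n * cnj (cis \<theta> ^ n) = 1" 
        unfolding complex_norm_square[symmetric] by (simp add: norm_power)
      ultimately show ?thesis by (simp add: mult.assoc)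
    qed
    moreover have "(\<integral>\<theta>. cis \<theta> ^ (m - n) \<partial>circ) = 0 ^ (m - n)"
      by (rule mean_value_circ[of "\<lambda>z. z ^ (m - n)"]) (auto intro!: holomorphic_intros)
    ultimately show ?thesis using that by (auto simp: power_0_left)
  qed
  show ?thesis
  proof (cases "n \<le> m")
    case False
    have "(\<integral>\<theta>. cis \<theta> ^ m * cnj (cis \<theta> ^ n) \<partial>circ) = (\<integral>\<theta>. cnj (cis \<theta> ^ n * cnj (cis \<theta> ^ m)) \<partial>circ)"
      by (simp add: mult.commute)
    also have "\<dots> = cnj (\<integral>\<theta>. cis \<theta> ^ n * cnj (cis \<theta> ^ m) \<partial>circ)"
      by (rule Bochner_Integration.integral_cnj)
    finally show ?thesis using *[of m n] False by (simp only:) simp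
  qed (rule *)
qed

lemma parseval_finite:
  "(\<integral>\<theta>. (cmod (\<Sum>n<N. a n * cis \<theta> ^ n))\<^sup>2 \<partial>circ) = (\<Sum>n<N. (cmod (a n))\<^sup>2)"
proof -
  have int: "integrable circ (\<lambda>\<theta>. cis \<theta> ^ i * cnj (cis \<theta> ^ j))" for i j
    by (intro integrable_circ_cis(1)[of "\<lambda>z. z ^ i * cnj (z ^ j)"] continuous_intros)
  have "complex_of_real (\<integral>\<theta>. (cmod (\<Sum>n<N. a n * cis \<theta> ^ n))\<^sup>2 \<partial>circ)
      = (\<integral>\<theta>. of_real ((cmod (\<Sum>n<N. a n * cis \<theta> ^ n))\<^sup>2) \<partial>circ)"
    by (rule integral_complex_of_real[symmetric])
  also have "\<dots> = (\<integral>\<theta>. (\<Sum>i<N. \<Sum>j<N. (a i * cnj (a j)) * (cis \<theta> ^ i * cnj (cis \<theta> ^ j))) \<partial>circ)"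
    unfolding complex_norm_square cnj_sum sum_product by (simp add: mult_ac)
  also have "\<dots> = (\<Sum>i<N. \<Sum>j<N. (a i * cnj (a j)) * (if i = j then 1 else 0))"
    unfolding integral_cis_mult[symmetric]
    using int by (simp add: Bochner_Integration.integral_sum)
  also have "\<dots> = (\<Sum>i<N. of_real ((cmod (a i))\<^sup>2))"
    unfolding complex_norm_square by (simp add: if_distrib cong: if_cong)
  also have "\<dots> = of_real (\<Sum>i<N. (cmod (a i))\<^sup>2)" by simp
  finally show ?thesis by (simp only: of_real_eq_iff)
qed

lemma parseval_abs_summable:
  assumes a: "summable (\<lambda>n. cmod (a n))"
    and g: "\<And>\<theta>. (\<lambda>n. a n * cis \<theta> ^ n) sums g \<theta>"
  shows "(\<lambda>n. (cmod (a n))\<^sup>2) sums (\<integral>\<theta>. (cmod (g \<theta>))\<^sup>2 \<partial>circ)"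
proof -
  have lim: "(\<lambda>N. \<Sum>n<N. a n * cis \<theta> ^ n) \<longlonglongrightarrow> g \<theta>" for \<theta> using g by (simp add: sums_def)
  have [measurable]: "g \<in> borel_measurable borel"
    by (rule borel_measurable_LIMSEQ_metric[OF _ lim]) auto
  have bd: "cmod (\<Sum>n<N. a n * cis \<theta> ^ n) \<le> (\<Sum>n. cmod (a n))" for N \<theta>
    by (rule order_trans[OF norm_sum], simp add: norm_mult norm_power, rule sum_le_suminf[OF a]) auto
  have "(\<lambda>N. \<integral>\<theta>. (cmod (\<Sum>n<N. a n * cis \<theta> ^ n))\<^sup>2 \<partial>circ) \<longlonglongrightarrow> (\<integral>\<theta>. (cmod (g \<theta>))\<^sup>2 \<partial>circ)"
  proof (rule integral_dominated_convergence[where w = "\<lambda>_. (\<Sum>n. cmod (a n))\<^sup>2"])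
    show "AE x in circ. (\<lambda>N. (cmod (\<Sum>n<N. a n * cis x ^ n))\<^sup>2) \<longlonglongrightarrow> (cmod (g x))\<^sup>2"
      by (intro AE_I2 tendsto_intros lim)
    show "AE x in circ. norm ((cmod (\<Sum>n<N. a n * cis x ^ n))\<^sup>2) \<le> (\<Sum>n. cmod (a n))\<^sup>2" for N
      using bd by (intro AE_I2) (auto intro!: power_mono)
  qed auto
  then show ?thesis by (simp add: parseval_finite sums_def)
qed

lemma parseval_disk:
  assumes f: "\<And>z. z \<in> ball 0 1 \<Longrightarrow> (\<lambda>n. c n * z ^ n) sums f z" and r: "0 \<le> r" "r < 1"
  shows "(\<lambda>n. (cmod (c n))\<^sup>2 * r ^ (2 * n)) sums (\<integral>\<theta>. (cmod (f (of_real r * cis \<theta>)))\<^sup>2 \<partial>circ)"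
proof -
  have "summable (\<lambda>n. c n * of_real ((1 + r) / 2) ^ n)"
    using f[of "of_real ((1 + r) / 2)"] r by (auto simp: sums_iff simp del: of_real_divide of_real_add)
  then have "summable (\<lambda>n. cmod (c n * of_real r ^ n))"
    by (rule powser_insidea) (use r in \<open>auto simp del: of_real_divide of_real_add\<close>)
  moreover have "(\<lambda>n. c n * of_real r ^ n * cis \<theta> ^ n) sums f (of_real r * cis \<theta>)" for \<theta>
    using f[of "of_real r * cis \<theta>"] r by (simp add: norm_mult power_mult_distrib mult_ac)
  ultimately have "(\<lambda>n. (cmod (c n * of_real r ^ n))\<^sup>2) sums (\<integral>\<theta>. (cmod (f (of_real r * cis \<theta>)))\<^sup>2 \<partial>circ)"
    by (rule parseval_abs_summable)
  moreover have "(cmod (c n * of_real r ^ n))\<^sup>2 = (cmod (c n))\<^sup>2 * r ^ (2 * n)" for n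
    using r by (simp add: norm_mult norm_power power_mult_distrib mult.commute flip: power_mult)
  ultimately show ?thesis by simp
qed

lemma disk_series_bound:
  assumes f: "\<And>z. z \<in> ball 0 1 \<Longrightarrow> (\<lambda>n. c n * z ^ n) sums f z" and c: "summable (\<lambda>n. (cmod (c n))\<^sup>2)"
    and r: "0 \<le> r" "r < 1"
  shows "(\<integral>\<theta>. (cmod (f (of_real r * cis \<theta>)))\<^sup>2 \<partial>circ) \<le> (\<Sum>n. (cmod (c n))\<^sup>2)"
proof -
  note s = parseval_disk[OF f r]
  have "(\<integral>\<theta>. (cmod (f (of_real r * cis \<theta>)))\<^sup>2 \<partial>circ) = (\<Sum>n. (cmod (c n))\<^sup>2 * r ^ (2 * n))"
    using s by (simp add: sums_iff)
  also have "\<dots> \<le> (\<Sum>n. (cmod (c n))\<^sup>2)"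
    using s r by (intro suminf_le c) (auto simp: sums_iff power_le_one mult_left_le)
  finally show ?thesis .
qed

lemma hardy_disk_seriesI:
  assumes f: "\<And>z. z \<in> ball 0 1 \<Longrightarrow> (\<lambda>n. c n * z ^ n) sums f z" and c: "summable (\<lambda>n. (cmod (c n))\<^sup>2)"
  shows "f \<in> hardy_disk"
  unfolding hardy_disk_iff
proof (intro conjI exI allI impI)
  show "f holomorphic_on ball 0 1"
    by (rule power_series_holomorphic[of _ _ c]) (use f in simp)
qed (use disk_series_bound[OF f c] in auto)

lemma hardy_disk_seriesE:
  assumes "f \<in> hardy_disk"
  obtains c where "\<And>z. z \<in> ball 0 1 \<Longrightarrow> (\<lambda>n. c n * z ^ n) sums f z" "summable (\<lambda>n. (cmod (c n))\<^sup>2)"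
proof -
  obtain B where f: "f holomorphic_on ball 0 1"
    and B: "\<And>r. 0 \<le> r \<Longrightarrow> r < 1 \<Longrightarrow> (\<integral>\<theta>. (cmod (f (of_real r * cis \<theta>)))\<^sup>2 \<partial>circ) \<le> B"
    using assms unfolding hardy_disk_iff by blast
  define c where "c = (\<lambda>n. (deriv ^^ n) f 0 / fact n)"
  have s: "(\<lambda>n. c n * z ^ n) sums f z" if "z \<in> ball 0 1" for z
    using holomorphic_power_series[OF f that] by (simp add: c_def)
  have "(\<Sum>n<N. (cmod (c n))\<^sup>2) \<le> B" for N
  proof (rule tendsto_upperbound)
    have "((\<lambda>r. \<Sum>n<N. (cmod (c n))\<^sup>2 * r ^ (2 * n)) \<longlongrightarrow> (\<Sum>n<N. (cmod (c n))\<^sup>2 * 1 ^ (2 * n))) (at_left (1::real))"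
      by (intro tendsto_intros)
    then show "((\<lambda>r. \<Sum>n<N. (cmod (c n))\<^sup>2 * r ^ (2 * n)) \<longlongrightarrow> (\<Sum>n<N. (cmod (c n))\<^sup>2)) (at_left (1::real))"
      by simp
    have "eventually (\<lambda>r::real. 0 < r \<and> r < 1) (at_left 1)"
      unfolding eventually_at_left_field by (auto intro!: exI[of _ 0])
    then show "\<forall>\<^sub>F r in at_left (1::real). (\<Sum>n<N. (cmod (c n))\<^sup>2 * r ^ (2 * n)) \<le> B"
    proof eventually_elim
      case (elim r)
      then have p: "(\<lambda>n. (cmod (c n))\<^sup>2 * r ^ (2 * n)) sums (\<integral>\<theta>. (cmod (f (of_real r * cis \<theta>)))\<^sup>2 \<partial>circ)"
        by (intro parseval_disk s) auto
      have "(\<Sum>n<N. (cmod (c n))\<^sup>2 * r ^ (2 * n)) \<le> (\<Sum>n. (cmod (c n))\<^sup>2 * r ^ (2 * n))"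
        using p elim by (intro sum_le_suminf) (auto simp: sums_iff)
      also have "\<dots> \<le> B" using B[of r] p elim by (simp add: sums_iff)
      finally show ?case .
    qed
  qed simp
  then have "summable (\<lambda>n. (cmod (c n))\<^sup>2)"
    by (intro bounded_imp_summable[where B = B]) (auto simp only: lessThan_Suc_atMost[symmetric] zero_le_power2)
  with s show thesis by (rule that)
qed

section \<open>Radial limits\<close>

text \<open>A sequence of radii increasing to 1 along which dominated convergence is applied.\<close>

definition rad :: "nat \<Rightarrow> real" where "rad n = 1 - 1 / real (n + 2)"

lemma rad: "0 \<le> rad n" "rad n < 1"
  by (auto simp: rad_def field_simps)

lemma filterlim_rad: "filterlim rad (at_left 1) sequentially"
proof -
  have "(\<lambda>n. 1 - 1 / real (n + 2)) \<longlonglongrightarrow> 1 - 0"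
    by (intro tendsto_diff tendsto_const LIMSEQ_ignore_initial_segment[OF lim_const_over_n])
  then show ?thesis
    unfolding filterlim_at by (auto simp: rad_def[abs_def] intro!: always_eventually)
qed

lemma tendsto_at_left_Cauchy:
  fixes u :: "real \<Rightarrow> complex"
  assumes "\<And>e. 0 < e \<Longrightarrow> \<exists>d<1. \<forall>x y. d < x \<and> x < 1 \<and> d < y \<and> y < 1 \<longrightarrow> cmod (u x - u y) \<le> e"
  shows "\<exists>L. (u \<longlongrightarrow> L) (at_left 1)"
proof -
  have ev: "\<forall>\<^sub>F n in sequentially. d < rad n \<and> rad n < 1" if "d < 1" for d
  proof -
    have "\<forall>\<^sub>F x in at_left 1. d < x \<and> x < (1::real)"
      unfolding eventually_at_left_field using that by blast
    then show ?thesis using filterlim_rad by (auto simp: filterlim_iff)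
  qed
  have "Cauchy (\<lambda>n. u (rad n))"
  proof (rule metric_CauchyI)
    fix e :: real assume "0 < e"
    then obtain d where d: "d < 1" "\<And>x y. d < x \<Longrightarrow> x < 1 \<Longrightarrow> d < y \<Longrightarrow> y < 1 \<Longrightarrow> cmod (u x - u y) \<le> e / 2"
      using assms[of "e / 2"] by auto
    obtain N where "\<And>n. n \<ge> N \<Longrightarrow> d < rad n \<and> rad n < 1"
      using ev[OF d(1)] by (auto simp: eventually_sequentially)
    then have "dist (u (rad m)) (u (rad n)) < e" if "m \<ge> N" "n \<ge> N" for m n
      using d(2)[of "rad m" "rad n"] that \<open>0 < e\<close> by (auto simp: dist_norm intro: le_less_trans)
    then show "\<exists>N. \<forall>m\<ge>N. \<forall>n\<ge>N. dist (u (rad m)) (u (rad n)) < e" by blast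
  qed
  then obtain L where L: "(\<lambda>n. u (rad n)) \<longlonglongrightarrow> L"
    using Cauchy_convergent convergent_def by blast
  have "(u \<longlongrightarrow> L) (at_left 1)"
  proof (rule tendstoI)
    fix e :: real assume "0 < e"
    then obtain d where d: "d < 1" "\<And>x y. d < x \<Longrightarrow> x < 1 \<Longrightarrow> d < y \<Longrightarrow> y < 1 \<Longrightarrow> cmod (u x - u y) \<le> e / 2"
      using assms[of "e / 2"] by auto
    have "cmod (u x - L) \<le> e / 2" if "d < x" "x < 1" for x
    proof (rule tendsto_upperbound)
      show "(\<lambda>n. cmod (u x - u (rad n))) \<longlonglongrightarrow> cmod (u x - L)" by (intro tendsto_intros L)
      show "\<forall>\<^sub>F n in sequentially. cmod (u x - u (rad n)) \<le> e / 2"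
        using ev[OF d(1)] by eventually_elim (use d(2) that in auto)
    qed simp
    then have "dist (u x) L < e" if "d < x" "x < 1" for x
      using that \<open>0 < e\<close> by (auto simp: dist_norm intro: le_less_trans[of _ "e / 2"])
    then show "\<forall>\<^sub>F x in at_left 1. dist (u x) L < e"
      unfolding eventually_at_left_field using d(1) by blast
  qed
  then show ?thesis ..
qed

lemma continuous_on_radius:
  assumes f: "f holomorphic_on ball 0 1"
  shows "continuous_on {0..<1} (\<lambda>r. f (of_real r * cis \<theta>))"
  by (rule continuous_on_compose2[OF holomorphic_on_imp_continuous_on[OF f]])
    (auto intro!: continuous_intros simp: norm_mult)

text \<open>At an angle without radial limit, \<^const>\<open>Lim\<close> is a definite description of an empty predicate, hence
  one and the same value at all such angles. The set of the remaining angles is a Borel set by Cauchy's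
  criterion along rational radii. So the function is Borel measurable, not only up to a null set.\<close>

lemma measurable_boundary_value:
  assumes f: "f holomorphic_on ball 0 1"
  shows "boundary_value f \<in> borel_measurable borel"
proof -
  define Q where "Q = \<rat> \<inter> {0..<1::real}"
  have cQ: "countable Q" unfolding Q_def by (intro countable_Int1 countable_rat)
  have neQ: "Q \<noteq> {}" unfolding Q_def by (auto intro!: exI[of _ 0])
  define q where "q = from_nat_into Q"
  have q: "0 \<le> q m" "q m < 1" for m
    using from_nat_into[OF neQ, of m] by (auto simp: Q_def q_def)
  have qsurj: "\<exists>m. x = q m" if "x \<in> \<rat>" "0 \<le> x" "x < 1" for x
    using from_nat_into_surj[OF cQ, of x] that by (auto simp: Q_def q_def)
  define u where "u = (\<lambda>\<theta> r. f (of_real r * cis \<theta>))"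
  have um [measurable]: "(\<lambda>\<theta>. u \<theta> (q i)) \<in> borel_measurable borel" for i
    unfolding u_def by (rule integrable_circ_holomorphic(1)[OF f q])
  have um2 [measurable]: "(\<lambda>\<theta>. u \<theta> (rad i)) \<in> borel_measurable borel" for i
    unfolding u_def by (rule integrable_circ_holomorphic(1)[OF f rad])
  define C where "C = {\<theta> \<in> space borel. \<forall>k::nat. \<exists>m::nat. \<forall>i j. 1 - 1 / real (Suc m) < q i \<and> 1 - 1 / real (Suc m) < q j \<longrightarrow>
      cmod (u \<theta> (q i) - u \<theta> (q j)) \<le> 1 / real (Suc k)}"
  have [measurable]: "C \<in> sets borel" unfolding C_def by measurable
  have cont: "continuous_on {0..<1} (u \<theta>)" for \<theta>
    unfolding u_def by (rule continuous_on_radius[OF f])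
  have C: "\<theta> \<in> C \<longleftrightarrow> (\<exists>L. (u \<theta> \<longlongrightarrow> L) (at_left 1))" for \<theta>
  proof
    assume th: "\<theta> \<in> C"
    show "\<exists>L. (u \<theta> \<longlongrightarrow> L) (at_left 1)"
    proof (rule tendsto_at_left_Cauchy)
      fix e :: real assume "0 < e"
      then obtain k where k: "1 / real (Suc k) < e" using nat_approx_posE by blast
      obtain m where m: "\<And>i j. 1 - 1 / real (Suc m) < q i \<Longrightarrow> 1 - 1 / real (Suc m) < q j \<Longrightarrow>
          cmod (u \<theta> (q i) - u \<theta> (q j)) \<le> 1 / real (Suc k)"
        using th unfolding C_def by blast
      define d where "d = 1 - 1 / real (Suc m)"
      have d: "0 \<le> d" "d < 1" by (auto simp: d_def field_simps)
      have "cmod (u \<theta> x - u \<theta> y) \<le> e" if xy: "d < x" "x < 1" "d < y" "y < 1" for x y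
      proof -
        obtain s where s: "\<And>n. s n \<in> \<rat>" "\<And>n. x < s n" "\<And>n. s n < 1" "s \<longlonglongrightarrow> x"
          using rational_sequence[OF xy(2)] by blast
        obtain t where t: "\<And>n. t n \<in> \<rat>" "\<And>n. y < t n" "\<And>n. t n < 1" "t \<longlonglongrightarrow> y"
          using rational_sequence[OF xy(4)] by blast
        have b: "cmod (u \<theta> (s n) - u \<theta> (t n)) \<le> e" for n
        proof -
          have n1: "0 \<le> s n" "0 \<le> t n" "d < s n" "d < t n" using xy d s(2)[of n] t(2)[of n] by auto
          obtain i j where "s n = q i" "t n = q j" using qsurj s t n1 by metis
          then show ?thesis using m[of i j] n1 k by (auto simp: d_def)
        qed
        have l1: "(\<lambda>n. u \<theta> (s n)) \<longlonglongrightarrow> u \<theta> x"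
          using d xy s by (intro continuous_on_tendsto_compose[OF cont s(4)])
            (auto intro!: always_eventually less_imp_le[OF less_trans[of 0 x]])
        have l2: "(\<lambda>n. u \<theta> (t n)) \<longlonglongrightarrow> u \<theta> y"
          using d xy t by (intro continuous_on_tendsto_compose[OF cont t(4)])
            (auto intro!: always_eventually less_imp_le[OF less_trans[of 0 y]])
        have "(\<lambda>n. cmod (u \<theta> (s n) - u \<theta> (t n))) \<longlonglongrightarrow> cmod (u \<theta> x - u \<theta> y)"
          by (intro tendsto_intros l1 l2)
        then show ?thesis by (rule LIMSEQ_le_const2) (use b in auto)
      qed
      then show "\<exists>d<1. \<forall>x y. d < x \<and> x < 1 \<and> d < y \<and> y < 1 \<longrightarrow> cmod (u \<theta> x - u \<theta> y) \<le> e"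
        using d by blast
    qed
  next
    assume "\<exists>L. (u \<theta> \<longlongrightarrow> L) (at_left 1)"
    then obtain L where L: "(u \<theta> \<longlongrightarrow> L) (at_left 1)" by blast
    have "\<exists>m. \<forall>i j. 1 - 1 / real (Suc m) < q i \<and> 1 - 1 / real (Suc m) < q j \<longrightarrow>
      cmod (u \<theta> (q i) - u \<theta> (q j)) \<le> 1 / real (Suc k)" for k
    proof -
      have "\<forall>\<^sub>F x in at_left 1. dist (u \<theta> x) L < 1 / real (Suc k) / 2"
        using L by (rule tendstoD) simp
      then obtain d where d: "d < 1" "\<And>x. d < x \<Longrightarrow> x < 1 \<Longrightarrow> dist (u \<theta> x) L < 1 / real (Suc k) / 2"
        unfolding eventually_at_left_field by blast
      obtain m where m: "1 / real (Suc m) < 1 - d" using nat_approx_posE[of "1 - d"] d(1) by auto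
      have "cmod (u \<theta> (q i) - u \<theta> (q j)) \<le> 1 / real (Suc k)"
        if "1 - 1 / real (Suc m) < q i" "1 - 1 / real (Suc m) < q j" for i j
      proof -
        have "dist (u \<theta> (q i)) (u \<theta> (q j)) \<le> dist (u \<theta> (q i)) L + dist (u \<theta> (q j)) L"
          by (rule dist_triangle2)
        also have "\<dots> \<le> 1 / real (Suc k) / 2 + 1 / real (Suc k) / 2"
          using that m q by (intro add_mono less_imp_le d) auto
        also have "\<dots> = 1 / real (Suc k)" by (simp only: field_sum_of_halves)
        finally show ?thesis unfolding dist_norm .
      qed
      then show ?thesis by blast
    qed
    then show "\<theta> \<in> C" by (auto simp: C_def)
  qed
  have "boundary_value f \<theta> = (if \<theta> \<in> C then lim (\<lambda>n. u \<theta> (rad n)) else (THE L. False))" for \<theta>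
  proof (cases "\<theta> \<in> C")
    case True
    then obtain L where L: "(u \<theta> \<longlongrightarrow> L) (at_left 1)" using C by blast
    then have "boundary_value f \<theta> = L"
      unfolding boundary_value_def u_def by (intro tendsto_Lim) auto
    moreover have "(\<lambda>n. u \<theta> (rad n)) \<longlonglongrightarrow> L"
      using filterlim_compose[OF L filterlim_rad] .
    ultimately show ?thesis using True by (simp add: limI)
  next
    case False
    then have "(\<lambda>L. (u \<theta> \<longlongrightarrow> L) (at_left 1)) = (\<lambda>L. False)" using C by auto
    then show ?thesis using False unfolding boundary_value_def t2_space_class.Lim_def u_def by (simp only: if_False)
  qed
  then have "boundary_value f = (\<lambda>\<theta>. if \<theta> \<in> C then lim (\<lambda>n. u \<theta> (rad n)) else (THE L. False))" by auto
  also have "\<dots> \<in> borel_measurable borel" by measurable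
  finally show ?thesis .
qed

text \<open>Fatou's theorem. The Taylor polynomials have radial limits everywhere. The maximal functions of the
  Taylor remainders tend to 0 in mean square, hence their lower limit is 0 almost everywhere, and there
  they bound the oscillation of \<open>f\<close> near the end of the radius.\<close>

theorem radial_limit_AE:
  assumes "f \<in> hardy_disk"
  shows "AE \<theta> in circ. ((\<lambda>r. f (of_real r * cis \<theta>)) \<longlongrightarrow> boundary_value f \<theta>) (at_left 1)"
proof -
  obtain c where s: "\<And>z. z \<in> ball 0 1 \<Longrightarrow> (\<lambda>n. c n * z ^ n) sums f z" and c: "summable (\<lambda>n. (cmod (c n))\<^sup>2)"
    using hardy_disk_seriesE[OF assms] by blast
  define p where "p = (\<lambda>N z. \<Sum>n<N. c n * z ^ n)"
  define g where "g = (\<lambda>N z. f z - p N z)"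
  define d where "d = (\<lambda>N n. if n < N then 0 else c n)"
  have gs: "(\<lambda>n. d N n * z ^ n) sums g N z" if "z \<in> ball 0 1" for N z
  proof -
    have "(\<lambda>n. if n \<in> {..<N} then c n * z ^ n else 0) sums p N z"
      unfolding p_def by (rule sums_If_finite_set) simp
    from sums_diff[OF s[OF that] this] show ?thesis
      unfolding g_def by (rule sums_cong[THEN iffD1, rotated]) (auto simp: d_def)
  qed
  have d2: "summable (\<lambda>n. (cmod (d N n))\<^sup>2)" for N
    by (rule summable_comparison_test_ev[OF _ c]) (auto simp: d_def)
  define B where "B = (\<lambda>N. \<Sum>n. (cmod (d N n))\<^sup>2)"
  have B_eq: "B N = (\<Sum>n. (cmod (c n))\<^sup>2) - (\<Sum>n<N. (cmod (c n))\<^sup>2)" for N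
  proof -
    have "(\<lambda>n. if n \<in> {..<N} then (cmod (c n))\<^sup>2 else 0) sums (\<Sum>n<N. (cmod (c n))\<^sup>2)"
      by (rule sums_If_finite_set) simp
    from sums_diff[OF summable_sums[OF c] this]
    have "(\<lambda>n. (cmod (d N n))\<^sup>2) sums ((\<Sum>n. (cmod (c n))\<^sup>2) - (\<Sum>n<N. (cmod (c n))\<^sup>2))"
      by (rule sums_cong[THEN iffD1, rotated]) (auto simp: d_def)
    then show ?thesis by (simp add: B_def sums_iff)
  qed
  have B_lim: "B \<longlonglongrightarrow> 0"
  proof -
    have "(\<lambda>N. (\<Sum>n. (cmod (c n))\<^sup>2) - (\<Sum>n<N. (cmod (c n))\<^sup>2)) \<longlonglongrightarrow> (\<Sum>n. (cmod (c n))\<^sup>2) - (\<Sum>n. (cmod (c n))\<^sup>2)"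
      by (intro tendsto_intros summable_LIMSEQ c)
    then show ?thesis by (simp add: B_eq[abs_def])
  qed
  have gh: "g N holomorphic_on ball 0 1" for N
    by (rule hardy_disk_holomorphic[OF hardy_disk_seriesI[OF gs d2]])
  have "\<forall>N. \<exists>M. M \<in> borel_measurable borel \<and> (\<forall>\<theta>. 0 \<le> M \<theta>) \<and> integrable circ (\<lambda>\<theta>. (M \<theta>)\<^sup>2) \<and>
     (\<integral>\<theta>. (M \<theta>)\<^sup>2 \<partial>circ) \<le> 256 * B N \<and>
     (AE \<theta> in circ. \<forall>r. 0 \<le> r \<and> r < 1 \<longrightarrow> cmod (g N (of_real r * cis \<theta>)) \<le> M \<theta>)"
    unfolding B_def by (intro allI maximal_theorem[OF gh disk_series_bound[OF gs d2]])
  from choice[OF this] obtain M where M [measurable]: "\<And>N. M N \<in> borel_measurable borel" and M0: "\<And>N \<theta>. 0 \<le> M N \<theta>"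
    and Mi: "\<And>N. integrable circ (\<lambda>\<theta>. (M N \<theta>)\<^sup>2)" and MB: "\<And>N. (\<integral>\<theta>. (M N \<theta>)\<^sup>2 \<partial>circ) \<le> 256 * B N"
    and Mg: "\<And>N. AE \<theta> in circ. \<forall>r. 0 \<le> r \<and> r < 1 \<longrightarrow> cmod (g N (of_real r * cis \<theta>)) \<le> M N \<theta>"
    by blast
  have "(\<integral>\<^sup>+\<theta>. liminf (\<lambda>N. ennreal ((M N \<theta>)\<^sup>2)) \<partial>circ) \<le> liminf (\<lambda>N. \<integral>\<^sup>+\<theta>. ennreal ((M N \<theta>)\<^sup>2) \<partial>circ)"
    by (rule nn_integral_liminf) simp
  also have "\<dots> \<le> liminf (\<lambda>N. ennreal (256 * B N))"
    using MB Mi by (intro Liminf_mono always_eventually allI) (subst nn_integral_eq_integral, auto intro!: ennreal_leI)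
  also have "\<dots> = 0"
  proof -
    have "(\<lambda>N. ennreal (256 * B N)) \<longlonglongrightarrow> ennreal (256 * 0)"
      by (intro tendsto_ennrealI tendsto_intros B_lim)
    then show ?thesis by (subst lim_imp_Liminf) auto
  qed
  finally have "(\<integral>\<^sup>+\<theta>. liminf (\<lambda>N. ennreal ((M N \<theta>)\<^sup>2)) \<partial>circ) = 0" by simp
  then have "AE \<theta> in circ. liminf (\<lambda>N. ennreal ((M N \<theta>)\<^sup>2)) = 0"
    by (subst (asm) nn_integral_0_iff_AE) auto
  moreover have "AE \<theta> in circ. \<forall>N. \<forall>r. 0 \<le> r \<and> r < 1 \<longrightarrow> cmod (g N (of_real r * cis \<theta>)) \<le> M N \<theta>"
    using Mg by (simp add: AE_all_countable)
  ultimately show ?thesis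
  proof eventually_elim
    case (elim \<theta>)
    have small: "\<exists>N. M N \<theta> < e" if "0 < e" for e
    proof (rule ccontr)
      assume "\<nexists>N. M N \<theta> < e"
      then have "ennreal (e\<^sup>2) \<le> ennreal ((M N \<theta>)\<^sup>2)" for N
        using that by (intro ennreal_leI power_mono) (auto simp: not_less)
      then have "ennreal (e\<^sup>2) \<le> liminf (\<lambda>N. ennreal ((M N \<theta>)\<^sup>2))"
        by (intro Liminf_bounded always_eventually) auto
      then show False using elim(1) that by (simp add: ennreal_eq_0_iff)
    qed
    have "\<exists>L. ((\<lambda>r. f (of_real r * cis \<theta>)) \<longlongrightarrow> L) (at_left 1)"
    proof (rule tendsto_at_left_Cauchy)
      fix e :: real assume e: "0 < e"
      then obtain N where N: "M N \<theta> < e / 4" using small[of "e / 4"] by auto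
      have "((\<lambda>r. p N (of_real r * cis \<theta>)) \<longlongrightarrow> p N (of_real 1 * cis \<theta>)) (at_left 1)"
        unfolding p_def by (intro tendsto_intros)
      then have "\<forall>\<^sub>F r in at_left 1. dist (p N (of_real r * cis \<theta>)) (p N (of_real 1 * cis \<theta>)) < e / 4"
        by (rule tendstoD) (use e in simp)
      then obtain d where d: "d < 1" "\<And>r. d < r \<Longrightarrow> r < 1 \<Longrightarrow> dist (p N (of_real r * cis \<theta>)) (p N (of_real 1 * cis \<theta>)) < e / 4"
        unfolding eventually_at_left_field by blast
      have "cmod (f (of_real x * cis \<theta>) - f (of_real y * cis \<theta>)) \<le> e"
        if xy: "max d 0 < x" "x < 1" "max d 0 < y" "y < 1" for x y
      proof -
        define P where "P = (\<lambda>r. p N (of_real r * cis \<theta>))"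
        define G where "G = (\<lambda>r. g N (of_real r * cis \<theta>))"
        have split: "f (of_real r * cis \<theta>) = P r + G r" for r by (simp add: P_def G_def g_def)
        have "cmod (G r) \<le> e / 4" if "0 < r" "r < 1" for r
          using elim(2)[THEN spec, of N, THEN spec, of r] that N unfolding G_def by linarith
        then have "cmod (G x) \<le> e / 4" "cmod (G y) \<le> e / 4"
          using xy by auto
        moreover have "cmod (P x - P 1) \<le> e / 4" "cmod (P y - P 1) \<le> e / 4"
          using d(2)[of x] d(2)[of y] xy unfolding P_def dist_norm by auto
        moreover have "cmod (P x + G x - (P y + G y)) \<le> cmod (P x - P 1) + cmod (P y - P 1) + cmod (G x) + cmod (G y)"
        proof -
          have "P x + G x - (P y + G y) = ((P x - P 1) - (P y - P 1)) + (G x - G y)" by simp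
          then have "cmod (P x + G x - (P y + G y)) \<le> cmod ((P x - P 1) - (P y - P 1)) + cmod (G x - G y)"
            by (metis norm_triangle_ineq)
          also have "\<dots> \<le> (cmod (P x - P 1) + cmod (P y - P 1)) + (cmod (G x) + cmod (G y))"
            by (intro add_mono norm_triangle_ineq4)
          finally show ?thesis by simp
        qed
        ultimately show ?thesis unfolding split by simp
      qed
      then show "\<exists>d<1. \<forall>x y. d < x \<and> x < 1 \<and> d < y \<and> y < 1 \<longrightarrow>
          cmod (f (of_real x * cis \<theta>) - f (of_real y * cis \<theta>)) \<le> e"
        using d(1) by (intro exI[of _ "max d 0"]) auto
    qed
    then obtain L where L: "((\<lambda>r. f (of_real r * cis \<theta>)) \<longlongrightarrow> L) (at_left 1)" ..
    then have "boundary_value f \<theta> = L" unfolding boundary_value_def by (intro tendsto_Lim) auto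
    with L show ?case by simp
  qed
qed

lemma boundary_value_eq:
  assumes "((\<lambda>r. f (of_real r * cis \<theta>)) \<longlongrightarrow> L) (at_left 1)"
  shows "boundary_value f \<theta> = L"
  unfolding boundary_value_def using assms by (intro tendsto_Lim) auto

lemma boundary_value_continuous:
  assumes "continuous_on (cball 0 1) f"
  shows "((\<lambda>r. f (of_real r * cis \<theta>)) \<longlongrightarrow> f (cis \<theta>)) (at_left 1)"
proof -
  have "((\<lambda>r. of_real r * cis \<theta>) \<longlongrightarrow> of_real 1 * cis \<theta>) (at_left (1::real))"
    by (intro tendsto_intros)
  moreover have "\<forall>\<^sub>F r in at_left (1::real). of_real r * cis \<theta> \<in> cball 0 1"
    unfolding eventually_at_left_field by (auto intro!: exI[of _ 0] simp: norm_mult)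
  ultimately show ?thesis
    using continuous_on_tendsto_compose[OF assms, of "\<lambda>r. of_real r * cis \<theta>" "cis \<theta>" "at_left 1"] by simp
qed

lemma hardy_boundary:
  assumes f: "f \<in> hardy_disk"
  obtains M where "M \<in> borel_measurable borel" "\<And>\<theta>. 0 \<le> M \<theta>" "integrable circ (\<lambda>\<theta>. (M \<theta>)\<^sup>2)"
    "AE \<theta> in circ. (\<forall>r. 0 \<le> r \<and> r < 1 \<longrightarrow> cmod (f (of_real r * cis \<theta>)) \<le> M \<theta>) \<and>
       ((\<lambda>n. f (of_real (rad n) * cis \<theta>)) \<longlonglongrightarrow> boundary_value f \<theta>) \<and> cmod (boundary_value f \<theta>) \<le> M \<theta>"
proof -
  obtain M where M: "M \<in> borel_measurable borel" "\<And>\<theta>. 0 \<le> M \<theta>" "integrable circ (\<lambda>\<theta>. (M \<theta>)\<^sup>2)"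
    and A: "AE \<theta> in circ. \<forall>r. 0 \<le> r \<and> r < 1 \<longrightarrow> cmod (f (of_real r * cis \<theta>)) \<le> M \<theta>"
    using maximal_hardy[OF f] by blast
  have "AE \<theta> in circ. (\<forall>r. 0 \<le> r \<and> r < 1 \<longrightarrow> cmod (f (of_real r * cis \<theta>)) \<le> M \<theta>) \<and>
       ((\<lambda>n. f (of_real (rad n) * cis \<theta>)) \<longlonglongrightarrow> boundary_value f \<theta>) \<and> cmod (boundary_value f \<theta>) \<le> M \<theta>"
    using A radial_limit_AE[OF f]
  proof eventually_elim
    case (elim \<theta>)
    have lim: "(\<lambda>n. f (of_real (rad n) * cis \<theta>)) \<longlonglongrightarrow> boundary_value f \<theta>"
      using filterlim_compose[OF elim(2) filterlim_rad] .
    moreover have "cmod (boundary_value f \<theta>) \<le> M \<theta>"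
      using elim(1) rad by (intro tendsto_upperbound[OF tendsto_norm[OF lim]]) auto
    ultimately show ?case using elim(1) by blast
  qed
  with M show thesis by (rule that)
qed

section \<open>Membership in the Hardy space\<close>

text \<open>The closure properties of the Hardy space all follow from this comparison.\<close>

lemma hardy_disk_bound:
  assumes f: "f holomorphic_on ball 0 1" and g: "g \<in> hardy_disk" and h: "h \<in> hardy_disk"
    and bound: "\<And>z. z \<in> ball 0 1 \<Longrightarrow> (cmod (f z))\<^sup>2 \<le> A + K * (cmod (g z))\<^sup>2 + K * (cmod (h z))\<^sup>2" and K: "0 \<le> K"
  shows "f \<in> hardy_disk"
proof -
  obtain B C where B: "\<And>r. 0 \<le> r \<Longrightarrow> r < 1 \<Longrightarrow> (\<integral>\<theta>. (cmod (g (of_real r * cis \<theta>)))\<^sup>2 \<partial>circ) \<le> B"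
    and C: "\<And>r. 0 \<le> r \<Longrightarrow> r < 1 \<Longrightarrow> (\<integral>\<theta>. (cmod (h (of_real r * cis \<theta>)))\<^sup>2 \<partial>circ) \<le> C"
    using g h unfolding hardy_disk_iff by blast
  have "(\<integral>\<theta>. (cmod (f (of_real r * cis \<theta>)))\<^sup>2 \<partial>circ) \<le> A + K * B + K * C" if r: "0 \<le> r" "r < 1" for r
  proof -
    have ig: "integrable circ (\<lambda>\<theta>. (cmod (g (of_real r * cis \<theta>)))\<^sup>2)" "integrable circ (\<lambda>\<theta>. (cmod (h (of_real r * cis \<theta>)))\<^sup>2)"
      using integrable_circ_holomorphic(3)[OF hardy_disk_holomorphic r] g h by auto
    have "(\<integral>\<theta>. (cmod (f (of_real r * cis \<theta>)))\<^sup>2 \<partial>circ) \<le>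
        (\<integral>\<theta>. A + K * (cmod (g (of_real r * cis \<theta>)))\<^sup>2 + K * (cmod (h (of_real r * cis \<theta>)))\<^sup>2 \<partial>circ)"
      using ig r by (intro integral_mono integrable_circ_holomorphic(3)[OF f r] bound) (auto simp: norm_mult)
    also have "\<dots> = A + K * (\<integral>\<theta>. (cmod (g (of_real r * cis \<theta>)))\<^sup>2 \<partial>circ) + K * (\<integral>\<theta>. (cmod (h (of_real r * cis \<theta>)))\<^sup>2 \<partial>circ)"
      using ig by (simp add: circ.prob_space[simplified])
    also have "\<dots> \<le> A + K * B + K * C"
      using B[OF r] C[OF r] K by (intro add_mono mult_left_mono) auto
    finally show ?thesis .
  qed
  then show ?thesis unfolding hardy_disk_iff using f by blast
qed

lemma hardy_disk_bounded:
  assumes f: "f holomorphic_on ball 0 1" and bound: "\<And>z. z \<in> ball 0 1 \<Longrightarrow> cmod (f z) \<le> K"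
  shows "f \<in> hardy_disk"
proof -
  have "(\<lambda>z. 0) \<in> hardy_disk" by (auto simp: hardy_disk_iff)
  from hardy_disk_bound[OF f this this _ order_refl, of "K\<^sup>2"] show ?thesis
    using power_mono[OF bound, of _ 2] by simp
qed

lemma hardy_disk_const: "(\<lambda>z. c) \<in> hardy_disk"
  by (rule hardy_disk_bounded[where K = "cmod c"]) auto

lemma hardy_disk_add:
  assumes f: "f \<in> hardy_disk" and g: "g \<in> hardy_disk"
  shows "(\<lambda>z. f z + g z) \<in> hardy_disk"
proof (rule hardy_disk_bound[OF _ f g])
  show "(\<lambda>z. f z + g z) holomorphic_on ball 0 1"
    using f g by (intro holomorphic_intros hardy_disk_holomorphic)
  show "(cmod (f z + g z))\<^sup>2 \<le> 0 + 2 * (cmod (f z))\<^sup>2 + 2 * (cmod (g z))\<^sup>2" for z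
  proof -
    have "(cmod (f z + g z))\<^sup>2 \<le> (cmod (f z) + cmod (g z))\<^sup>2"
      by (intro power_mono norm_triangle_ineq) auto
    also have "\<dots> \<le> 2 * (cmod (f z))\<^sup>2 + 2 * (cmod (g z))\<^sup>2"
      using sum_squares_bound[of "cmod (f z)" "cmod (g z)"] by (simp add: power2_sum)
    finally show ?thesis by simp
  qed
qed simp

lemma hardy_disk_mult_bounded:
  assumes f: "f \<in> hardy_disk" and g: "g holomorphic_on ball 0 1" and bound: "\<And>z. z \<in> ball 0 1 \<Longrightarrow> cmod (g z) \<le> K"
  shows "(\<lambda>z. g z * f z) \<in> hardy_disk"
proof (rule hardy_disk_bound[OF _ f f])
  show "(\<lambda>z. g z * f z) holomorphic_on ball 0 1"
    by (intro holomorphic_intros g hardy_disk_holomorphic[OF f])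
  fix z :: complex assume z: "z \<in> ball 0 1"
  have "(cmod (g z * f z))\<^sup>2 \<le> K\<^sup>2 * (cmod (f z))\<^sup>2"
    unfolding norm_mult power_mult_distrib using bound[OF z] by (intro mult_right_mono power_mono) auto
  also have "\<dots> \<le> 0 + K\<^sup>2 * (cmod (f z))\<^sup>2 + K\<^sup>2 * (cmod (f z))\<^sup>2" by simp
  finally show "(cmod (g z * f z))\<^sup>2 \<le> 0 + K\<^sup>2 * (cmod (f z))\<^sup>2 + K\<^sup>2 * (cmod (f z))\<^sup>2" .
qed simp

lemma hardy_disk_cmult: "f \<in> hardy_disk \<Longrightarrow> (\<lambda>z. c * f z) \<in> hardy_disk"
  by (rule hardy_disk_mult_bounded[where K = "cmod c"]) auto

lemma hardy_disk_cong:
  assumes "\<And>z. z \<in> ball 0 1 \<Longrightarrow> f z = g z"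
  shows "f \<in> hardy_disk \<longleftrightarrow> g \<in> hardy_disk"
proof -
  have "g \<in> hardy_disk" if f: "f \<in> hardy_disk" and eq: "\<And>z. z \<in> ball 0 1 \<Longrightarrow> f z = g z" for f g
  proof (rule hardy_disk_bound[OF _ f f _ zero_le_one])
    show "g holomorphic_on ball 0 1"
      by (rule holomorphic_transform[OF hardy_disk_holomorphic[OF f] eq])
    show "(cmod (g z))\<^sup>2 \<le> 0 + 1 * (cmod (f z))\<^sup>2 + 1 * (cmod (f z))\<^sup>2" if "z \<in> ball 0 1" for z
      using eq[OF that] by simp
  qed
  from this[of f g] this[of g f] assms show ?thesis by auto
qed

lemma boundary_value_cong:
  assumes "\<And>z. z \<in> ball 0 1 \<Longrightarrow> f z = g z"
  shows "boundary_value f = boundary_value g"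
proof
  fix \<theta>
  have "\<forall>\<^sub>F r in at_left (1::real). f (of_real r * cis \<theta>) = g (of_real r * cis \<theta>)"
    unfolding eventually_at_left_field using assms by (intro exI[of _ 0]) (auto simp: norm_mult)
  then have "((\<lambda>r. f (of_real r * cis \<theta>)) \<longlongrightarrow> L) (at_left 1) \<longleftrightarrow> ((\<lambda>r. g (of_real r * cis \<theta>)) \<longlongrightarrow> L) (at_left 1)" for L
    by (rule tendsto_cong)
  then show "boundary_value f \<theta> = boundary_value g \<theta>"
    by (simp add: boundary_value_def t2_space_class.Lim_def)
qed

lemma outer_disk_cong:
  assumes "\<And>z. z \<in> ball 0 1 \<Longrightarrow> f z = g z"
  shows "outer_disk f \<longleftrightarrow> outer_disk g"
  using hardy_disk_cong[OF assms] boundary_value_cong[OF assms] assms[of 0] by (simp add: outer_disk_def)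

lemma outer_disk_circ:
  "outer_disk f \<longleftrightarrow> f \<in> hardy_disk \<and> f 0 \<noteq> 0 \<and> integrable circ (\<lambda>\<theta>. ln (cmod (boundary_value f \<theta>))) \<and>
     ln (cmod (f 0)) = (\<integral>\<theta>. ln (cmod (boundary_value f \<theta>)) \<partial>circ)"
proof (cases "f \<in> hardy_disk")
  case True
  have [measurable]: "boundary_value f \<in> borel_measurable borel"
    by (rule measurable_boundary_value[OF hardy_disk_holomorphic[OF True]])
  have m: "(\<lambda>\<theta>. ln (cmod (boundary_value f \<theta>))) \<in> borel_measurable borel" by measurable
  show ?thesis by (simp add: outer_disk_def integral_circ[OF m] integrable_circ[OF m])
qed (simp add: outer_disk_def)

section \<open>Exponentials of Hardy space functions are outer\<close>

text \<open>Here \<open>ln |f| = Re L\<close> has the same mean on every circle, and the maximal function of \<open>L\<close> allows the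
  radius to tend to 1.\<close>

theorem exp_hardy_boundary:
  assumes f: "f \<in> hardy_disk" and L: "L \<in> hardy_disk" and eq: "\<And>z. z \<in> ball 0 1 \<Longrightarrow> f z = exp (L z)"
  shows "AE \<theta> in circ. boundary_value f \<theta> \<noteq> 0" and "outer_disk f"
proof -
  have mf: "boundary_value f \<in> borel_measurable borel" and mL: "boundary_value L \<in> borel_measurable borel"
    using f L measurable_boundary_value hardy_disk_holomorphic by auto
  note [measurable] = mf mL
  have AE: "AE \<theta> in circ. boundary_value f \<theta> = exp (boundary_value L \<theta>)"
    using radial_limit_AE[OF L]
  proof eventually_elim
    case (elim \<theta>)
    have "\<forall>\<^sub>F r in at_left (1::real). exp (L (of_real r * cis \<theta>)) = f (of_real r * cis \<theta>)"
      unfolding eventually_at_left_field using eq by (intro exI[of _ 0]) (auto simp: norm_mult)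
    with tendsto_exp[OF elim] show ?case
      by (intro boundary_value_eq) (rule Lim_transform_eventually)
  qed
  then show "AE \<theta> in circ. boundary_value f \<theta> \<noteq> 0" by eventually_elim auto
  obtain M where [measurable]: "M \<in> borel_measurable borel" and M: "\<And>\<theta>. 0 \<le> M \<theta>" "integrable circ (\<lambda>\<theta>. (M \<theta>)\<^sup>2)"
    and MA: "AE \<theta> in circ. (\<forall>r. 0 \<le> r \<and> r < 1 \<longrightarrow> cmod (L (of_real r * cis \<theta>)) \<le> M \<theta>) \<and>
       ((\<lambda>n. L (of_real (rad n) * cis \<theta>)) \<longlonglongrightarrow> boundary_value L \<theta>) \<and> cmod (boundary_value L \<theta>) \<le> M \<theta>"
    using hardy_boundary[OF L] by blast
  have M1: "M \<theta> \<le> 1 + (M \<theta>)\<^sup>2" for \<theta>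
    using zero_le_power2[of "M \<theta> - 1"] M(1)[of \<theta>] by (simp add: power2_eq_square algebra_simps)
  have Lm [measurable]: "(\<lambda>\<theta>. L (of_real (rad n) * cis \<theta>)) \<in> borel_measurable borel" for n
    by (rule integrable_circ_holomorphic(1)[OF hardy_disk_holomorphic[OF L] rad])
  have int: "integrable circ (\<lambda>\<theta>. Re (boundary_value L \<theta>))"
    and lim: "(\<lambda>n. \<integral>\<theta>. Re (L (of_real (rad n) * cis \<theta>)) \<partial>circ) \<longlonglongrightarrow> (\<integral>\<theta>. Re (boundary_value L \<theta>) \<partial>circ)"
  proof -
    have *: "(\<lambda>\<theta>. Re (boundary_value L \<theta>)) \<in> borel_measurable circ" 
      "(\<lambda>\<theta>. Re (L (of_real (rad n) * cis \<theta>))) \<in> borel_measurable circ" for n by measurable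
    have w: "integrable circ (\<lambda>\<theta>. 1 + (M \<theta>)\<^sup>2)" using M by auto
    have c: "AE \<theta> in circ. (\<lambda>n. Re (L (of_real (rad n) * cis \<theta>))) \<longlonglongrightarrow> Re (boundary_value L \<theta>)"
      using MA by eventually_elim (auto intro!: tendsto_Re)
    have d: "AE \<theta> in circ. norm (Re (L (of_real (rad n) * cis \<theta>))) \<le> 1 + (M \<theta>)\<^sup>2" for n
      using MA
    proof eventually_elim
      case (elim \<theta>)
      have "norm (Re (L (of_real (rad n) * cis \<theta>))) \<le> cmod (L (of_real (rad n) * cis \<theta>))" by (simp add: abs_Re_le_cmod)
      also have "\<dots> \<le> M \<theta>" using elim rad by blast
      finally show ?case using M1[of \<theta>] by simp
    qed
    show "integrable circ (\<lambda>\<theta>. Re (boundary_value L \<theta>))"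
      by (rule integrable_dominated_convergence[OF * w c d])
    show "(\<lambda>n. \<integral>\<theta>. Re (L (of_real (rad n) * cis \<theta>)) \<partial>circ) \<longlonglongrightarrow> (\<integral>\<theta>. Re (boundary_value L \<theta>) \<partial>circ)"
      by (rule integral_dominated_convergence[OF * w c d])
  qed
  have "(\<integral>\<theta>. Re (L (of_real (rad n) * cis \<theta>)) \<partial>circ) = Re (L 0)" for n
    using mean_value_circ[OF holomorphic_on_dilate[OF hardy_disk_holomorphic[OF L] rad]]
      integral_Re[OF integrable_circ_holomorphic(2)[OF hardy_disk_holomorphic[OF L] rad]] by simp
  with lim have mv: "(\<integral>\<theta>. Re (boundary_value L \<theta>) \<partial>circ) = Re (L 0)"
    by (simp add: LIMSEQ_const_iff)
  have ae: "AE \<theta> in circ. Re (boundary_value L \<theta>) = ln (cmod (boundary_value f \<theta>))"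
    using AE by eventually_elim simp
  have "integrable circ (\<lambda>\<theta>. ln (cmod (boundary_value f \<theta>)))"
    using int ae by (subst integrable_cong_AE[of _ _ "\<lambda>\<theta>. Re (boundary_value L \<theta>)"]) (auto elim: eventually_mono)
  moreover have "(\<integral>\<theta>. ln (cmod (boundary_value f \<theta>)) \<partial>circ) = (\<integral>\<theta>. Re (boundary_value L \<theta>) \<partial>circ)"
    using ae by (intro integral_cong_AE) (auto elim: eventually_mono)
  ultimately show "outer_disk f"
    using f mv eq[of 0] by (simp add: outer_disk_circ)
qed

text \<open>The Taylor coefficients \<open>- l ^ n / n\<close> are square summable even for \<open>|l| = 1\<close>. Factors that vanish at a
  point of the circle are therefore covered as well.\<close>

lemma hardy_disk_Ln_one_minus:
  assumes "cmod l \<le> 1"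
  shows "(\<lambda>z. Ln (1 - l * z)) \<in> hardy_disk"
proof (rule hardy_disk_seriesI)
  fix z :: complex assume "z \<in> ball 0 1"
  then have "cmod (- (l * z)) < 1"
    using assms mult_left_le_one_le[of "cmod z" "cmod l"] by (simp add: norm_mult)
  from Ln_series[OF this]
  show "(\<lambda>n. (- (l ^ n) / of_nat n) * z ^ n) sums Ln (1 - l * z)"
    by (simp add: power_minus' power_mult_distrib) 
next
  show "summable (\<lambda>n. (cmod (- (l ^ n) / of_nat n))\<^sup>2)"
  proof (rule summable_comparison_test)
    show "summable (\<lambda>n. inverse (real n ^ 2))" by (rule inverse_power_summable) simp
    show "\<exists>N. \<forall>n\<ge>N. norm ((cmod (- (l ^ n) / of_nat n))\<^sup>2) \<le> inverse (real n ^ 2)"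
      using assms by (auto simp: norm_divide norm_power power_divide power_le_one inverse_eq_divide intro!: divide_right_mono)
  qed
qed

text \<open>The argument of \<open>s\<close> is bounded, and \<open>0 \<le> ln |s| \<le> |s|\<close>.\<close>

lemma hardy_disk_Ln:
  assumes s: "s \<in> hardy_disk" and re: "\<And>z. z \<in> ball 0 1 \<Longrightarrow> 1 \<le> Re (s z)"
  shows "(\<lambda>z. Ln (s z)) \<in> hardy_disk"
proof (rule hardy_disk_bound[OF _ s s _ zero_le_one])
  have nn: "s z \<notin> \<real>\<^sub>\<le>\<^sub>0" if "z \<in> ball 0 1" for z
    using re[OF that] by (auto simp: complex_nonpos_Reals_iff)
  show "(\<lambda>z. Ln (s z)) holomorphic_on ball 0 1"
    using nn by (intro holomorphic_intros hardy_disk_holomorphic[OF s]) auto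
  fix z :: complex assume z: "z \<in> ball 0 1"
  have "1 \<le> cmod (s z)" using re[OF z] complex_Re_le_cmod[of "s z"] by simp
  moreover from this have "s z \<noteq> 0" by auto
  ultimately have "(Re (Ln (s z)))\<^sup>2 \<le> (cmod (s z))\<^sup>2" "\<bar>Im (Ln (s z))\<bar> \<le> pi"
    using Im_Ln_le_pi[of "s z"] mpi_less_Im_Ln[of "s z"] ln_bound[of "cmod (s z)"] by (auto intro!: power_mono)
  moreover from this have "(Im (Ln (s z)))\<^sup>2 \<le> pi\<^sup>2"
    using power_mono[of "\<bar>Im (Ln (s z))\<bar>" pi 2] by simp
  moreover have "0 \<le> (cmod (s z))\<^sup>2" by simp
  ultimately show "(cmod (Ln (s z)))\<^sup>2 \<le> pi\<^sup>2 + 1 * (cmod (s z))\<^sup>2 + 1 * (cmod (s z))\<^sup>2"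
    unfolding cmod_power2[of "Ln (s z)"] by linarith
qed

lemma cmod_mult_less_1: "cmod l \<le> 1 \<Longrightarrow> z \<in> ball 0 1 \<Longrightarrow> cmod (l * z) < 1"
  using mult_left_le_one_le[of "cmod z" "cmod l"] by (simp add: norm_mult)

lemma outer_disk_power_mult:
  assumes s: "s \<in> hardy_disk" and re: "\<And>z. z \<in> ball 0 1 \<Longrightarrow> 1 \<le> Re (s z)" and l: "cmod l \<le> 1"
  shows "outer_disk (\<lambda>z. (1 - l * z) ^ n * s z)"
proof (rule exp_hardy_boundary(2))
  have b: "cmod (1 - l * z) \<le> 2" if "z \<in> ball 0 1" for z
    using norm_triangle_ineq4[of 1 "l * z"] cmod_mult_less_1[OF l that] by simp
  show "(\<lambda>z. (1 - l * z) ^ n * s z) \<in> hardy_disk"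
    by (rule hardy_disk_mult_bounded[OF s, where K = "2 ^ n"])
      (auto intro!: holomorphic_intros power_mono b simp: norm_power)
  show "(\<lambda>z. of_nat n * Ln (1 - l * z) + Ln (s z)) \<in> hardy_disk"
    by (intro hardy_disk_add hardy_disk_cmult hardy_disk_Ln_one_minus hardy_disk_Ln s re l)
  fix z :: complex assume z: "z \<in> ball 0 1"
  have "1 - l * z \<noteq> 0" using cmod_mult_less_1[OF l z] by auto
  moreover have "s z \<noteq> 0" using re[OF z] by auto
  ultimately show "(1 - l * z) ^ n * s z = exp (of_nat n * Ln (1 - l * z) + Ln (s z))"
    by (simp add: exp_add exp_of_nat_mult)
qed

section \<open>Jensen's inequality\<close>

text \<open>If \<open>|l| \<le> 1\<close>, then \<open>1 - l z\<close> is outer and equal to 1 at 0, so the mean is 0. A zero inside the disk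
  is reflected in the circle: \<open>|1 - l cis \<theta>| = |l| |1 - cis \<theta> / cnj l|\<close>, and the mean is \<open>ln |l|\<close>.\<close>

lemma ln_one_minus_cis:
  shows "AE \<theta> in circ. 1 - l * cis \<theta> \<noteq> 0" "integrable circ (\<lambda>\<theta>. ln (cmod (1 - l * cis \<theta>)))"
    "0 \<le> (\<integral>\<theta>. ln (cmod (1 - l * cis \<theta>)) \<partial>circ)"
proof -
  have *: "(AE \<theta> in circ. 1 - l * cis \<theta> \<noteq> 0) \<and> integrable circ (\<lambda>\<theta>. ln (cmod (1 - l * cis \<theta>))) \<and>
    (\<integral>\<theta>. ln (cmod (1 - l * cis \<theta>)) \<partial>circ) = 0" if l: "cmod l \<le> 1" for l
  proof -
    let ?f = "\<lambda>z. 1 - l * z"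
    have bv: "boundary_value ?f \<theta> = 1 - l * cis \<theta>" for \<theta>
      by (intro boundary_value_eq boundary_value_continuous continuous_intros)
    have b: "cmod (1 - l * z) \<le> 2" if "z \<in> ball 0 1" for z
      using norm_triangle_ineq4[of 1 "l * z"] cmod_mult_less_1[OF l that] by simp
    have "?f \<in> hardy_disk" 
      by (rule hardy_disk_bounded[where K = 2]) (auto intro!: holomorphic_intros b)
    moreover have "?f z = exp (Ln (1 - l * z))" if "z \<in> ball 0 1" for z
      using cmod_mult_less_1[OF l that] by (subst exp_Ln) auto
    ultimately show ?thesis
      using exp_hardy_boundary[of ?f, OF _ hardy_disk_Ln_one_minus[OF l]] by (simp add: bv outer_disk_circ)
  qed
  have "(AE \<theta> in circ. 1 - l * cis \<theta> \<noteq> 0) \<and> integrable circ (\<lambda>\<theta>. ln (cmod (1 - l * cis \<theta>))) \<and>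
    0 \<le> (\<integral>\<theta>. ln (cmod (1 - l * cis \<theta>)) \<partial>circ)"
  proof (cases "cmod l \<le> 1")
    case True
    then show ?thesis using *[OF True] by simp
  next
    case False
    then have l: "cmod l > 1" "l \<noteq> 0" by auto
    define m where "m = 1 / cnj l"
    have m: "cmod m < 1" using l by (simp add: m_def norm_divide)
    have eq: "cmod (1 - l * cis \<theta>) = cmod l * cmod (1 - m * cis \<theta>)" for \<theta>
    proof -
      have "1 - l * cis \<theta> = - l * cis \<theta> * cnj (1 - m * cis \<theta>)"
        using l by (simp add: m_def algebra_simps cis_cnj cis_mult)
      then show ?thesis by (simp add: norm_mult del: complex_cnj_diff)
    qed
    have nz: "1 - m * cis \<theta> \<noteq> 0" for \<theta>
    proof
      assume "1 - m * cis \<theta> = 0"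
      then have "cmod (m * cis \<theta>) = 1" by (metis norm_one right_minus_eq)
      then show False using m by (simp add: norm_mult)
    qed
    have "ln (cmod (1 - l * cis \<theta>)) = ln (cmod l) + ln (cmod (1 - m * cis \<theta>))" for \<theta>
      unfolding eq using l nz[of \<theta>] by (subst ln_mult) auto
    moreover have "1 - l * cis \<theta> \<noteq> 0" for \<theta> using eq[of \<theta>] l nz[of \<theta>] by auto
    ultimately show ?thesis using *[of m] m l by (simp add: circ.prob_space[simplified])
  qed
  then show "AE \<theta> in circ. 1 - l * cis \<theta> \<noteq> 0" "integrable circ (\<lambda>\<theta>. ln (cmod (1 - l * cis \<theta>)))"
    "0 \<le> (\<integral>\<theta>. ln (cmod (1 - l * cis \<theta>)) \<partial>circ)" by auto
qed

text \<open>The inverses of the roots are used because they leave the constant coefficient as the leading factor.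
  Jensen's inequality needs the value at 0, and the identity for functionals needs the lowest
  coefficients.\<close>

lemma poly_factor_list:
  fixes q :: "complex poly"
  assumes "poly q 0 \<noteq> 0"
  shows "\<exists>ls. length ls = degree q \<and> (\<forall>l\<in>set ls. l \<noteq> 0 \<and> poly q (1 / l) = 0) \<and>
     q = smult (poly q 0) (\<Prod>l\<leftarrow>ls. [:1, - l:])"
  using assms
proof (induction "degree q" arbitrary: q)
  case 0
  then obtain c where "q = [:c:]" using degree_eq_zeroE by metis
  then show ?case by (intro exI[of _ "[]"]) auto
next
  case (Suc n)
  have "coeff q (degree q) \<noteq> 0" "degree q \<in> {1..degree q}" using Suc.hyps(2) by auto
  then have "coeff q 0 = 0 \<or> (\<exists>i\<in>{1..degree q}. coeff q i \<noteq> 0)" by blast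
  then obtain a where a: "poly q a = 0"
    unfolding poly_altdef by (rule fundamental_theorem_of_algebra)
  then obtain p where p: "q = [:- a, 1:] * p" by (auto simp: poly_eq_0_iff_dvd dvd_def)
  have "a \<noteq> 0" using a Suc.prems by auto
  have p0: "p \<noteq> 0" "poly p 0 \<noteq> 0" using p Suc.prems by auto
  have "degree p = n" using Suc.hyps(2) p p0 by (simp add: degree_mult_eq del: mult_pCons_left)
  then obtain ls where ls: "length ls = degree p" "\<forall>l\<in>set ls. l \<noteq> 0 \<and> poly p (1 / l) = 0"
     "p = smult (poly p 0) (\<Prod>l\<leftarrow>ls. [:1, - l:])" using Suc.hyps(1)[of p] p0 by blast
  show ?case
  proof (intro exI[of _ "1 / a # ls"] conjI)
    show "length (1 / a # ls) = degree q" using ls(1) Suc.hyps(2) \<open>degree p = n\<close> by simp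
    show "\<forall>l\<in>set (1 / a # ls). l \<noteq> 0 \<and> poly q (1 / l) = 0"
      using ls(2) a \<open>a \<noteq> 0\<close> by (auto simp: p simp del: mult_pCons_left)
    have "q = [:- a, 1:] * smult (poly p 0) (\<Prod>l\<leftarrow>ls. [:1, - l:])" using ls(3) p by simp
    also have "[:- a, 1:] = smult (- a) [:1, - (1 / a):]" using \<open>a \<noteq> 0\<close> by simp
    also have "smult (- a) [:1, - (1 / a):] * smult (poly p 0) (\<Prod>l\<leftarrow>ls. [:1, - l:])
       = smult (- a * poly p 0) ([:1, - (1 / a):] * (\<Prod>l\<leftarrow>ls. [:1, - l:]))"
      by (simp only: mult_smult_left mult_smult_right smult_smult mult.commute[of "poly p 0"])
    also have "- a * poly p 0 = poly q 0" by (simp add: p)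
    finally show "q = smult (poly q 0) (\<Prod>l\<leftarrow>1 / a # ls. [:1, - l:])" by simp
  qed
qed

lemma ln_square_plus_bound:
  fixes x :: real
  assumes "0 < e"
  shows "\<bar>ln (x\<^sup>2 + e)\<bar> \<le> \<bar>ln e\<bar> + x\<^sup>2 / e"
proof -
  have "x\<^sup>2 + e = e * (1 + x\<^sup>2 / e)" using assms by (simp add: field_simps)
  then have "ln (x\<^sup>2 + e) = ln (e * (1 + x\<^sup>2 / e))" by simp
  also have "\<dots> = ln e + ln (1 + x\<^sup>2 / e)"
    using assms by (subst ln_mult) (auto simp: add_nonneg_eq_0_iff)
  finally have 1: "ln (x\<^sup>2 + e) = ln e + ln (1 + x\<^sup>2 / e)" .
  have "0 \<le> x\<^sup>2 / e" using assms by simp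
  then have "0 \<le> ln (1 + x\<^sup>2 / e)" "ln (1 + x\<^sup>2 / e) \<le> x\<^sup>2 / e"
    by (auto intro: ln_add_one_self_le_self)
  then show ?thesis unfolding 1 by linarith
qed

text \<open>The summand \<open>e\<close> keeps the logarithm continuous across zeros on the circle, so that the inequality
  survives passage to the limit.\<close>

lemma jensen_poly:
  fixes p :: "complex poly"
  assumes p: "poly p 0 \<noteq> 0" and e: "0 < e"
  shows "2 * ln (cmod (poly p 0)) \<le> (\<integral>\<theta>. ln ((cmod (poly p (cis \<theta>)))\<^sup>2 + e) \<partial>circ)"
proof -
  obtain ls where ls: "p = smult (poly p 0) (\<Prod>l\<leftarrow>ls. [:1, - l:])"
    using poly_factor_list[OF p] by blast
  have pz: "poly p z = poly p 0 * (\<Prod>l\<leftarrow>ls. 1 - l * z)" for z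
  proof -
    have "poly (\<Prod>l\<leftarrow>ls. [:1, - l:]) z = (\<Prod>l\<leftarrow>ls. 1 - l * z)" for ls
      by (induction ls) (auto simp: mult.commute simp del: mult_pCons_left)
    then show ?thesis by (subst ls) simp
  qed
  have prods: "(AE \<theta> in circ. (\<Prod>l\<leftarrow>ls. 1 - l * cis \<theta>) \<noteq> 0) \<and> 
      integrable circ (\<lambda>\<theta>. \<Sum>l\<leftarrow>ls. ln (cmod (1 - l * cis \<theta>))) \<and>
      0 \<le> (\<integral>\<theta>. (\<Sum>l\<leftarrow>ls. ln (cmod (1 - l * cis \<theta>))) \<partial>circ)" for ls
    by (induction ls) (use ln_one_minus_cis in auto)
  have sum: "ln (cmod (\<Prod>l\<leftarrow>ls. 1 - l * cis \<theta>)) = (\<Sum>l\<leftarrow>ls. ln (cmod (1 - l * cis \<theta>)))"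
    if "(\<Prod>l\<leftarrow>ls. 1 - l * cis \<theta>) \<noteq> 0" for ls \<theta>
    using that by (induction ls) (auto simp: norm_mult ln_mult)
  let ?S = "\<lambda>\<theta>. \<Sum>l\<leftarrow>ls. ln (cmod (1 - l * cis \<theta>))"
  have "2 * ln (cmod (poly p 0)) \<le> (\<integral>\<theta>. 2 * ln (cmod (poly p 0)) + 2 * ?S \<theta> \<partial>circ)"
    using prods[of ls] by (simp add: circ.prob_space[simplified])
  also have "\<dots> \<le> (\<integral>\<theta>. ln ((cmod (poly p (cis \<theta>)))\<^sup>2 + e) \<partial>circ)"
  proof (rule integral_mono_AE)
    show "integrable circ (\<lambda>\<theta>. 2 * ln (cmod (poly p 0)) + 2 * ?S \<theta>)" using prods[of ls] by auto
    show "integrable circ (\<lambda>\<theta>. ln ((cmod (poly p (cis \<theta>)))\<^sup>2 + e))"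
    proof (rule integrable_circ_cis(1)[of "\<lambda>z. ln ((cmod (poly p z))\<^sup>2 + e)"])
      have "(cmod (poly p z))\<^sup>2 + e \<noteq> 0" for z using e zero_le_power2[of "cmod (poly p z)"] by linarith
      then show "continuous_on (sphere 0 1) (\<lambda>z. ln ((cmod (poly p z))\<^sup>2 + e))"
        by (intro continuous_intros) auto
    qed
    show "AE \<theta> in circ. 2 * ln (cmod (poly p 0)) + 2 * ?S \<theta> \<le> ln ((cmod (poly p (cis \<theta>)))\<^sup>2 + e)"
      using conjunct1[OF prods[of ls]]
    proof eventually_elim
      case (elim \<theta>)
      have nz: "poly p (cis \<theta>) \<noteq> 0" using elim p unfolding pz[of "cis \<theta>"] by simp
      have "2 * ln (cmod (poly p 0)) + 2 * ?S \<theta> = 2 * ln (cmod (poly p (cis \<theta>)))"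
        unfolding pz[of "cis \<theta>"] using elim p by (simp add: norm_mult ln_mult sum)
      also have "\<dots> = ln ((cmod (poly p (cis \<theta>)))\<^sup>2)" using nz by (simp add: ln_realpow)
      also have "\<dots> \<le> ln ((cmod (poly p (cis \<theta>)))\<^sup>2 + e)" using nz e by (subst ln_le_cancel_iff) (auto intro: add_pos_pos)
      finally show ?case .
    qed
  qed
  finally show ?thesis .
qed

text \<open>The Taylor polynomials converge on each circle of radius less than 1, and then the radius tends to 1
  under the maximal function.\<close>

lemma jensen_regularized:
  assumes f: "f \<in> hardy_disk" and f0: "f 0 \<noteq> 0" and e: "0 < e"
  shows "2 * ln (cmod (f 0)) \<le> (\<integral>\<theta>. ln ((cmod (boundary_value f \<theta>))\<^sup>2 + e) \<partial>circ)"
proof -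
  have [measurable]: "boundary_value f \<in> borel_measurable borel"
    using f measurable_boundary_value hardy_disk_holomorphic by auto
  obtain c where s: "\<And>z. z \<in> ball 0 1 \<Longrightarrow> (\<lambda>n. c n * z ^ n) sums f z"
    using hardy_disk_seriesE[OF f] by blast
  have pos: "(cmod z)\<^sup>2 + e \<noteq> 0" for z using e zero_le_power2[of "cmod z"] by linarith
  have c0: "c 0 = f 0" using s[of 0] by (simp add: sums_iff)
  have r_bound: "2 * ln (cmod (f 0)) \<le> (\<integral>\<theta>. ln ((cmod (f (of_real r * cis \<theta>)))\<^sup>2 + e) \<partial>circ)" if r: "0 \<le> r" "r < 1" for r
  proof -
    define P where "P = (\<lambda>N. \<Sum>n<N. monom (c n * of_real r ^ n) n)"
    have P: "poly (P N) z = (\<Sum>n<N. c n * (of_real r * z) ^ n)" for N z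
      by (simp add: P_def poly_sum poly_monom power_mult_distrib mult_ac)
    have "summable (\<lambda>n. c n * of_real ((1 + r) / 2) ^ n)"
      using s[of "of_real ((1 + r) / 2)"] r by (auto simp: sums_iff simp del: of_real_divide of_real_add)
    then have sm: "summable (\<lambda>n. cmod (c n * of_real r ^ n))"
      by (rule powser_insidea) (use r in \<open>auto simp del: of_real_divide of_real_add\<close>)
    define K where "K = (\<Sum>n. cmod (c n * of_real r ^ n))"
    have PK: "cmod (poly (P N) (cis \<theta>)) \<le> K" for N \<theta>
    proof -
      have "cmod (poly (P N) (cis \<theta>)) \<le> (\<Sum>n<N. cmod (c n * of_real r ^ n))"
        unfolding P by (rule order_trans[OF norm_sum]) (simp add: norm_mult norm_power)
      also have "\<dots> \<le> K" unfolding K_def by (rule sum_le_suminf[OF sm]) auto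
      finally show ?thesis .
    qed
    have lim: "(\<lambda>N. poly (P N) (cis \<theta>)) \<longlonglongrightarrow> f (of_real r * cis \<theta>)" for \<theta>
      unfolding P using s[of "of_real r * cis \<theta>"] r by (simp add: sums_def norm_mult)
    have [measurable]: "(\<lambda>\<theta>. f (of_real r * cis \<theta>)) \<in> borel_measurable borel"
      by (rule integrable_circ_holomorphic(1)[OF hardy_disk_holomorphic[OF f] r])
    have [measurable]: "(\<lambda>\<theta>. poly (P N) (cis \<theta>)) \<in> borel_measurable borel" for N
      by (intro borel_measurable_continuous_onI continuous_intros)
    have "(\<lambda>N. \<integral>\<theta>. ln ((cmod (poly (P N) (cis \<theta>)))\<^sup>2 + e) \<partial>circ) \<longlonglongrightarrow> (\<integral>\<theta>. ln ((cmod (f (of_real r * cis \<theta>)))\<^sup>2 + e) \<partial>circ)"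
    proof (rule integral_dominated_convergence[where w = "\<lambda>_. \<bar>ln e\<bar> + K\<^sup>2 / e"])
      show "AE \<theta> in circ. (\<lambda>N. ln ((cmod (poly (P N) (cis \<theta>)))\<^sup>2 + e)) \<longlonglongrightarrow> ln ((cmod (f (of_real r * cis \<theta>)))\<^sup>2 + e)"
        by (intro AE_I2 tendsto_intros lim pos)
      show "AE \<theta> in circ. norm (ln ((cmod (poly (P N) (cis \<theta>)))\<^sup>2 + e)) \<le> \<bar>ln e\<bar> + K\<^sup>2 / e" for N
      proof (rule AE_I2)
        fix \<theta>
        have "(cmod (poly (P N) (cis \<theta>)))\<^sup>2 / e \<le> K\<^sup>2 / e"
          using e PK[of N \<theta>] by (intro divide_right_mono power_mono) auto
        then show "norm (ln ((cmod (poly (P N) (cis \<theta>)))\<^sup>2 + e)) \<le> \<bar>ln e\<bar> + K\<^sup>2 / e"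
          using ln_square_plus_bound[OF e, of "cmod (poly (P N) (cis \<theta>))"] by simp
      qed
    qed auto
    moreover have "2 * ln (cmod (f 0)) \<le> (\<integral>\<theta>. ln ((cmod (poly (P N) (cis \<theta>)))\<^sup>2 + e) \<partial>circ)" if "N \<ge> 1" for N
    proof -
      have "poly (P N) 0 = f 0"
        using that c0 unfolding P by (cases N) (auto simp: sum.lessThan_Suc_shift simp del: sum.lessThan_Suc)
      then show ?thesis using jensen_poly[of "P N" e] f0 e by simp
    qed
    ultimately show ?thesis by (intro LIMSEQ_le_const) auto
  qed
  obtain M where [measurable]: "M \<in> borel_measurable borel" and M: "\<And>\<theta>. 0 \<le> M \<theta>" "integrable circ (\<lambda>\<theta>. (M \<theta>)\<^sup>2)"
    and MA: "AE \<theta> in circ. (\<forall>r. 0 \<le> r \<and> r < 1 \<longrightarrow> cmod (f (of_real r * cis \<theta>)) \<le> M \<theta>) \<and>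
       ((\<lambda>n. f (of_real (rad n) * cis \<theta>)) \<longlonglongrightarrow> boundary_value f \<theta>) \<and> cmod (boundary_value f \<theta>) \<le> M \<theta>"
    using hardy_boundary[OF f] by blast
  have [measurable]: "(\<lambda>\<theta>. f (of_real (rad n) * cis \<theta>)) \<in> borel_measurable borel" for n
    by (rule integrable_circ_holomorphic(1)[OF hardy_disk_holomorphic[OF f] rad])
  have "(\<lambda>n. \<integral>\<theta>. ln ((cmod (f (of_real (rad n) * cis \<theta>)))\<^sup>2 + e) \<partial>circ) \<longlonglongrightarrow> (\<integral>\<theta>. ln ((cmod (boundary_value f \<theta>))\<^sup>2 + e) \<partial>circ)"
  proof (rule integral_dominated_convergence[where w = "\<lambda>\<theta>. \<bar>ln e\<bar> + (M \<theta>)\<^sup>2 / e"])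
    show "AE \<theta> in circ. (\<lambda>n. ln ((cmod (f (of_real (rad n) * cis \<theta>)))\<^sup>2 + e)) \<longlonglongrightarrow> ln ((cmod (boundary_value f \<theta>))\<^sup>2 + e)"
      using MA by eventually_elim (auto intro!: tendsto_intros pos)
    show "AE \<theta> in circ. norm (ln ((cmod (f (of_real (rad n) * cis \<theta>)))\<^sup>2 + e)) \<le> \<bar>ln e\<bar> + (M \<theta>)\<^sup>2 / e" for n
      using MA
    proof eventually_elim
      case (elim \<theta>)
      have "(cmod (f (of_real (rad n) * cis \<theta>)))\<^sup>2 / e \<le> (M \<theta>)\<^sup>2 / e"
        using e elim rad by (intro divide_right_mono power_mono) auto
      then show ?case
        using ln_square_plus_bound[OF e, of "cmod (f (of_real (rad n) * cis \<theta>))"] by simp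
    qed
    show "integrable circ (\<lambda>\<theta>. \<bar>ln e\<bar> + (M \<theta>)\<^sup>2 / e)" using M by auto
  qed auto
  then show ?thesis
    using r_bound[OF rad] by (intro LIMSEQ_le_const) auto
qed

text \<open>Let \<open>e\<close> tend to 0 in \<open>jensen_regularized\<close>. At a zero of the boundary value the regularised logarithm
  is not positive, so it may be replaced by 0, in agreement with the convention \<open>ln 0 = 0\<close>.\<close>

theorem jensen_hardy:
  assumes f: "f \<in> hardy_disk" and f0: "f 0 \<noteq> 0" and int: "integrable circ (\<lambda>\<theta>. ln (cmod (boundary_value f \<theta>)))"
  shows "ln (cmod (f 0)) \<le> (\<integral>\<theta>. ln (cmod (boundary_value f \<theta>)) \<partial>circ)"
proof -
  have [measurable]: "boundary_value f \<in> borel_measurable borel"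
    using f measurable_boundary_value hardy_disk_holomorphic by auto
  obtain M where [measurable]: "M \<in> borel_measurable borel" and M: "\<And>\<theta>. 0 \<le> M \<theta>" "integrable circ (\<lambda>\<theta>. (M \<theta>)\<^sup>2)"
    and MA: "AE \<theta> in circ. (\<forall>r. 0 \<le> r \<and> r < 1 \<longrightarrow> cmod (f (of_real r * cis \<theta>)) \<le> M \<theta>) \<and>
       ((\<lambda>n. f (of_real (rad n) * cis \<theta>)) \<longlonglongrightarrow> boundary_value f \<theta>) \<and> cmod (boundary_value f \<theta>) \<le> M \<theta>"
    using hardy_boundary[OF f] by blast
  define b where "b = (\<lambda>\<theta>. cmod (boundary_value f \<theta>))"
  have [measurable]: "b \<in> borel_measurable borel" unfolding b_def by measurable
  have b0: "0 \<le> b \<theta>" for \<theta> by (simp add: b_def)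
  have bM: "AE \<theta> in circ. b \<theta> \<le> M \<theta>" unfolding b_def using MA by eventually_elim auto
  \<comment> \<open>The case distinction makes the pointwise limit \<open>2 * ln (b \<theta>)\<close> at zeros of \<open>b\<close> too.\<close>
  define \<psi> where "\<psi> = (\<lambda>n \<theta>. if b \<theta> = 0 then 0 else ln ((b \<theta>)\<^sup>2 + 1 / real (Suc n)))"
  have le: "2 * ln (cmod (f 0)) \<le> (\<integral>\<theta>. \<psi> n \<theta> \<partial>circ)" for n
  proof -
    have e: "0 < 1 / real (Suc n)" "1 / real (Suc n) \<le> 1" by auto
    have i: "integrable circ (\<lambda>\<theta>. \<bar>ln (1 / real (Suc n))\<bar> + (M \<theta>)\<^sup>2 / (1 / real (Suc n)))" using M by auto
    have bd: "AE \<theta> in circ. \<bar>ln ((b \<theta>)\<^sup>2 + 1 / real (Suc n))\<bar> \<le> \<bar>ln (1 / real (Suc n))\<bar> + (M \<theta>)\<^sup>2 / (1 / real (Suc n))"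
      using bM
    proof eventually_elim
      case (elim \<theta>)
      have "(b \<theta>)\<^sup>2 / (1 / real (Suc n)) \<le> (M \<theta>)\<^sup>2 / (1 / real (Suc n))"
        using elim b0 by (intro divide_right_mono power_mono) auto
      then show ?case using ln_square_plus_bound[OF e(1), of "b \<theta>"] by linarith
    qed
    have "2 * ln (cmod (f 0)) \<le> (\<integral>\<theta>. ln ((b \<theta>)\<^sup>2 + 1 / real (Suc n)) \<partial>circ)"
      unfolding b_def by (rule jensen_regularized[OF f f0 e(1)])
    also have "\<dots> \<le> (\<integral>\<theta>. \<psi> n \<theta> \<partial>circ)"
    proof (rule integral_mono_AE)
      show "integrable circ (\<lambda>\<theta>. ln ((b \<theta>)\<^sup>2 + 1 / real (Suc n)))"
        by (rule Bochner_Integration.integrable_bound[OF i]) (use bd in \<open>auto elim!: eventually_mono\<close>)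
      show "integrable circ (\<psi> n)"
        by (rule Bochner_Integration.integrable_bound[OF i]) (use bd in \<open>auto simp: \<psi>_def elim!: eventually_mono\<close>)
      show "AE \<theta> in circ. ln ((b \<theta>)\<^sup>2 + 1 / real (Suc n)) \<le> \<psi> n \<theta>"
        by (rule AE_I2) (use e in \<open>auto simp: \<psi>_def\<close>)
    qed
    finally show ?thesis .
  qed
  have "(\<lambda>n. \<integral>\<theta>. \<psi> n \<theta> \<partial>circ) \<longlonglongrightarrow> (\<integral>\<theta>. 2 * ln (b \<theta>) \<partial>circ)"
  proof (rule integral_dominated_convergence[where w = "\<lambda>\<theta>. 2 * \<bar>ln (b \<theta>)\<bar> + (M \<theta>)\<^sup>2"])
    show "integrable circ (\<lambda>\<theta>. 2 * \<bar>ln (b \<theta>)\<bar> + (M \<theta>)\<^sup>2)" using int M by (auto simp: b_def)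
    show "AE \<theta> in circ. (\<lambda>n. \<psi> n \<theta>) \<longlonglongrightarrow> 2 * ln (b \<theta>)"
    proof (rule AE_I2)
      fix \<theta>
      show "(\<lambda>n. \<psi> n \<theta>) \<longlonglongrightarrow> 2 * ln (b \<theta>)"
      proof (cases "b \<theta> = 0")
        case False
        have "(\<lambda>n. ln ((b \<theta>)\<^sup>2 + 1 / real (Suc n))) \<longlonglongrightarrow> ln ((b \<theta>)\<^sup>2 + 0)"
          using False by (intro tendsto_intros LIMSEQ_Suc[OF lim_const_over_n]) auto
        moreover have "ln ((b \<theta>)\<^sup>2 + 0) = 2 * ln (b \<theta>)" using False b0[of \<theta>] by (simp add: ln_realpow)
        ultimately show ?thesis using False by (simp add: \<psi>_def)
      qed (simp add: \<psi>_def)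
    qed
    show "AE \<theta> in circ. norm (\<psi> n \<theta>) \<le> 2 * \<bar>ln (b \<theta>)\<bar> + (M \<theta>)\<^sup>2" for n
      using bM
    proof eventually_elim
      case (elim \<theta>)
      show ?case
      proof (cases "b \<theta> = 0")
        case False
        then have bp: "0 < (b \<theta>)\<^sup>2" by simp
        have "2 * ln (b \<theta>) = ln ((b \<theta>)\<^sup>2)" using False b0[of \<theta>] by (simp add: ln_realpow)
        moreover have "ln ((b \<theta>)\<^sup>2) \<le> ln ((b \<theta>)\<^sup>2 + 1 / real (Suc n))"
          using bp by (subst ln_le_cancel_iff) (auto intro: add_pos_pos)
        moreover have "ln ((b \<theta>)\<^sup>2 + 1 / real (Suc n)) \<le> ln (1 + (b \<theta>)\<^sup>2)"
          using bp by (subst ln_le_cancel_iff) (auto intro: add_pos_pos)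
        moreover have "ln (1 + (b \<theta>)\<^sup>2) \<le> (b \<theta>)\<^sup>2" by (rule ln_add_one_self_le_self) simp
        moreover have "(b \<theta>)\<^sup>2 \<le> (M \<theta>)\<^sup>2" using elim b0 by (intro power_mono) auto
        moreover have "\<psi> n \<theta> = ln ((b \<theta>)\<^sup>2 + 1 / real (Suc n))" using False by (simp add: \<psi>_def)
        moreover have "0 \<le> (M \<theta>)\<^sup>2" by simp
        moreover have "\<bar>y\<bar> \<le> 2 * \<bar>l\<bar> + m" if "2 * l \<le> y" "y \<le> m" "0 \<le> m" for y l m :: real
          using that by linarith
        ultimately show ?thesis unfolding real_norm_def by simp
      qed (simp add: \<psi>_def)
    qed
  qed (auto simp: \<psi>_def)
  then have "2 * ln (cmod (f 0)) \<le> (\<integral>\<theta>. 2 * ln (b \<theta>) \<partial>circ)"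
    using le by (intro LIMSEQ_le_const) auto
  then show ?thesis by (simp add: b_def)
qed

section \<open>Outer functions have no zeros\<close>

text \<open>Away from \<open>a\<close> the factor \<open>z - a\<close> is bounded below; near \<open>a\<close> the quotient is bounded by compactness.\<close>

lemma hardy_disk_divide:
  assumes f: "f \<in> hardy_disk" and a: "a \<in> ball 0 1" and fa: "f a = 0"
  obtains k where "k \<in> hardy_disk" "\<And>z. z \<in> ball 0 1 \<Longrightarrow> f z = (z - a) * k z"
proof -
  define k where "k = (\<lambda>z. if z = a then deriv f a else (f z - f a) / (z - a))"
  have k: "k holomorphic_on ball 0 1"
    unfolding k_def using pole_lemma[OF hardy_disk_holomorphic[OF f], of a] a by simp
  have eq: "f z = (z - a) * k z" if "z \<in> ball 0 1" for z using fa by (simp add: k_def)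
  define \<rho> where "\<rho> = (1 + cmod a) / 2"
  have \<rho>: "cmod a < \<rho>" "\<rho> < 1" using a by (auto simp: \<rho>_def)
  have "compact (k ` cball 0 \<rho>)"
    using \<rho> by (intro compact_continuous_image continuous_on_subset[OF holomorphic_on_imp_continuous_on[OF k]]) auto
  then obtain K where K: "\<And>z. z \<in> cball 0 \<rho> \<Longrightarrow> cmod (k z) \<le> K"
    unfolding compact_eq_bounded_closed bounded_iff by (metis imageI)
  have "k \<in> hardy_disk"
  proof (rule hardy_disk_bound[OF k f f])
    fix z :: complex assume z: "z \<in> ball 0 1"
    let ?c = "1 / (\<rho> - cmod a)\<^sup>2"
    show "(cmod (k z))\<^sup>2 \<le> K\<^sup>2 + ?c * (cmod (f z))\<^sup>2 + ?c * (cmod (f z))\<^sup>2"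
    proof (cases "z \<in> cball 0 \<rho>")
      case True
      have "(cmod (k z))\<^sup>2 \<le> K\<^sup>2" using K[OF True] by (intro power_mono) auto
      moreover have "0 \<le> ?c * (cmod (f z))\<^sup>2" by simp
      ultimately show ?thesis by linarith
    next
      case False
      then have d: "\<rho> - cmod a \<le> cmod (z - a)" using norm_triangle_ineq2[of z a] by simp
      then have "cmod (k z) * (\<rho> - cmod a) \<le> cmod (f z)"
        unfolding eq[OF z] norm_mult by (subst mult.commute) (intro mult_right_mono, auto)
      then have "cmod (k z) \<le> cmod (f z) / (\<rho> - cmod a)" using \<rho> by (simp add: field_simps)
      then have "(cmod (k z))\<^sup>2 \<le> (cmod (f z) / (\<rho> - cmod a))\<^sup>2" by (intro power_mono) auto
      also have "\<dots> = ?c * (cmod (f z))\<^sup>2" by (simp add: power_divide)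
      finally show ?thesis by (smt (verit) zero_le_power2)
    qed
  qed simp
  then show thesis using eq that by blast
qed

text \<open>If \<open>f a = 0\<close>, replace the factor \<open>z - a\<close> by \<open>1 - cnj a z\<close>. The boundary values keep their modulus, but
  the modulus at 0 grows by the factor \<open>1 / |a|\<close>, which contradicts Jensen's inequality.\<close>

theorem outer_disk_nonzero:
  assumes "outer_disk f" and a: "a \<in> ball 0 1"
  shows "f a \<noteq> 0"
proof
  assume fa: "f a = 0"
  have f: "f \<in> hardy_disk" "f 0 \<noteq> 0" "integrable circ (\<lambda>\<theta>. ln (cmod (boundary_value f \<theta>)))"
    "ln (cmod (f 0)) = (\<integral>\<theta>. ln (cmod (boundary_value f \<theta>)) \<partial>circ)"
    using assms(1) by (auto simp: outer_disk_circ)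
  obtain k where k: "k \<in> hardy_disk" and eq: "\<And>z. z \<in> ball 0 1 \<Longrightarrow> f z = (z - a) * k z"
    using hardy_disk_divide[OF f(1) a fa] by blast
  define g where "g = (\<lambda>z. (1 - cnj a * z) * k z)"
  have "a \<noteq> 0" using fa f(2) by auto
  have g: "g \<in> hardy_disk"
    unfolding g_def
  proof (rule hardy_disk_mult_bounded[OF k, where K = 2])
    show "(\<lambda>z. 1 - cnj a * z) holomorphic_on ball 0 1" by (intro holomorphic_intros)
    show "cmod (1 - cnj a * z) \<le> 2" if "z \<in> ball 0 1" for z
      using norm_triangle_ineq4[of 1 "cnj a * z"] cmod_mult_less_1[of "cnj a" z] that a by simp
  qed
  have [measurable]: "boundary_value f \<in> borel_measurable borel" "boundary_value g \<in> borel_measurable borel"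
    using f(1) g measurable_boundary_value hardy_disk_holomorphic by auto
  have ae: "AE \<theta> in circ. cmod (boundary_value g \<theta>) = cmod (boundary_value f \<theta>)"
    using radial_limit_AE[OF k]
  proof eventually_elim
    case (elim \<theta>)
    have "((\<lambda>r. g (of_real r * cis \<theta>)) \<longlongrightarrow> (1 - cnj a * (of_real 1 * cis \<theta>)) * boundary_value k \<theta>) (at_left 1)"
      unfolding g_def by (intro tendsto_intros elim)
    then have 1: "boundary_value g \<theta> = (1 - cnj a * cis \<theta>) * boundary_value k \<theta>"
      using boundary_value_eq by fastforce
    have "((\<lambda>r. (of_real r * cis \<theta> - a) * k (of_real r * cis \<theta>)) \<longlongrightarrow> (of_real 1 * cis \<theta> - a) * boundary_value k \<theta>) (at_left 1)"
      by (intro tendsto_intros elim)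
    moreover have "\<forall>\<^sub>F r in at_left (1::real). (of_real r * cis \<theta> - a) * k (of_real r * cis \<theta>) = f (of_real r * cis \<theta>)"
      unfolding eventually_at_left_field using eq by (intro exI[of _ 0]) (auto simp: norm_mult)
    ultimately have "((\<lambda>r. f (of_real r * cis \<theta>)) \<longlongrightarrow> (of_real 1 * cis \<theta> - a) * boundary_value k \<theta>) (at_left 1)"
      by (rule Lim_transform_eventually)
    then have 2: "boundary_value f \<theta> = (cis \<theta> - a) * boundary_value k \<theta>"
      using boundary_value_eq by fastforce
    have "1 - cnj a * cis \<theta> = cis \<theta> * cnj (cis \<theta> - a)"
      by (simp add: algebra_simps cis_cnj cis_mult)
    then have "cmod (1 - cnj a * cis \<theta>) = cmod (cis \<theta> - a)" by (simp add: norm_mult del: complex_cnj_diff)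
    then show ?case by (simp add: 1 2 norm_mult)
  qed
  have int: "integrable circ (\<lambda>\<theta>. ln (cmod (boundary_value g \<theta>)))"
    using f(3) ae by (subst integrable_cong_AE[of _ _ "\<lambda>\<theta>. ln (cmod (boundary_value f \<theta>))"]) (auto elim: eventually_mono)
  have "(\<integral>\<theta>. ln (cmod (boundary_value g \<theta>)) \<partial>circ) = (\<integral>\<theta>. ln (cmod (boundary_value f \<theta>)) \<partial>circ)"
    using ae by (intro integral_cong_AE) (auto elim: eventually_mono)
  moreover have f0: "f 0 = - a * k 0" and g0: "g 0 = k 0" using eq[of 0] by (auto simp: g_def)
  moreover have "k 0 \<noteq> 0" using f(2) f0 by auto
  ultimately have "ln (cmod (k 0)) \<le> ln (cmod (f 0))"
    using jensen_hardy[OF g _ int] f(4) by simp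
  moreover have "ln (cmod (f 0)) = ln (cmod a) + ln (cmod (k 0))"
    using \<open>a \<noteq> 0\<close> \<open>k 0 \<noteq> 0\<close> by (simp add: f0 norm_mult ln_mult)
  moreover have "ln (cmod a) < 0" using \<open>a \<noteq> 0\<close> a by simp
  ultimately show False by simp
qed

section \<open>Bessel's inequality\<close>

lemma measurable_cnj [measurable]: "cnj \<in> borel_measurable borel"
  by (intro borel_measurable_continuous_onI continuous_intros)

lemma integrable_mult_L2:
  fixes f g :: "'a \<Rightarrow> complex"
  assumes [measurable]: "f \<in> borel_measurable M" "g \<in> borel_measurable M"
    and f2: "integrable M (\<lambda>x. (cmod (f x))\<^sup>2)" and g2: "integrable M (\<lambda>x. (cmod (g x))\<^sup>2)"
  shows "integrable M (\<lambda>x. f x * g x)"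
  using Cauchy_Schwarz_integral(1)[OF _ _ f2 g2] by (subst integrable_norm_iff[symmetric]) (auto simp: norm_mult)

theorem bessel_inequality:
  fixes u :: "'a \<Rightarrow> complex" and e :: "nat \<Rightarrow> 'a \<Rightarrow> complex"
  assumes [measurable]: "u \<in> borel_measurable M" "\<And>n. e n \<in> borel_measurable M"
    and u2: "integrable M (\<lambda>x. (cmod (u x))\<^sup>2)" and e2: "\<And>n. integrable M (\<lambda>x. (cmod (e n x))\<^sup>2)"
    and orth: "\<And>m n. (\<integral>x. e m x * cnj (e n x) \<partial>M) = (if m = n then 1 else 0)"
  shows "(\<Sum>n<N. (cmod (\<integral>x. u x * cnj (e n x) \<partial>M))\<^sup>2) \<le> (\<integral>x. (cmod (u x))\<^sup>2 \<partial>M)"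
proof -
  define c where "c = (\<lambda>n. \<integral>x. u x * cnj (e n x) \<partial>M)"
  define P where "P = (\<lambda>x. \<Sum>n<N. c n * e n x)"
  have iu: "integrable M (\<lambda>x. u x * cnj (u x))"
    using u2 by (intro integrable_mult_L2) auto
  have iue: "integrable M (\<lambda>x. u x * cnj (e n x))" for n
    using u2 e2 by (intro integrable_mult_L2) auto
  have ieu: "integrable M (\<lambda>x. e n x * cnj (u x))" for n
    using u2 e2 by (intro integrable_mult_L2) auto
  have iee: "integrable M (\<lambda>x. e m x * cnj (e n x))" for m n
    using e2 by (intro integrable_mult_L2) auto
  have ceu: "(\<integral>x. e n x * cnj (u x) \<partial>M) = cnj (c n)" for n
    unfolding c_def Bochner_Integration.integral_cnj[symmetric] by (simp add: mult.commute)
  have "complex_of_real (\<integral>x. (cmod (u x - P x))\<^sup>2 \<partial>M) = (\<integral>x. of_real ((cmod (u x - P x))\<^sup>2) \<partial>M)"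
    by (rule integral_complex_of_real[symmetric])
  also have "(\<lambda>x. complex_of_real ((cmod (u x - P x))\<^sup>2)) = (\<lambda>x. u x * cnj (u x) - (\<Sum>n<N. cnj (c n) * (u x * cnj (e n x)))
     - (\<Sum>n<N. c n * (e n x * cnj (u x))) + (\<Sum>m<N. \<Sum>n<N. (c m * cnj (c n)) * (e m x * cnj (e n x))))"
    unfolding complex_norm_square P_def complex_cnj_diff cnj_sum
    by (rule ext) (simp add: algebra_simps sum_distrib_left sum_distrib_right sum_product, rule sum.swap)
  also have "(\<integral>x. u x * cnj (u x) - (\<Sum>n<N. cnj (c n) * (u x * cnj (e n x)))
     - (\<Sum>n<N. c n * (e n x * cnj (u x))) + (\<Sum>m<N. \<Sum>n<N. (c m * cnj (c n)) * (e m x * cnj (e n x))) \<partial>M)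
     = (\<integral>x. u x * cnj (u x) \<partial>M) - (\<Sum>n<N. cnj (c n) * c n)
     - (\<Sum>n<N. c n * cnj (c n)) + (\<Sum>m<N. \<Sum>n<N. (c m * cnj (c n)) * (if m = n then 1 else 0))"
    using iu iue ieu iee by (simp add: Bochner_Integration.integral_sum ceu orth) (simp add: c_def)
  also have "\<dots> = (\<integral>x. u x * cnj (u x) \<partial>M) - (\<Sum>n<N. cnj (c n) * c n)"
    by (simp add: if_distrib cong: if_cong)
  also have "\<dots> = of_real ((\<integral>x. (cmod (u x))\<^sup>2 \<partial>M) - (\<Sum>n<N. (cmod (c n))\<^sup>2))"
    unfolding of_real_diff of_real_sum integral_complex_of_real[symmetric] complex_norm_square
    by (simp add: mult.commute)
  finally have "(\<integral>x. (cmod (u x - P x))\<^sup>2 \<partial>M) = (\<integral>x. (cmod (u x))\<^sup>2 \<partial>M) - (\<Sum>n<N. (cmod (c n))\<^sup>2)"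
    by (simp only: of_real_eq_iff)
  moreover have "0 \<le> (\<integral>x. (cmod (u x - P x))\<^sup>2 \<partial>M)" by simp
  ultimately show ?thesis by (simp add: c_def)
qed

section \<open>Harmonic majorants\<close>

text \<open>Let \<open>h\<close> be the Herglotz integral of the maximal function \<open>M\<close> of \<open>f\<close>. Then \<open>Re h\<close> is the Poisson
  integral of \<open>M\<close>. The values of \<open>f\<close> are Poisson means of its values on circles, which \<open>M\<close>
  dominates, so \<open>|f| \<le> Re h\<close>. Up to a factor 2 the Taylor coefficients of \<open>h\<close> are Fourier coefficients
  of \<open>M\<close>, and Bessel's inequality puts \<open>h\<close> into the Hardy space.\<close>

theorem hardy_majorant:
  assumes f: "f \<in> hardy_disk"
  obtains h where "h \<in> hardy_disk" "\<And>z. z \<in> ball 0 1 \<Longrightarrow> cmod (f z) \<le> Re (h z)"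
proof -
  obtain M where M_meas [measurable]: "M \<in> borel_measurable borel" and M: "\<And>\<theta>. 0 \<le> M \<theta>" "integrable circ (\<lambda>\<theta>. (M \<theta>)\<^sup>2)"
    and MA: "AE \<theta> in circ. \<forall>r. 0 \<le> r \<and> r < 1 \<longrightarrow> cmod (f (of_real r * cis \<theta>)) \<le> M \<theta>"
    using maximal_hardy[OF f] by blast
  have M1: "M \<theta> \<le> 1 + (M \<theta>)\<^sup>2" for \<theta>
    using zero_le_power2[of "M \<theta> - 1"] M(1)[of \<theta>] by (simp add: power2_eq_square algebra_simps)
  have Mi: "integrable circ M"
    by (rule Bochner_Integration.integrable_bound[of _ "\<lambda>\<theta>. 1 + (M \<theta>)\<^sup>2"]) (use M M1 in auto)
  define k where "k = (\<lambda>n::nat. if n = 0 then 1 else (2::complex))"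
  define c where "c = (\<lambda>n. \<integral>\<theta>. of_real (M \<theta>) * cnj (cis \<theta> ^ n) \<partial>circ)"
  define K where "K = (\<lambda>z \<theta>. (cis \<theta> + z) / (cis \<theta> - z))"
  define h where "h = (\<lambda>z. \<integral>\<theta>. of_real (M \<theta>) * K z \<theta> \<partial>circ)"
  have K_sums: "(\<lambda>n. k n * (z * cnj (cis \<theta>)) ^ n) sums K z \<theta>" if z: "z \<in> ball 0 1" for z \<theta>
  proof -
    let ?w = "z * cnj (cis \<theta>)"
    have w: "cmod ?w < 1" using z by (simp add: norm_mult)
    have "(\<lambda>n. 2 * ?w ^ n - (if n = 0 then 1 else 0)) sums (2 * (1 / (1 - ?w)) - 1)"
      by (intro sums_diff sums_mult geometric_sums w sums_single)
    moreover have "2 * ?w ^ n - (if n = 0 then 1 else 0) = k n * ?w ^ n" for n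
      by (auto simp: k_def)
    moreover have "2 * (1 / (1 - ?w)) - 1 = K z \<theta>"
    proof -
      have "1 - ?w \<noteq> 0" using w by auto
      then have "2 * (1 / (1 - ?w)) - 1 = (1 + ?w) / (1 - ?w)" by (simp add: field_simps)
      also have "\<dots> = (cis \<theta> * (1 + ?w)) / (cis \<theta> * (1 - ?w))" by simp
      also have "cis \<theta> * (1 + ?w) = cis \<theta> + z"
        by (simp add: algebra_simps cis_cnj cis_mult)
      also have "cis \<theta> * (1 - ?w) = cis \<theta> - z"
        by (simp add: algebra_simps cis_cnj cis_mult)
      finally show ?thesis by (simp add: K_def)
    qed
    ultimately show ?thesis by simp
  qed
  have hs: "(\<lambda>n. (k n * c n) * z ^ n) sums h z" if z: "z \<in> ball 0 1" for z
  proof -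
    have lim: "(\<lambda>N. \<integral>\<theta>. of_real (M \<theta>) * (\<Sum>n<N. k n * (z * cnj (cis \<theta>)) ^ n) \<partial>circ) \<longlonglongrightarrow> h z"
      unfolding h_def
    proof (rule integral_dominated_convergence[where w = "\<lambda>\<theta>. M \<theta> * (2 * (1 / (1 - cmod z)))"])
      show "AE \<theta> in circ. (\<lambda>N. of_real (M \<theta>) * (\<Sum>n<N. k n * (z * cnj (cis \<theta>)) ^ n)) \<longlonglongrightarrow> of_real (M \<theta>) * K z \<theta>"
        using K_sums[OF z] by (intro AE_I2 tendsto_intros) (simp add: sums_def)
      show "AE \<theta> in circ. norm (of_real (M \<theta>) * (\<Sum>n<N. k n * (z * cnj (cis \<theta>)) ^ n)) \<le> M \<theta> * (2 * (1 / (1 - cmod z)))" for N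
      proof (rule AE_I2)
        fix \<theta>
        have g: "(\<lambda>n. cmod z ^ n) sums (1 / (1 - cmod z))" using z by (intro geometric_sums) simp
        have "norm (\<Sum>n<N. k n * (z * cnj (cis \<theta>)) ^ n) \<le> (\<Sum>n<N. 2 * cmod z ^ n)"
          by (rule sum_norm_le) (auto simp: norm_mult norm_power k_def)
        also have "\<dots> = 2 * (\<Sum>n<N. cmod z ^ n)" by (simp add: sum_distrib_left)
        also have "(\<Sum>n<N. cmod z ^ n) \<le> (\<Sum>n. cmod z ^ n)"
          using g by (intro sum_le_suminf) (auto simp: sums_iff)
        also have "\<dots> = 1 / (1 - cmod z)" using g by (simp add: sums_iff)
        finally have "norm (\<Sum>n<N. k n * (z * cnj (cis \<theta>)) ^ n) \<le> 2 * (1 / (1 - cmod z))" by simp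
        then show "norm (of_real (M \<theta>) * (\<Sum>n<N. k n * (z * cnj (cis \<theta>)) ^ n)) \<le> M \<theta> * (2 * (1 / (1 - cmod z)))"
          unfolding norm_mult using M(1)[of \<theta>] by (simp only: norm_of_real abs_of_nonneg) (rule mult_left_mono)
      qed
      show "integrable circ (\<lambda>\<theta>. M \<theta> * (2 * (1 / (1 - cmod z))))" using Mi by simp
      have "(\<lambda>\<theta>. K z \<theta>) \<in> borel_measurable borel" unfolding K_def by measurable
      then show "(\<lambda>\<theta>. of_real (M \<theta>) * K z \<theta>) \<in> borel_measurable circ" by measurable
      show "(\<lambda>\<theta>. of_real (M \<theta>) * (\<Sum>n<N. k n * (z * cnj (cis \<theta>)) ^ n)) \<in> borel_measurable circ" for N by measurable
    qed
    have ic: "integrable circ (\<lambda>\<theta>. of_real (M \<theta>) * cnj (cis \<theta> ^ n))" for n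
      by (rule Bochner_Integration.integrable_bound[OF Mi]) (use M(1) in \<open>auto simp: norm_mult norm_power\<close>)
    have "(\<integral>\<theta>. of_real (M \<theta>) * (\<Sum>n<N. k n * (z * cnj (cis \<theta>)) ^ n) \<partial>circ) = (\<Sum>n<N. (k n * c n) * z ^ n)" for N
    proof -
      have "(\<integral>\<theta>. of_real (M \<theta>) * (\<Sum>n<N. k n * (z * cnj (cis \<theta>)) ^ n) \<partial>circ) 
         = (\<integral>\<theta>. (\<Sum>n<N. (k n * z ^ n) * (of_real (M \<theta>) * cnj (cis \<theta> ^ n))) \<partial>circ)"
        by (simp add: sum_distrib_left power_mult_distrib mult_ac)
      also have "\<dots> = (\<Sum>n<N. (k n * z ^ n) * c n)"
        using ic by (subst Bochner_Integration.integral_sum) (auto simp: c_def)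
      finally show ?thesis by (simp add: mult_ac)
    qed
    with lim show ?thesis by (simp add: sums_def)
  qed
  have "(\<Sum>n<N. (cmod (c n))\<^sup>2) \<le> (\<integral>\<theta>. (M \<theta>)\<^sup>2 \<partial>circ)" for N
  proof -
    have "(\<Sum>n<N. (cmod (c n))\<^sup>2) \<le> (\<integral>\<theta>. (cmod (of_real (M \<theta>)))\<^sup>2 \<partial>circ)"
      unfolding c_def by (rule bessel_inequality[where e = "\<lambda>n \<theta>. cis \<theta> ^ n"])
        (use M integral_cis_mult in \<open>auto simp: norm_power\<close>)
    then show ?thesis by simp
  qed
  then have cs: "summable (\<lambda>n. (cmod (c n))\<^sup>2)"
    by (intro bounded_imp_summable[where B = "\<integral>\<theta>. (M \<theta>)\<^sup>2 \<partial>circ"]) (auto simp only: lessThan_Suc_atMost[symmetric] zero_le_power2)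
  have "summable (\<lambda>n. (cmod (k n * c n))\<^sup>2)"
  proof (rule summable_comparison_test)
    show "summable (\<lambda>n. 4 * (cmod (c n))\<^sup>2)" using cs by (rule summable_mult)
    show "\<exists>N. \<forall>n\<ge>N. norm ((cmod (k n * c n))\<^sup>2) \<le> 4 * (cmod (c n))\<^sup>2"
      by (auto simp: k_def norm_mult power_mult_distrib)
  qed
  from hardy_disk_seriesI[OF hs this] have hh: "h \<in> hardy_disk" .
  have "cmod (f z) \<le> Re (h z)" if z: "z \<in> ball 0 1" for z
  proof -
    have zz: "cmod z < 1" using z by simp
    have pb: "\<bar>poisson z \<theta>\<bar> \<le> 1 / (1 - cmod z)\<^sup>2" for \<theta>
      using poisson_le[OF order_refl zz] poisson_nonneg[OF zz] by simp
    have iMP: "integrable circ (\<lambda>\<theta>. poisson z \<theta> * M \<theta>)"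
    proof (rule Bochner_Integration.integrable_bound)
      show "integrable circ (\<lambda>\<theta>. 1 / (1 - cmod z)\<^sup>2 * M \<theta>)" using Mi by simp
      show "AE \<theta> in circ. norm (poisson z \<theta> * M \<theta>) \<le> norm (1 / (1 - cmod z)\<^sup>2 * M \<theta>)"
      proof (rule AE_I2)
        fix \<theta>
        have "\<bar>poisson z \<theta>\<bar> * \<bar>M \<theta>\<bar> \<le> 1 / (1 - cmod z)\<^sup>2 * \<bar>M \<theta>\<bar>"
          by (intro mult_right_mono pb) simp
        then show "norm (poisson z \<theta> * M \<theta>) \<le> norm (1 / (1 - cmod z)\<^sup>2 * M \<theta>)"
          by (simp add: abs_mult)
      qed
    qed simp
    have ReK: "Re (K z \<theta>) = poisson z \<theta>" for \<theta>
    proof -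
      have "K z \<theta> = (cis \<theta> + z) * cnj (cis \<theta> - z) / of_real ((cmod (cis \<theta> - z))\<^sup>2)"
        unfolding K_def complex_div_cnj[of "cis \<theta> + z"] by simp
      then have "Re (K z \<theta>) = Re ((cis \<theta> + z) * cnj (cis \<theta> - z)) / (cmod (cis \<theta> - z))\<^sup>2"
        by (simp only: Re_divide_of_real)
      also have "Re ((cis \<theta> + z) * cnj (cis \<theta> - z)) = 1 - (cmod z)\<^sup>2"
        using sin_cos_squared_add3[of \<theta>] by (simp add: cmod_def algebra_simps power2_eq_square)
      finally show ?thesis by (simp add: poisson_def)
    qed
    have Kb: "cmod (K z \<theta>) \<le> 2 / (1 - cmod z)" for \<theta>
    proof -
      have "1 - cmod z \<le> cmod (cis \<theta> - z)" using norm_triangle_ineq2[of "cis \<theta>" z] by simp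
      moreover have "cmod (cis \<theta> + z) \<le> 2" using norm_triangle_ineq[of "cis \<theta>" z] zz by simp
      ultimately show ?thesis unfolding K_def norm_divide using zz by (intro frac_le) auto
    qed
    have "(\<lambda>\<theta>. K z \<theta>) \<in> borel_measurable borel" unfolding K_def by measurable
    then have KM: "(\<lambda>\<theta>. of_real (M \<theta>) * K z \<theta>) \<in> borel_measurable circ" by measurable
    have iK: "integrable circ (\<lambda>\<theta>. of_real (M \<theta>) * K z \<theta>)"
    proof (rule Bochner_Integration.integrable_bound[where f = "\<lambda>\<theta>. M \<theta> * (2 / (1 - cmod z))"])
      show "integrable circ (\<lambda>\<theta>. M \<theta> * (2 / (1 - cmod z)))" using Mi by simp
      show "AE \<theta> in circ. norm (of_real (M \<theta>) * K z \<theta>) \<le> norm (M \<theta> * (2 / (1 - cmod z)))"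
      proof (rule AE_I2)
        fix \<theta>
        have "\<bar>M \<theta>\<bar> * cmod (K z \<theta>) \<le> \<bar>M \<theta>\<bar> * (2 / (1 - cmod z))"
          by (intro mult_left_mono Kb) simp
        then show "norm (of_real (M \<theta>) * K z \<theta>) \<le> norm (M \<theta> * (2 / (1 - cmod z)))"
          using zz by (simp add: norm_mult)
      qed
    qed (rule KM)
    have Reh: "Re (h z) = (\<integral>\<theta>. poisson z \<theta> * M \<theta> \<partial>circ)"
      unfolding h_def using integral_Re[OF iK] by (simp add: ReK mult.commute)
    have fz: "cmod (f (of_real (rad n) * z)) \<le> Re (h z)" for n
    proof -
      note hol = holomorphic_on_dilate[OF hardy_disk_holomorphic[OF f] rad[of n]]
      have "cmod (f (of_real (rad n) * z)) = cmod (\<integral>\<theta>. poisson z \<theta> *\<^sub>R f (of_real (rad n) * cis \<theta>) \<partial>circ)"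
        using poisson_circ[OF hol zz] by simp
      also have "\<dots> \<le> (\<integral>\<theta>. poisson z \<theta> * cmod (f (of_real (rad n) * cis \<theta>)) \<partial>circ)"
        by (rule order_trans[OF integral_norm_bound]) (simp add: poisson_nonneg[OF zz])
      also have "\<dots> \<le> (\<integral>\<theta>. poisson z \<theta> * M \<theta> \<partial>circ)"
      proof (rule integral_mono_AE')
        show "integrable circ (\<lambda>\<theta>. poisson z \<theta> * M \<theta>)" by (rule iMP)
        show "AE \<theta> in circ. poisson z \<theta> * cmod (f (of_real (rad n) * cis \<theta>)) \<le> poisson z \<theta> * M \<theta>"
          using MA by eventually_elim (auto intro!: mult_left_mono poisson_nonneg[OF zz] rad)
        show "AE \<theta> in circ. 0 \<le> poisson z \<theta> * M \<theta>"
          by (intro AE_I2 mult_nonneg_nonneg poisson_nonneg[OF zz] M)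
      qed
      finally show ?thesis by (simp add: Reh)
    qed
    have "rad \<longlonglongrightarrow> 1" using filterlim_rad by (simp add: filterlim_at)
    then have "(\<lambda>n. of_real (rad n) * z) \<longlonglongrightarrow> of_real 1 * z" by (intro tendsto_intros)
    moreover have "isCont f (of_real 1 * z)"
      using holomorphic_on_imp_continuous_on[OF hardy_disk_holomorphic[OF f]] z
      by (auto simp: continuous_on_eq_continuous_at)
    ultimately have "(\<lambda>n. f (of_real (rad n) * z)) \<longlonglongrightarrow> f (of_real 1 * z)"
      by (metis isCont_tendsto_compose)
    then have "(\<lambda>n. cmod (f (of_real (rad n) * z))) \<longlonglongrightarrow> cmod (f z)" by (intro tendsto_norm) simp
    then show ?thesis by (rule LIMSEQ_le_const2) (use fz in auto)
  qed
  with hh show thesis by (rule that)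
qed

text \<open>A set of outer functions that is closed under addition. The sum of two arbitrary outer functions need
  not be outer, whereas here it provides the link between the values of the functional on both summands.\<close>

definition positive_hardy :: "(complex \<Rightarrow> complex) set" where
  "positive_hardy = {s \<in> hardy_disk. \<forall>z\<in>ball 0 1. 1 \<le> Re (s z)}"

text \<open>With a majorant \<open>h\<close> of \<open>f\<close>, take \<open>1 + h + f\<close> and \<open>1 + h - f\<close>.\<close>

lemma positive_hardy_span:
  assumes "f \<in> hardy_disk"
  obtains s t where "s \<in> positive_hardy" "t \<in> positive_hardy" "\<And>z. f z = 1 / 2 * s z + (- 1 / 2) * t z"
proof -
  obtain h where h: "h \<in> hardy_disk" "\<And>z. z \<in> ball 0 1 \<Longrightarrow> cmod (f z) \<le> Re (h z)"
    using hardy_majorant[OF assms] by blast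
  have re: "0 \<le> Re (h z) + Re (f z)" "0 \<le> Re (h z) + Re (- 1 * f z)" if "cmod z < 1" for z
    using h(2)[of z] that abs_Re_le_cmod[of "f z"] by auto
  show thesis
  proof (rule that)
    show "(\<lambda>z. 1 + (h z + f z)) \<in> positive_hardy"
      unfolding positive_hardy_def
      using re by (auto intro!: hardy_disk_add hardy_disk_const assms h(1))
    show "(\<lambda>z. 1 + (h z + (- 1) * f z)) \<in> positive_hardy"
      unfolding positive_hardy_def
      using re hardy_disk_add[OF hardy_disk_const[of 1] hardy_disk_add[OF h(1) hardy_disk_cmult[OF assms, of "- 1"]]]
      by auto
    show "f z = 1 / 2 * (1 + (h z + f z)) + (- 1 / 2) * (1 + (h z + (- 1) * f z))" for z
      by (simp add: field_simps)
  qed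
qed

section \<open>Functionals that do not vanish on outer functions\<close>

lemma prod_linear_coeffs:
  fixes ls :: "complex list"
  defines "p \<equiv> \<Prod>l\<leftarrow>ls. [:1, - l:]"
  shows "coeff p 0 = 1" "coeff p 1 = - sum_list ls"
    "2 * coeff p 2 = (sum_list ls)\<^sup>2 - (\<Sum>l\<leftarrow>ls. l\<^sup>2)"
proof -
  have "coeff (\<Prod>l\<leftarrow>ls. [:1, - l:]) 0 = 1 \<and> coeff (\<Prod>l\<leftarrow>ls. [:1, - l:]) 1 = - sum_list ls \<and>
     2 * coeff (\<Prod>l\<leftarrow>ls. [:1, - l:]) 2 = (sum_list ls)\<^sup>2 - (\<Sum>l\<leftarrow>ls. l\<^sup>2)"
  proof (induction ls)
    case (Cons l ls)
    then show ?case
      by (auto simp: coeff_pCons numeral_2_eq_2 algebra_simps power2_eq_square split: nat.splits)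
  qed (auto simp: numeral_2_eq_2)
  then show "coeff p 0 = 1" "coeff p 1 = - sum_list ls"
    "2 * coeff p 2 = (sum_list ls)\<^sup>2 - (\<Sum>l\<leftarrow>ls. l\<^sup>2)" by (auto simp: p_def)
qed

text \<open>The elementary argument for the Gleason-Kahane-Zelazko theorem. The polynomial of degree \<open>n\<close> in \<open>l\<close>
  has no root in the closed unit disk, so the inverses of its roots lie in the disk and the sum of their
  squares is at most \<open>n\<close> in modulus. By the first three coefficients this sum is also
  \<open>(n a\<^sub>1 / a\<^sub>0)\<^sup>2 - n (n - 1) a\<^sub>2 / a\<^sub>0\<close>, whose two terms are of order \<open>n\<^sup>2\<close>.\<close>

lemma moment_identity:
  fixes a :: "nat \<Rightarrow> complex"
  assumes nz: "\<And>n l. cmod l \<le> 1 \<Longrightarrow> (\<Sum>j\<le>n. of_nat (n choose j) * (- l) ^ j * a j) \<noteq> 0"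
  shows "(a 1)\<^sup>2 = a 0 * a 2"
proof -
  have a0: "a 0 \<noteq> 0" using nz[of 0 0] by simp
  have bound: "cmod ((a 1)\<^sup>2 - (1 - 1 / of_nat n) * (a 0 * a 2)) \<le> (cmod (a 0))\<^sup>2 * (1 / real n)" if n: "n \<ge> 1" for n
  proof -
    define q where "q = (\<Sum>j\<le>n. monom (of_nat (n choose j) * (- 1) ^ j * a j) j)"
    have qp: "poly q l = (\<Sum>j\<le>n. of_nat (n choose j) * (- l) ^ j * a j)" for l
    proof -
      have "(- l) ^ j = (- 1) ^ j * l ^ j" for j using power_mult_distrib[of "-1" l j] by simp
      then show ?thesis by (simp add: q_def poly_sum poly_monom mult_ac)
    qed
    have qc: "coeff q j = of_nat (n choose j) * (- 1) ^ j * a j" for j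
      by (auto simp: q_def coeff_sum if_distrib binomial_eq_0 not_le cong: if_cong)
    have deg: "degree q \<le> n"
      by (rule degree_le) (auto simp: qc binomial_eq_0)
    have q0: "poly q 0 = a 0" by (simp add: poly_0_coeff_0 qc)
    obtain ls where ls: "length ls = degree q" "\<And>l. l \<in> set ls \<Longrightarrow> l \<noteq> 0 \<and> poly q (1 / l) = 0"
      "q = smult (a 0) (\<Prod>l\<leftarrow>ls. [:1, - l:])"
      using poly_factor_list[of q] a0 q0 by auto
    have l1: "cmod l \<le> 1" if "l \<in> set ls" for l
    proof (rule ccontr)
      assume "\<not> cmod l \<le> 1"
      then have "cmod (1 / l) \<le> 1" by (simp add: norm_divide divide_le_eq_1)
      then show False using nz[of "1 / l" n] ls(2)[OF that] by (simp add: qp)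
    qed
    define A where "A = sum_list ls"
    define Q where "Q = (\<Sum>l\<leftarrow>ls. l\<^sup>2)"
    have "cmod Q \<le> (\<Sum>l\<leftarrow>ls. cmod (l\<^sup>2))" unfolding Q_def by (induction ls) (auto intro: order_trans[OF norm_triangle_ineq])
    also have "\<dots> \<le> (\<Sum>l\<leftarrow>ls. 1)" using l1 by (intro sum_list_mono) (auto simp: norm_power power_le_one)
    also have "\<dots> \<le> n" using ls(1) deg by (simp add: sum_list_triv)
    finally have Q: "cmod Q \<le> n" .
    have e1: "of_nat n * a 1 = a 0 * A"
      using qc[of 1] prod_linear_coeffs(2)[of ls] by (subst (asm) ls(3)) (simp add: A_def)
    have e2: "of_nat n * (of_nat n - 1) * a 2 = a 0 * (A\<^sup>2 - Q)"
    proof -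
      have ch: "2 * complex_of_nat (n choose 2) = of_nat n * (of_nat n - 1)"
      proof -
        have "even (n * (n - 1))" by (cases n) auto
        then have "2 * (n choose 2) = n * (n - 1)" unfolding choose_two by (rule dvd_mult_div_cancel)
        then have "of_nat (2 * (n choose 2)) = complex_of_nat (n * (n - 1))" by (simp only:)
        then show ?thesis using n by (simp add: of_nat_diff)
      qed
      have "coeff q 2 = a 0 * coeff (\<Prod>l\<leftarrow>ls. [:1, - l:]) 2" by (subst ls(3)) simp
      then have "2 * (of_nat (n choose 2) * a 2) = a 0 * (2 * coeff (\<Prod>l\<leftarrow>ls. [:1, - l:]) 2)"
        using qc[of 2] by simp
      then show ?thesis unfolding prod_linear_coeffs(3) A_def Q_def using ch by (metis mult.assoc)
    qed
    have "of_nat n * of_nat n * ((a 1)\<^sup>2 - (1 - 1 / of_nat n) * (a 0 * a 2))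
        = (of_nat n * a 1)\<^sup>2 - a 0 * (of_nat n * (of_nat n - 1) * a 2)"
      using n by (simp add: field_simps power2_eq_square)
    also have "\<dots> = (a 0)\<^sup>2 * Q" unfolding e1 e2 by (simp add: algebra_simps power2_eq_square)
    finally have "(a 1)\<^sup>2 - (1 - 1 / of_nat n) * (a 0 * a 2) = (a 0)\<^sup>2 * Q / (of_nat n * of_nat n)"
      using n by (simp add: field_simps)
    then have "cmod ((a 1)\<^sup>2 - (1 - 1 / of_nat n) * (a 0 * a 2)) = (cmod (a 0))\<^sup>2 * cmod Q / (real n * real n)"
      by (simp add: norm_divide norm_mult norm_power)
    also have "\<dots> \<le> (cmod (a 0))\<^sup>2 * real n / (real n * real n)"
      using Q by (intro divide_right_mono mult_left_mono) auto
    also have "\<dots> = (cmod (a 0))\<^sup>2 * (1 / real n)" using n by simp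
    finally show ?thesis .
  qed
  have "(\<lambda>n. cmod ((a 1)\<^sup>2 - (1 - 1 / of_nat n) * (a 0 * a 2))) \<longlonglongrightarrow> cmod ((a 1)\<^sup>2 - (1 - 0) * (a 0 * a 2))"
    by (intro tendsto_intros lim_const_over_n)
  moreover have "(\<lambda>n. (cmod (a 0))\<^sup>2 * (1 / real n)) \<longlonglongrightarrow> (cmod (a 0))\<^sup>2 * 0"
    by (intro tendsto_intros lim_const_over_n)
  ultimately have "cmod ((a 1)\<^sup>2 - (1 - 0) * (a 0 * a 2)) \<le> (cmod (a 0))\<^sup>2 * 0"
    using bound by (intro LIMSEQ_le) auto
  then show ?thesis by simp
qed

text \<open>Let \<open>a s j\<close> be the value of the functional at \<open>z\<^sup>j s\<close>. For \<open>s\<close> in \<^const>\<open>positive_hardy\<close> the functions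
  \<open>(1 - l z)\<^sup>n s\<close> are outer, so \<open>moment_identity\<close> gives \<open>(a s 1)\<^sup>2 = a s 0 * a s 2\<close>. Comparing \<open>s\<close>, the
  constant 1, and their sum shows that the quotient \<open>w = a s 1 / a s 0\<close> is the same for all \<open>s\<close>. As these \<open>s\<close>
  span the Hardy space, multiplication by \<open>z\<close> acts on the functional as multiplication by \<open>w\<close>. If \<open>w\<close>
  were outside the disk, \<open>z - w\<close> would be an outer function on which the functional vanishes; and for \<open>w\<close>
  in the disk \<open>f - f w\<close> is divisible by \<open>z - w\<close>.\<close>

theorem outer_functional:
  fixes \<Lambda> :: "(complex \<Rightarrow> complex) \<Rightarrow> complex"
  assumes cong: "\<And>f g. f \<in> hardy_disk \<Longrightarrow> (\<And>z. z \<in> ball 0 1 \<Longrightarrow> f z = g z) \<Longrightarrow> \<Lambda> f = \<Lambda> g"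
    and add: "\<And>f g. f \<in> hardy_disk \<Longrightarrow> g \<in> hardy_disk \<Longrightarrow> \<Lambda> (\<lambda>z. f z + g z) = \<Lambda> f + \<Lambda> g"
    and scale: "\<And>f c. f \<in> hardy_disk \<Longrightarrow> \<Lambda> (\<lambda>z. c * f z) = c * \<Lambda> f"
    and nz: "\<And>f. outer_disk f \<Longrightarrow> \<Lambda> f \<noteq> 0"
  obtains w where "w \<in> ball 0 1" "\<And>f. f \<in> hardy_disk \<Longrightarrow> \<Lambda> f = \<Lambda> (\<lambda>_. 1) * f w" "\<Lambda> (\<lambda>_. 1) \<noteq> 0"
proof -
  have zh: "(\<lambda>z. z ^ j * f z) \<in> hardy_disk" if "f \<in> hardy_disk" for f j
    by (rule hardy_disk_mult_bounded[OF that, where K = 1]) (auto intro!: holomorphic_intros simp: norm_power power_le_one)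
  have lsum: "(\<lambda>z. \<Sum>j\<le>n. c j * F j z) \<in> hardy_disk \<and> \<Lambda> (\<lambda>z. \<Sum>j\<le>n. c j * F j z) = (\<Sum>j\<le>n. c j * \<Lambda> (F j))"
    if "\<And>j. F j \<in> hardy_disk" for c F and n :: nat
    by (induction n) (auto simp: scale that hardy_disk_cmult hardy_disk_add add)
  have pos: "s \<in> hardy_disk" "\<And>z. z \<in> ball 0 1 \<Longrightarrow> 1 \<le> Re (s z)" if "s \<in> positive_hardy" for s
    using that by (auto simp: positive_hardy_def)
  define a where "a = (\<lambda>s (j::nat). \<Lambda> (\<lambda>z. z ^ j * s z))"
  have expand: "\<Lambda> (\<lambda>z. (1 - l * z) ^ n * s z) = (\<Sum>j\<le>n. of_nat (n choose j) * (- l) ^ j * a s j)" if s: "s \<in> hardy_disk" for s l n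
  proof -
    have "(1 - l * z) ^ n * s z = (\<Sum>j\<le>n. (of_nat (n choose j) * (- l) ^ j) * (z ^ j * s z))" for z
    proof -
      have "(1 - l * z) ^ n = ((- l * z) + 1) ^ n" by simp
      also have "\<dots> = (\<Sum>j\<le>n. of_nat (n choose j) * (- l * z) ^ j * 1 ^ (n - j))" by (rule binomial_ring)
      also have "\<dots> = (\<Sum>j\<le>n. of_nat (n choose j) * (- l) ^ j * z ^ j)"
        unfolding power_mult_distrib by (simp add: mult.assoc)
      finally show ?thesis by (simp add: sum_distrib_right mult.assoc)
    qed
    then have "\<Lambda> (\<lambda>z. (1 - l * z) ^ n * s z) = \<Lambda> (\<lambda>z. \<Sum>j\<le>n. (of_nat (n choose j) * (- l) ^ j) * (z ^ j * s z))" by simp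
    also have "\<dots> = (\<Sum>j\<le>n. (of_nat (n choose j) * (- l) ^ j) * a s j)"
      unfolding a_def by (rule conjunct2[OF lsum[of "\<lambda>j z. z ^ j * s z"]]) (rule zh[OF s])
    finally show ?thesis .
  qed
  have square: "(a s 1)\<^sup>2 = a s 0 * a s 2" and a0: "a s 0 \<noteq> 0" if s: "s \<in> positive_hardy" for s
  proof -
    have n: "(\<Sum>j\<le>n. of_nat (n choose j) * (- l) ^ j * a s j) \<noteq> 0" if "cmod l \<le> 1" for l n
      unfolding expand[OF pos(1)[OF s], symmetric] by (intro nz outer_disk_power_mult pos s that)
    then show "(a s 1)\<^sup>2 = a s 0 * a s 2" by (rule moment_identity)
    show "a s 0 \<noteq> 0" using n[of 0 0] by simp
  qed
  have a_add: "a (\<lambda>z. s z + t z) j = a s j + a t j" if "s \<in> hardy_disk" "t \<in> hardy_disk" for s t j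
    unfolding a_def distrib_left by (intro add zh that)
  have a_cmult: "a (\<lambda>z. c * s z) j = c * a s j" if "s \<in> hardy_disk" for s j c
    unfolding a_def mult.left_commute[of _ c] by (intro scale zh that)
  define one where "one = (\<lambda>z::complex. 1::complex)"
  have one: "one \<in> positive_hardy" by (auto simp: positive_hardy_def one_def intro!: hardy_disk_const)
  define w where "w = a one 1 / a one 0"
  have ws: "a s 1 = w * a s 0" if s: "s \<in> positive_hardy" for s
  proof -
    define v where "v = a s 1 / a s 0"
    have v: "a s 1 = v * a s 0" "a s 2 = v\<^sup>2 * a s 0" and w1: "a one 1 = w * a one 0" "a one 2 = w\<^sup>2 * a one 0"
      using square[OF s] a0[OF s] square[OF one] a0[OF one] 
      by (auto simp: v_def w_def field_simps power2_eq_square)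
    have "(\<lambda>z. s z + one z) \<in> positive_hardy"
      using pos[OF s] by (auto simp: positive_hardy_def one_def intro!: hardy_disk_add hardy_disk_const)
        (smt (verit))
    from square[OF this] have "(v * a s 0 + w * a one 0)\<^sup>2 = (a s 0 + a one 0) * (v\<^sup>2 * a s 0 + w\<^sup>2 * a one 0)"
      by (simp only: a_add[OF pos(1)[OF s] pos(1)[OF one]] v w1)
    then have "a s 0 * a one 0 * (v - w)\<^sup>2 = 0" by (simp add: algebra_simps power2_eq_square)
    then have "v = w" using a0[OF s] a0[OF one] by simp
    then show ?thesis using v by simp
  qed
  have wf: "\<Lambda> (\<lambda>z. z * f z) = w * \<Lambda> f" if f: "f \<in> hardy_disk" for f
  proof -
    obtain s t where st: "s \<in> positive_hardy" "t \<in> positive_hardy" and eq: "\<And>z. f z = 1 / 2 * s z + (- 1 / 2) * t z"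
      using positive_hardy_span[OF f] by blast
    have feq: "f = (\<lambda>z. 1 / 2 * s z + (- 1 / 2) * t z)" using eq by auto
    have "a f j = 1 / 2 * a s j + (- 1 / 2) * a t j" for j
      unfolding feq a_add[OF hardy_disk_cmult[OF pos(1)[OF st(1)]] hardy_disk_cmult[OF pos(1)[OF st(2)]]]
        a_cmult[OF pos(1)[OF st(1)]] a_cmult[OF pos(1)[OF st(2)]] ..
    note af = this
    have "a f 1 = w * a f 0" unfolding af ws[OF st(1)] ws[OF st(2)] by (simp add: algebra_simps)
    then show ?thesis by (simp add: a_def)
  qed
  have c: "\<Lambda> one \<noteq> 0" using a0[OF one] by (simp add: a_def)
  have zk: "\<Lambda> (\<lambda>z. (z - b) * k z) = (w - b) * \<Lambda> k" if k: "k \<in> hardy_disk" for k b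
  proof -
    have zk: "(\<lambda>z. z * k z) \<in> hardy_disk" using zh[OF k, of 1] by simp
    have "\<Lambda> (\<lambda>z. (z - b) * k z) = \<Lambda> (\<lambda>z. z * k z + (- b) * k z)" by (simp add: algebra_simps)
    also have "\<dots> = \<Lambda> (\<lambda>z. z * k z) + (- b) * \<Lambda> k"
      unfolding add[OF zk hardy_disk_cmult[OF k, of "- b"]] scale[OF k] ..
    finally show ?thesis by (simp add: wf[OF k] algebra_simps)
  qed
  have w: "w \<in> ball 0 1"
  proof (rule ccontr)
    assume "w \<notin> ball 0 1"
    then have "cmod w \<ge> 1" "w \<noteq> 0" by auto
    then have "outer_disk (\<lambda>z. (1 - 1 / w * z) ^ 1 * one z)"
      by (intro outer_disk_power_mult pos one) (auto simp: norm_divide)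
    then have "\<Lambda> (\<lambda>z. (1 - 1 / w * z) ^ 1 * one z) \<noteq> 0" by (rule nz)
    moreover have "(\<lambda>z. (1 - 1 / w * z) ^ 1 * one z) = (\<lambda>z. (z - w) * (- 1 / w * one z))"
      using \<open>w \<noteq> 0\<close> by (auto simp: field_simps)
    ultimately show False
      using zk[OF hardy_disk_cmult[OF pos(1)[OF one], of "- 1 / w"], of w] by (simp only:) simp
  qed
  have "\<Lambda> f = \<Lambda> one * f w" if f: "f \<in> hardy_disk" for f
  proof -
    define g where "g = (\<lambda>z. f z + (- f w) * one z)"
    have g: "g \<in> hardy_disk" unfolding g_def by (intro hardy_disk_add hardy_disk_cmult f pos one)
    have "g w = 0" by (simp add: g_def one_def)
    then obtain k where k: "k \<in> hardy_disk" "\<And>z. z \<in> ball 0 1 \<Longrightarrow> g z = (z - w) * k z"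
      using hardy_disk_divide[OF g w] by blast
    have "\<Lambda> g = \<Lambda> (\<lambda>z. (z - w) * k z)" by (rule cong[OF g k(2)])
    also have "\<dots> = 0" using zk[OF k(1), of w] by simp
    finally have "\<Lambda> f + (- f w) * \<Lambda> one = 0"
      unfolding g_def using add[OF f hardy_disk_cmult[OF pos(1)[OF one], of "- f w"]] scale[OF pos(1)[OF one], of "- f w"] by simp
    then show ?thesis by (simp add: algebra_simps)
  qed
  then show thesis using w c that unfolding one_def by blast
qed

section \<open>Laplace transforms of square-integrable functions\<close>

text \<open>Representatives of the elements of \<^typ>\<open>L2\<close> that vanish to the left of the origin, so that all integrals
  can be taken over the whole line.\<close>

definition l2_half :: "(real \<Rightarrow> complex) \<Rightarrow> bool" where
  "l2_half f \<longleftrightarrow> f \<in> borel_measurable borel \<and> (\<forall>t<0. f t = 0) \<and> integrable lborel (\<lambda>t. (cmod (f t))\<^sup>2)"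

lemma l2_halfD:
  assumes "l2_half f"
  shows l2_half_measurable: "f \<in> borel_measurable borel"
    and "t < 0 \<Longrightarrow> f t = 0" and "integrable lborel (\<lambda>t. (cmod (f t))\<^sup>2)"
  using assms by (auto simp: l2_half_def)

lemma l2_half_indicator: "l2_half f \<Longrightarrow> indicator {0..} t *\<^sub>R f t = f t"
  by (cases "t < 0") (auto simp: l2_half_def)

lemma L2_rel_l2_half:
  assumes f: "l2_half f" and g: "l2_half g"
  shows "L2_rel f g \<longleftrightarrow> (AE t in lborel. f t = g t)"
proof -
  have sq: "square_integrable f" if f: "l2_half f" for f
  proof -
    have "(\<lambda>t. indicat_real {0..} t *\<^sub>R (cmod (f t))\<^sup>2) = (\<lambda>t. (cmod (f t))\<^sup>2)"
    proof
      fix t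
      show "indicat_real {0..} t *\<^sub>R (cmod (f t))\<^sup>2 = (cmod (f t))\<^sup>2"
        using l2_halfD(2)[OF f, of t] by (cases "t < 0") auto
    qed
    then show ?thesis
      using f by (auto simp: square_integrable_def l2_half_def integrable_restrict_space intro!: measurable_restrict_space1)
  qed
  have "(AE t in halfline. f t = g t) \<longleftrightarrow> (AE t in lborel. f t = g t)"
    using l2_halfD(2)[OF f] l2_halfD(2)[OF g] by (subst AE_restrict_space_iff) (auto intro!: AE_cong simp: not_le[symmetric])
  then show ?thesis using sq f g by (simp add: L2_rel_def)
qed

lemma L2_cases:
  obtains f where "l2_half f" "u = abs_L2 f"
proof (induction u rule: L2.abs_induct)
  case (1 y)
  define f where "f = (\<lambda>t. indicator {0..} t *\<^sub>R y t)"
  have y: "y \<in> borel_measurable halfline" "integrable halfline (\<lambda>t. (cmod (y t))\<^sup>2)"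
    using 1(1) by (auto simp: L2_rel_def square_integrable_def)
  have "f \<in> borel_measurable borel"
    using y(1) unfolding f_def by (subst (asm) borel_measurable_restrict_space_iff) auto
  moreover have "integrable lborel (\<lambda>t. (cmod (f t))\<^sup>2)"
  proof -
    have "(\<lambda>t. (cmod (f t))\<^sup>2) = (\<lambda>t. indicator {0..} t *\<^sub>R (cmod (y t))\<^sup>2)"
      by (auto simp: f_def indicator_def)
    then show ?thesis using y(2) by (simp add: integrable_restrict_space)
  qed
  ultimately have f: "l2_half f" by (auto simp: l2_half_def f_def)
  have "L2_rel y f"
    using 1(1) L2_rel_l2_half[OF f f] unfolding L2_rel_def
    by (auto simp: AE_restrict_space_iff f_def)
  then have "abs_L2 y = abs_L2 f" by (rule Quotient3_rel_abs[OF Quotient3_L2])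
  then show ?case using 1(2) f by blast
qed

lemma abs_L2_eq_iff:
  assumes "l2_half f" "l2_half g"
  shows "abs_L2 f = abs_L2 g \<longleftrightarrow> (AE t in lborel. f t = g t)"
  using Quotient3_rel[OF Quotient3_L2, of f g] L2_rel_l2_half assms by auto

definition laplace :: "(real \<Rightarrow> complex) \<Rightarrow> complex \<Rightarrow> complex" where
  "laplace f z = (\<integral>t. f t * exp (- z * of_real t) \<partial>lborel)"

lemma fourier_laplace_abs:
  assumes f: "l2_half f"
  shows "fourier_laplace (abs_L2 f) z = 1 / of_real (sqrt (2 * pi)) * laplace f z"
proof -
  have "L2_rel f f" using L2_rel_l2_half[OF f f] by simp
  then have "fourier_laplace (abs_L2 f) z = 1 / of_real (sqrt (2 * pi)) * (\<integral>t. f t * exp (- z * of_real t) \<partial>halfline)"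
    by (simp add: fourier_laplace.abs_eq)
  also have "(\<integral>t. f t * exp (- z * of_real t) \<partial>halfline) = laplace f z"
    unfolding laplace_def by (subst integral_restrict_space) (auto simp: l2_half_indicator[OF f] simp flip: scaleR_scaleR mult_scaleR_left)
  finally show ?thesis .
qed

text \<open>This is the normalisation of the Erlang density.\<close>

lemma gamma_moment:
  fixes x :: real
  assumes x: "0 < x"
  shows "has_bochner_integral lborel (\<lambda>t. indicator {0..} t * (t ^ k * exp (- x * t))) (fact k / x ^ Suc k)"
proof -
  interpret prob_space "density lborel (erlang_density k x)"
    by (rule prob_space_erlang_density[OF x])
  have "(\<integral>\<^sup>+t. ennreal (erlang_density k x t) \<partial>lborel) = 1"
    using emeasure_space_1 by (simp add: emeasure_density)
  then have "has_bochner_integral lborel (erlang_density k x) 1"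
    using x by (intro has_bochner_integral_nn_integral) auto
  then have "has_bochner_integral lborel (\<lambda>t. fact k / x ^ Suc k * erlang_density k x t) (fact k / x ^ Suc k * 1)"
    by (rule has_bochner_integral_mult_right)
  moreover have "fact k / x ^ Suc k * erlang_density k x t = indicator {0..} t * (t ^ k * exp (- x * t))" for t
    using x by (auto simp: erlang_density_def indicator_def field_simps)
  ultimately show ?thesis by simp
qed

definition texp :: "nat \<Rightarrow> complex \<Rightarrow> real \<Rightarrow> complex" where
  "texp k a t = indicator {0..} t * (of_real t ^ k * exp (- a * of_real t))"

lemma l2_half_texp:
  assumes "0 < Re a"
  shows "l2_half (texp k a)"
proof -
  have "(cmod (texp k a t))\<^sup>2 = indicator {0..} t * (t ^ (2 * k) * exp (- (2 * Re a) * t))" for t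
  proof -
    have "(exp (- (Re a * t)))\<^sup>2 = exp (- (2 * Re a * t))" by (simp add: power2_eq_square flip: exp_add)
    then show ?thesis
      by (auto simp: texp_def norm_mult norm_power indicator_def power_mult_distrib mult.commute[of 2 k] power_mult)
  qed
  then have "integrable lborel (\<lambda>t. (cmod (texp k a t))\<^sup>2)"
    using gamma_moment[of "2 * Re a" "2 * k"] assms by (auto simp: has_bochner_integral_iff)
  moreover have "texp k a \<in> borel_measurable borel"
    unfolding texp_def by measurable
  ultimately show ?thesis by (auto simp: l2_half_def texp_def)
qed

lemma integrable_texp:
  assumes f: "l2_half f" and "0 < Re a"
  shows "integrable lborel (\<lambda>t. f t * texp k a t)"
  using l2_halfD(1,3)[OF f] l2_halfD(1,3)[OF l2_half_texp[OF assms(2), of k]]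
  by (intro integrable_mult_L2) auto

lemma laplace_texp: 
  assumes "l2_half f" 
  shows "laplace f z = (\<integral>t. f t * texp 0 z t \<partial>lborel)"
  unfolding laplace_def texp_def using l2_halfD(2)[OF assms]
  by (intro Bochner_Integration.integral_cong) (auto simp: indicator_def not_le)

text \<open>Expand \<open>exp (- z t)\<close> about \<open>a\<close>. The partial sums are dominated by \<open>exp (|z - a| t - Re a t)\<close>, which
  decays because \<open>|z - a| < Re a\<close>.\<close>

lemma laplace_series:
  assumes f: "l2_half f" and z: "cmod (z - a) < Re a"
  shows "(\<lambda>k. ((- 1) ^ k / fact k * (\<integral>t. f t * texp k a t \<partial>lborel)) * (z - a) ^ k) sums laplace f z"
proof -
  have a: "0 < Re a" using z norm_ge_zero[of "z - a"] by linarith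
  define d where "d = Re a - cmod (z - a)"
  have d: "0 < Re (of_real d)" using z by (simp add: d_def)
  define P where "P = (\<lambda>N t. \<Sum>k<N. ((- 1) ^ k / fact k * (z - a) ^ k) * (f t * texp k a t))"
  have fm [measurable]: "f \<in> borel_measurable borel" by (rule l2_halfD(1)[OF f])
  have tm [measurable]: "texp k b \<in> borel_measurable borel" for k b
    unfolding texp_def by measurable
  have Pe: "P N t = f t * texp 0 a t * (\<Sum>k<N. (of_real t * (a - z)) ^ k /\<^sub>R fact k)" for N t
  proof -
    have "(- 1) ^ k * (z - a) ^ k = (a - z) ^ k" for k
      by (simp flip: power_mult_distrib)
    then have "((- 1) ^ k / fact k * (z - a) ^ k) * (f t * texp k a t) = (a - z) ^ k / fact k * (f t * texp k a t)" for k
      by simp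
    also have "(a - z) ^ k / fact k * (f t * texp k a t) = f t * texp 0 a t * ((of_real t * (a - z)) ^ k /\<^sub>R fact k)" for k
      unfolding power_mult_distrib scaleR_conv_of_real texp_def by (simp add: divide_inverse mult_ac)
    finally have "((- 1) ^ k / fact k * (z - a) ^ k) * (f t * texp k a t) = f t * texp 0 a t * ((of_real t * (a - z)) ^ k /\<^sub>R fact k)" for k .
    then show ?thesis by (simp add: P_def sum_distrib_left)
  qed
  have "(\<lambda>N. \<integral>t. P N t \<partial>lborel) \<longlonglongrightarrow> (\<integral>t. f t * texp 0 z t \<partial>lborel)"
  proof (rule integral_dominated_convergence[where w = "\<lambda>t. cmod (f t * texp 0 (of_real d) t)"])
    show "integrable lborel (\<lambda>t. cmod (f t * texp 0 (of_real d) t))"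
      by (intro integrable_norm integrable_texp[OF f d])
    show "AE t in lborel. (\<lambda>N. P N t) \<longlonglongrightarrow> f t * texp 0 z t"
    proof (rule AE_I2)
      fix t
      have "(\<lambda>N. f t * texp 0 a t * (\<Sum>k<N. (of_real t * (a - z)) ^ k /\<^sub>R fact k)) \<longlonglongrightarrow> f t * texp 0 a t * exp (of_real t * (a - z))"
        using exp_converges[of "of_real t * (a - z)"] by (intro tendsto_intros) (simp add: sums_def)
      moreover have "texp 0 a t * exp (of_real t * (a - z)) = texp 0 z t"
        by (simp add: texp_def algebra_simps flip: exp_add)
      ultimately show "(\<lambda>N. P N t) \<longlonglongrightarrow> f t * texp 0 z t" by (simp add: Pe mult.assoc)
    qed
    show "AE t in lborel. norm (P N t) \<le> cmod (f t * texp 0 (of_real d) t)" for N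
    proof (rule AE_I2)
      fix t :: real
      show "norm (P N t) \<le> cmod (f t * texp 0 (of_real d) t)"
      proof (cases "0 \<le> t")
        case True
        have "norm (\<Sum>k<N. (of_real t * (a - z)) ^ k /\<^sub>R fact k) \<le> (\<Sum>k<N. (t * cmod (z - a)) ^ k /\<^sub>R fact k)"
          using True by (intro sum_norm_le) (simp add: norm_mult norm_power norm_minus_commute)
        also have "\<dots> \<le> (\<Sum>k. (t * cmod (z - a)) ^ k /\<^sub>R fact k)"
          using True by (intro sum_le_suminf summable_exp_generic) auto
        also have "\<dots> = exp (t * cmod (z - a))" by (simp add: exp_def)
        finally have "norm (P N t) \<le> cmod (f t) * (cmod (texp 0 a t) * exp (t * cmod (z - a)))"
          unfolding Pe norm_mult mult.assoc by (intro mult_left_mono) auto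
        also have "cmod (texp 0 a t) * exp (t * cmod (z - a)) = cmod (texp 0 (of_real d) t)"
          using True by (simp add: texp_def d_def norm_mult algebra_simps flip: exp_add)
        finally show ?thesis by (simp add: norm_mult mult.assoc)
      qed (simp add: Pe texp_def)
    qed
    show "P N \<in> borel_measurable lborel" for N unfolding P_def by measurable
  qed measurable
  moreover have "(\<integral>t. P N t \<partial>lborel) = (\<Sum>k<N. ((- 1) ^ k / fact k * (\<integral>t. f t * texp k a t \<partial>lborel)) * (z - a) ^ k)" for N
  proof -
    have "(\<integral>t. P N t \<partial>lborel) = (\<Sum>k<N. ((- 1) ^ k / fact k * (z - a) ^ k) * (\<integral>t. f t * texp k a t \<partial>lborel))"
      unfolding P_def using integrable_texp[OF f a]
      by (subst Bochner_Integration.integral_sum) (auto intro: integrable_mult_right)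
    then show ?thesis by (simp add: mult_ac)
  qed
  ultimately show ?thesis by (simp add: sums_def laplace_texp[OF f])
qed

lemma holomorphic_laplace:
  assumes f: "l2_half f"
  shows "laplace f holomorphic_on {z. 0 < Re z}"
  unfolding holomorphic_on_def
proof
  fix a assume "a \<in> {z. 0 < Re z}"
  then have a: "0 < Re a" by simp
  have "laplace f holomorphic_on ball a (Re a)"
    by (rule power_series_holomorphic[where a = "\<lambda>k. (- 1) ^ k / fact k * (\<integral>t. f t * texp k a t \<partial>lborel)"])
      (intro laplace_series[OF f], simp add: dist_norm norm_minus_commute)
  then have "laplace f field_differentiable at a"
    using a by (auto simp: holomorphic_on_open field_differentiable_def holomorphic_on_imp_differentiable_at)
  then show "laplace f field_differentiable at a within {z. 0 < Re z}"
    by (rule field_differentiable_at_within)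
qed

lemma halfplane: "open {z. 0 < Re z}" "connected {z. 0 < Re z}"
  by (simp_all add: open_halfspace_Re_gt convex_connected convex_halfspace_Re_gt)

section \<open>Uniqueness of the Laplace transform\<close>

text \<open>The positive and the negative part of \<open>a\<close> have the same mass. If it is not 0, division by it turns
  them into probability densities with equal characteristic functions.\<close>

lemma fourier_unique_real:
  fixes a :: "real \<Rightarrow> real"
  assumes a: "integrable lborel a" and z: "\<And>y. (\<integral>t. of_real (a t) * iexp (y * t) \<partial>lborel) = 0"
  shows "AE t in lborel. a t = 0"
proof -
  have [measurable]: "a \<in> borel_measurable borel" using a by auto
  define p where "p = (\<lambda>t. max 0 (a t))"
  define n where "n = (\<lambda>t. max 0 (- a t))"
  have [measurable]: "p \<in> borel_measurable borel" "n \<in> borel_measurable borel" unfolding p_def n_def by measurable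
  have ip: "integrable lborel p" "integrable lborel n" unfolding p_def n_def using a by auto
  have pn: "a t = p t - n t" "0 \<le> p t" "0 \<le> n t" for t by (auto simp: p_def n_def)
  have ie: "integrable lborel (\<lambda>t. of_real (q t) * iexp (y * t))" if "integrable lborel q" for q :: "real \<Rightarrow> real" and y
    using that by (intro Bochner_Integration.integrable_bound[OF that]) (auto simp: norm_mult)
  have eq: "(\<integral>t. of_real (p t) * iexp (y * t) \<partial>lborel) = (\<integral>t. of_real (n t) * iexp (y * t) \<partial>lborel)" for y
    using z[of y] ie[OF ip(1), of y] ie[OF ip(2), of y] by (simp add: pn(1) left_diff_distrib)
  define m where "m = (\<integral>t. p t \<partial>lborel)"
  have m2: "m = (\<integral>t. n t \<partial>lborel)" using eq[of 0] by (simp add: m_def)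
  have m0: "0 \<le> m" unfolding m_def by (intro integral_nonneg_AE AE_I2 pn)
  show ?thesis
  proof (cases "m = 0")
    case True
    have "AE t in lborel. p t = 0" "AE t in lborel. n t = 0"
      using integral_nonneg_eq_0_iff_AE[OF ip(1)] integral_nonneg_eq_0_iff_AE[OF ip(2)] True pn m2 by (auto simp: m_def)
    then show ?thesis by eventually_elim (simp add: pn(1))
  next
    case False
    with m0 have mp: "0 < m" by simp
    define D where "D = (\<lambda>q. density lborel (\<lambda>t::real. ennreal (q t / m)))"
    have real_dist: "real_distribution (D q)" if q: "integrable lborel q" "\<And>t. 0 \<le> q t" "(\<integral>t. q t \<partial>lborel) = m" for q
    proof -
      have [measurable]: "q \<in> borel_measurable borel" using q by auto
      have "emeasure (D q) (space (D q)) = (\<integral>\<^sup>+t. ennreal (q t / m) \<partial>lborel)"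
        unfolding D_def by (subst emeasure_density) auto
      also have "\<dots> = ennreal (\<integral>t. q t / m \<partial>lborel)"
        using q mp by (intro nn_integral_eq_integral) auto
      also have "\<dots> = 1" using q mp by simp
      finally have "prob_space (D q)" by (rule prob_spaceI)
      then show ?thesis by (auto simp: real_distribution_def real_distribution_axioms_def D_def)
    qed
    have ch: "char (D q) y = (\<integral>t. of_real (q t) * iexp (y * t) \<partial>lborel) / of_real m" if q: "integrable lborel q" "\<And>t. 0 \<le> q t" for q y
    proof -
      have [measurable]: "q \<in> borel_measurable borel" using q by auto
      have "char (D q) y = (\<integral>t. (q t / m) *\<^sub>R iexp (y * t) \<partial>lborel)"
        unfolding char_def D_def using q mp by (subst integral_density) auto
      also have "\<dots> = (\<integral>t. of_real (q t) * iexp (y * t) / of_real m \<partial>lborel)"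
        by (simp add: scaleR_conv_of_real)
      finally show ?thesis by simp
    qed
    have "D p = D n"
      using ip pn m2 eq by (intro Levy_uniqueness real_dist) (auto simp: m_def ch fun_eq_iff)
    then have "AE t in lborel. ennreal (p t / m) = ennreal (n t / m)"
      unfolding D_def       by (subst (asm) sigma_finite_measure.density_unique_iff[OF sigma_finite_lborel]) auto
    then show ?thesis by eventually_elim (use pn mp in simp)
  qed
qed

lemma fourier_unique:
  fixes v :: "real \<Rightarrow> complex"
  assumes v: "integrable lborel v" and z: "\<And>y. (\<integral>t. v t * iexp (y * t) \<partial>lborel) = 0"
  shows "AE t in lborel. v t = 0"
proof -
  have [measurable]: "v \<in> borel_measurable borel" using v by auto
  have ie: "integrable lborel (\<lambda>t. q t * iexp (y * t))" if "integrable lborel q" for q :: "real \<Rightarrow> complex" and y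
    using that by (intro Bochner_Integration.integrable_bound[OF that]) (auto simp: norm_mult)
  have cn: "integrable lborel (\<lambda>t. cnj (v t))" using v by simp
  have z2: "(\<integral>t. cnj (v t) * iexp (y * t) \<partial>lborel) = 0" for y
  proof -
    have "cnj (\<integral>t. v t * iexp ((- y) * t) \<partial>lborel) = (\<integral>t. cnj (v t) * iexp (y * t) \<partial>lborel)"
      unfolding Bochner_Integration.integral_cnj[symmetric] by (simp add: exp_cnj)
    then show ?thesis using z[of "- y"] by simp
  qed
  have "AE t in lborel. Re (v t) = 0"
  proof (rule fourier_unique_real)
    show "integrable lborel (\<lambda>t. Re (v t))" using v by simp
    fix y
    have "complex_of_real (Re (v t)) * iexp (y * t) = 1 / 2 * (v t * iexp (y * t) + cnj (v t) * iexp (y * t))" for t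
    proof -
      have "complex_of_real (Re (v t)) = 1 / 2 * (v t + cnj (v t))" by (simp add: complex_add_cnj)
      then show ?thesis by (simp only: mult.assoc distrib_right)
    qed
    then have "(\<integral>t. of_real (Re (v t)) * iexp (y * t) \<partial>lborel) = (\<integral>t. 1 / 2 * (v t * iexp (y * t) + cnj (v t) * iexp (y * t)) \<partial>lborel)"
      by (simp only:)
    also have "\<dots> = 0"
      using ie[OF v, of y] ie[OF cn, of y] z[of y] z2[of y] by simp
    finally show "(\<integral>t. of_real (Re (v t)) * iexp (y * t) \<partial>lborel) = 0" .
  qed
  moreover have "AE t in lborel. Im (v t) = 0"
  proof (rule fourier_unique_real)
    show "integrable lborel (\<lambda>t. Im (v t))" using v by simp
    fix y
    have "complex_of_real (Im (v t)) * iexp (y * t) = 1 / (2 * \<i>) * (v t * iexp (y * t) - cnj (v t) * iexp (y * t))" for t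
    proof -
      have "complex_of_real (Im (v t)) = 1 / (2 * \<i>) * (v t - cnj (v t))" by (simp add: complex_diff_cnj complex_eq_iff)
      then show ?thesis by (simp only: mult.assoc left_diff_distrib)
    qed
    then have "(\<integral>t. of_real (Im (v t)) * iexp (y * t) \<partial>lborel) = (\<integral>t. 1 / (2 * \<i>) * (v t * iexp (y * t) - cnj (v t) * iexp (y * t)) \<partial>lborel)"
      by (simp only:)
    also have "\<dots> = 0"
      using ie[OF v, of y] ie[OF cn, of y] z[of y] z2[of y] by simp
    finally show "(\<integral>t. of_real (Im (v t)) * iexp (y * t) \<partial>lborel) = 0" .
  qed
  ultimately show ?thesis by eventually_elim (simp add: complex_eq_iff)
qed

lemma laplace_unique:
  assumes f: "l2_half f" and z: "\<And>z. 0 < Re z \<Longrightarrow> laplace f z = 0"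
  shows "AE t in lborel. f t = 0"
proof -
  have "AE t in lborel. f t * texp 0 1 t = 0"
  proof (rule fourier_unique)
    show "integrable lborel (\<lambda>t. f t * texp 0 1 t)" by (rule integrable_texp[OF f]) simp
    fix y :: real
    have "(\<integral>t. f t * texp 0 1 t * iexp (y * t) \<partial>lborel) = (\<integral>t. f t * texp 0 (Complex 1 (- y)) t \<partial>lborel)"
    proof (intro Bochner_Integration.integral_cong refl)
      fix t
      have "- Complex 1 (- y) * of_real t = - 1 * of_real t + \<i> * of_real (y * t)" by (simp add: complex_eq_iff)
      then show "f t * texp 0 1 t * iexp (y * t) = f t * texp 0 (Complex 1 (- y)) t"
        unfolding texp_def by (simp only: exp_add) simp
    qed
    also have "\<dots> = laplace f (Complex 1 (- y))" by (simp add: laplace_texp[OF f])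
    also have "\<dots> = 0" by (rule z) simp
    finally show "(\<integral>t. f t * texp 0 1 t * iexp (y * t) \<partial>lborel) = 0" .
  qed
  then show ?thesis
    by eventually_elim (use l2_halfD(2)[OF f] in \<open>auto simp: texp_def indicator_def split: if_splits\<close>)
qed

text \<open>The moments are the Taylor coefficients at 1 of the Laplace transform, up to nonzero factors.\<close>

lemma moments_unique:
  assumes f: "l2_half f" and m: "\<And>k. (\<integral>t. f t * texp k 1 t \<partial>lborel) = 0"
  shows "AE t in lborel. f t = 0"
proof (rule laplace_unique[OF f])
  have b: "laplace f z = 0" if "z \<in> ball 1 1" for z
    using laplace_series[OF f, of z 1] that by (simp add: m dist_norm norm_minus_commute sums_iff)
  fix z :: complex assume z: "0 < Re z"
  show "laplace f z = 0"
  proof (rule analytic_continuation_open[where f = "laplace f" and g = "\<lambda>_. 0" and s = "ball 1 1" and s' = "{z. 0 < Re z}"])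
    show "ball (1::complex) 1 \<subseteq> {z. 0 < Re z}"
    proof
      fix w :: complex assume "w \<in> ball 1 1"
      then show "w \<in> {z. 0 < Re z}" using complex_Re_le_cmod[of "1 - w"] by (simp add: dist_norm)
    qed
  qed (use b z f halfplane in \<open>auto intro: holomorphic_laplace\<close>)
qed

section \<open>The Riesz-Fischer theorem\<close>

locale orthonormal_sequence =
  fixes M :: "'a measure" and e :: "nat \<Rightarrow> 'a \<Rightarrow> complex"
  assumes e_meas [measurable]: "\<And>n. e n \<in> borel_measurable M"
    and e2: "\<And>n. integrable M (\<lambda>x. (cmod (e n x))\<^sup>2)"
    and orth: "\<And>m n. (\<integral>x. e m x * cnj (e n x) \<partial>M) = (if m = n then 1 else 0)"
begin

lemma e_prod: "integrable M (\<lambda>x. e m x * cnj (e n x))"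
  using e2 by (intro integrable_mult_L2) auto

lemma pythagoras:
  assumes "finite A"
  shows "integrable M (\<lambda>x. (cmod (\<Sum>n\<in>A. c n * e n x))\<^sup>2)"
    and "(\<integral>x. (cmod (\<Sum>n\<in>A. c n * e n x))\<^sup>2 \<partial>M) = (\<Sum>n\<in>A. (cmod (c n))\<^sup>2)"
proof -
  have eq: "complex_of_real ((cmod (\<Sum>n\<in>A. c n * e n x))\<^sup>2) = (\<Sum>m\<in>A. \<Sum>n\<in>A. (c m * cnj (c n)) * (e m x * cnj (e n x)))" for x
    unfolding complex_norm_square cnj_sum sum_product by (simp add: mult_ac)
  have "integrable M (\<lambda>x. complex_of_real ((cmod (\<Sum>n\<in>A. c n * e n x))\<^sup>2))"
    unfolding eq using e_prod by (intro Bochner_Integration.integrable_sum integrable_mult_right) auto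
  then show "integrable M (\<lambda>x. (cmod (\<Sum>n\<in>A. c n * e n x))\<^sup>2)"
    by (simp only: complex_of_real_integrable_eq)
  have "complex_of_real (\<integral>x. (cmod (\<Sum>n\<in>A. c n * e n x))\<^sup>2 \<partial>M) = (\<integral>x. (\<Sum>m\<in>A. \<Sum>n\<in>A. (c m * cnj (c n)) * (e m x * cnj (e n x))) \<partial>M)"
    unfolding integral_complex_of_real[symmetric] eq ..
  also have "\<dots> = (\<Sum>m\<in>A. \<Sum>n\<in>A. (c m * cnj (c n)) * (if m = n then 1 else 0))"
    unfolding orth[symmetric] using e_prod by (simp add: Bochner_Integration.integral_sum)
  also have "\<dots> = of_real (\<Sum>n\<in>A. (cmod (c n))\<^sup>2)"
    unfolding of_real_sum complex_norm_square using assms by (simp add: if_distrib cong: if_cong)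
  finally show "(\<integral>x. (cmod (\<Sum>n\<in>A. c n * e n x))\<^sup>2 \<partial>M) = (\<Sum>n\<in>A. (cmod (c n))\<^sup>2)"
    by (simp only: of_real_eq_iff)
qed

text \<open>Choose a subsequence of the partial sums whose increments \<open>G k\<close> have squared norm at most
  \<open>16\<^sup>-\<^sup>k\<close>. Then \<open>S = (\<Sum>k. 4\<^sup>k |G k|\<^sup>2)\<close> is finite almost everywhere, and \<open>|G k| \<le> sqrt S / 2\<^sup>k\<close>. This gives
  pointwise convergence together with a square-integrable majorant, hence convergence of the integrals
  against every square-integrable \<open>g\<close>.\<close>

theorem riesz_fischer:
  assumes c: "summable (\<lambda>n. (cmod (c n))\<^sup>2)"
  obtains v N where "v \<in> borel_measurable M" "integrable M (\<lambda>x. (cmod (v x))\<^sup>2)" "strict_mono (N :: nat \<Rightarrow> nat)"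
    "\<And>g. g \<in> borel_measurable M \<Longrightarrow> integrable M (\<lambda>x. (cmod (g x))\<^sup>2) \<Longrightarrow>
       (\<lambda>k. \<integral>x. (\<Sum>n<N k. c n * e n x) * g x \<partial>M) \<longlonglongrightarrow> (\<integral>x. v x * g x \<partial>M)"
    "\<And>x. (\<And>n. e n x = 0) \<Longrightarrow> v x = 0"
proof -
  have "\<exists>n0. \<forall>m\<ge>n0. \<forall>n. norm (\<Sum>i\<in>{m..<n}. (cmod (c i))\<^sup>2) < (1 / 16) ^ k" for k
    using c[unfolded summable_Cauchy, rule_format, of "(1 / 16) ^ k"] by simp
  then have "\<forall>k. \<exists>n0. \<forall>m\<ge>n0. \<forall>n. norm (\<Sum>i\<in>{m..<n}. (cmod (c i))\<^sup>2) < (1 / 16) ^ k" ..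
  from choice[OF this] obtain n0 where n0: "\<And>k m n. m \<ge> n0 k \<Longrightarrow> norm (\<Sum>i\<in>{m..<n}. (cmod (c i))\<^sup>2) < (1 / 16) ^ k"
    by blast
  \<comment> \<open>The summation makes the sequence strictly increasing; it stays above \<open>n0\<close>.\<close>
  define N where "N = (\<lambda>k::nat. \<Sum>i\<le>k. n0 i + 1)"
  have N_mono: "strict_mono N" by (rule strict_monoI_Suc) (simp add: N_def)
  have N_ge: "n0 k \<le> N k" for k by (cases k) (auto simp: N_def)
  define F where "F = (\<lambda>m x. \<Sum>n<m. c n * e n x)"
  have [measurable]: "F m \<in> borel_measurable M" for m unfolding F_def by measurable
  define G where "G = (\<lambda>k x. F (N (Suc k)) x - F (N k) x)"
  have G_eq: "G k x = (\<Sum>n\<in>{N k..<N (Suc k)}. c n * e n x)" for k x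
  proof -
    have "{..<N (Suc k)} = {..<N k} \<union> {N k..<N (Suc k)}" using strict_monoD[OF N_mono, of k "Suc k"] by auto
    then have "F (N (Suc k)) x = (\<Sum>n\<in>{..<N k} \<union> {N k..<N (Suc k)}. c n * e n x)"
      unfolding F_def by (rule sum.cong) (rule refl)
    also have "\<dots> = F (N k) x + (\<Sum>n\<in>{N k..<N (Suc k)}. c n * e n x)"
      unfolding F_def by (rule sum.union_disjoint) auto
    finally have "F (N (Suc k)) x = F (N k) x + (\<Sum>n\<in>{N k..<N (Suc k)}. c n * e n x)" .
    then show ?thesis by (simp add: G_def)
  qed
  have [measurable]: "G k \<in> borel_measurable M" for k unfolding G_def by measurable
  have G2: "(\<integral>\<^sup>+x. ennreal (4 ^ k * (cmod (G k x))\<^sup>2) \<partial>M) \<le> ennreal ((1 / 4) ^ k)" for k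
  proof -
    have "(\<integral>\<^sup>+x. ennreal (4 ^ k * (cmod (G k x))\<^sup>2) \<partial>M) = ennreal (\<integral>x. 4 ^ k * (cmod (G k x))\<^sup>2 \<partial>M)"
      unfolding G_eq using pythagoras(1) by (intro nn_integral_eq_integral) auto
    also have "(\<integral>x. 4 ^ k * (cmod (G k x))\<^sup>2 \<partial>M) = 4 ^ k * (\<Sum>n\<in>{N k..<N (Suc k)}. (cmod (c n))\<^sup>2)"
      unfolding G_eq by (simp add: pythagoras(2))
    also have "\<dots> \<le> 4 ^ k * (1 / 16) ^ k"
      using n0[OF N_ge, of k "N (Suc k)"] by (intro mult_left_mono) auto
    also have "4 ^ k * (1 / 16) ^ k = (1 / 4 :: real) ^ k" by (simp flip: power_mult_distrib)
    finally show ?thesis by (simp add: ennreal_leI)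
  qed
  define S where "S = (\<lambda>x. \<Sum>k. ennreal (4 ^ k * (cmod (G k x))\<^sup>2))"
  have [measurable]: "S \<in> borel_measurable M" unfolding S_def by measurable
  have "(\<integral>\<^sup>+x. S x \<partial>M) = (\<Sum>k. \<integral>\<^sup>+x. ennreal (4 ^ k * (cmod (G k x))\<^sup>2) \<partial>M)"
    unfolding S_def by (rule nn_integral_suminf) measurable
  also have "\<dots> \<le> (\<Sum>k. ennreal ((1 / 4) ^ k))" by (intro suminf_le G2) auto
  also have "\<dots> = ennreal (\<Sum>k. (1 / 4) ^ k)" by (intro suminf_ennreal2) auto
  finally have S_int: "(\<integral>\<^sup>+x. S x \<partial>M) < \<infinity>" by (auto intro: le_less_trans)
  then have S_fin: "AE x in M. S x \<noteq> \<infinity>" by (intro nn_integral_PInf_AE) auto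
  define s where "s = (\<lambda>x. enn2real (S x))"
  have [measurable]: "s \<in> borel_measurable M" unfolding s_def by measurable
  have s0: "0 \<le> s x" for x by (simp add: s_def)
  have "(\<integral>\<^sup>+x. ennreal (s x) \<partial>M) = (\<integral>\<^sup>+x. S x \<partial>M)"
    using S_fin by (intro nn_integral_cong_AE) (auto simp: s_def less_top)
  then have s_int: "integrable M s" using S_int s0 by (intro integrableI_bounded) auto
  have Gs: "cmod (G k x) \<le> sqrt (s x) * (1 / 2) ^ k" if "S x \<noteq> \<infinity>" for k x
  proof -
    have "a k \<le> suminf a" for a :: "nat \<Rightarrow> ennreal"
      using sum_le_suminf[of a "{k}"] by simp
    then have "ennreal (4 ^ k * (cmod (G k x))\<^sup>2) \<le> S x" unfolding S_def .
    also have "S x = ennreal (s x)" using that by (simp add: s_def less_top)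
    finally have "4 ^ k * (cmod (G k x))\<^sup>2 \<le> s x" using s0 by simp
    moreover have "((2::real) ^ k)\<^sup>2 = 4 ^ k" by (simp add: power2_eq_square flip: power_mult_distrib)
    ultimately have "(2 ^ k * cmod (G k x))\<^sup>2 \<le> s x" by (simp add: power_mult_distrib)
    then have "2 ^ k * cmod (G k x) \<le> sqrt (s x)" by (rule real_le_rsqrt)
    then show ?thesis by (simp add: power_one_over field_simps)
  qed
  have F_tele: "F (N k) x = F (N 0) x + (\<Sum>i<k. G i x)" for k x
    by (induction k) (auto simp: G_def)
  have gsum: "(\<Sum>i<k. (1 / 2) ^ i) \<le> (2::real)" for k
    using sum_le_suminf[of "\<lambda>i. (1 / 2 :: real) ^ i" "{..<k}"] by (simp add: suminf_geometric)
  have Fb: "cmod (F (N k) x) \<le> cmod (F (N 0) x) + 2 * sqrt (s x)" if "S x \<noteq> \<infinity>" for k x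
  proof -
    have "cmod (\<Sum>i<k. G i x) \<le> (\<Sum>i<k. sqrt (s x) * (1 / 2) ^ i)"
      by (intro sum_norm_le Gs that)
    also have "\<dots> = sqrt (s x) * (\<Sum>i<k. (1 / 2) ^ i)" by (simp add: sum_distrib_left)
    also have "\<dots> \<le> sqrt (s x) * 2" by (intro mult_left_mono gsum) (simp add: s0)
    finally show ?thesis unfolding F_tele[of k] using norm_triangle_ineq[of "F (N 0) x" "\<Sum>i<k. G i x"] by simp
  qed
  define v where "v = (\<lambda>x. lim (\<lambda>k. F (N k) x))"
  have [measurable]: "v \<in> borel_measurable M" unfolding v_def by (rule borel_measurable_lim_metric) measurable
  have v_lim: "(\<lambda>k. F (N k) x) \<longlonglongrightarrow> v x" if "S x \<noteq> \<infinity>" for x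
  proof -
    have "summable (\<lambda>i. G i x)"
    proof (rule summable_comparison_test)
      show "summable (\<lambda>i. sqrt (s x) * (1 / 2) ^ i)" by (intro summable_mult summable_geometric) simp
    qed (use Gs[OF that] in auto)
    then have "(\<lambda>k. F (N 0) x + (\<Sum>i<k. G i x)) \<longlonglongrightarrow> F (N 0) x + (\<Sum>i. G i x)"
      by (intro tendsto_intros summable_LIMSEQ)
    then have "convergent (\<lambda>k. F (N k) x)" unfolding F_tele[symmetric] by (rule convergentI)
    then show ?thesis unfolding v_def by (simp add: convergent_LIMSEQ_iff)
  qed
  define W where "W = (\<lambda>x. cmod (F (N 0) x) + 2 * sqrt (s x))"
  have [measurable]: "W \<in> borel_measurable M" unfolding W_def by measurable
  have F0_int: "integrable M (\<lambda>x. (cmod (F (N 0) x))\<^sup>2)"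
    unfolding F_def by (rule pythagoras(1)) simp
  have W_int: "integrable M (\<lambda>x. (W x)\<^sup>2)"
  proof (rule Bochner_Integration.integrable_bound)
    show "integrable M (\<lambda>x. 2 * (cmod (F (N 0) x))\<^sup>2 + 8 * s x)"
      using F0_int s_int by auto
    have "(W x)\<^sup>2 \<le> 2 * (cmod (F (N 0) x))\<^sup>2 + 8 * s x" for x
    proof -
      have "(W x)\<^sup>2 = (cmod (F (N 0) x))\<^sup>2 + (2 * sqrt (s x))\<^sup>2 + 2 * cmod (F (N 0) x) * (2 * sqrt (s x))"
        unfolding W_def by (rule power2_sum)
      also have "\<dots> \<le> 2 * (cmod (F (N 0) x))\<^sup>2 + 2 * (2 * sqrt (s x))\<^sup>2"
        using sum_squares_bound[of "cmod (F (N 0) x)" "2 * sqrt (s x)"] by linarith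
      also have "2 * (2 * sqrt (s x))\<^sup>2 = 8 * s x" using s0[of x] by (simp add: power_mult_distrib)
      finally show ?thesis by simp
    qed
    then show "AE x in M. norm ((W x)\<^sup>2) \<le> norm (2 * (cmod (F (N 0) x))\<^sup>2 + 8 * s x)"
      using s0 by (intro AE_I2) (simp add: add_nonneg_nonneg)
  qed measurable
  have vW: "AE x in M. cmod (v x) \<le> W x"
    using S_fin
  proof eventually_elim
    case (elim x)
    then show ?case
      using Fb[OF elim] by (intro tendsto_upperbound[OF tendsto_norm[OF v_lim[OF elim]]]) (auto simp: W_def)
  qed
  show thesis
  proof (rule that[OF _ _ N_mono])
    show "v \<in> borel_measurable M" by measurable
    show "integrable M (\<lambda>x. (cmod (v x))\<^sup>2)"
      by (rule Bochner_Integration.integrable_bound[OF W_int]) (use vW in \<open>auto elim!: eventually_mono intro!: power_mono\<close>)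
    show "(\<lambda>k. \<integral>x. (\<Sum>n<N k. c n * e n x) * g x \<partial>M) \<longlonglongrightarrow> (\<integral>x. v x * g x \<partial>M)"
      if g [measurable]: "g \<in> borel_measurable M" and g2: "integrable M (\<lambda>x. (cmod (g x))\<^sup>2)" for g
    proof (rule integral_dominated_convergence[where w = "\<lambda>x. W x * cmod (g x)"])
      show "integrable M (\<lambda>x. W x * cmod (g x))"
        by (rule Cauchy_Schwarz_integral(1)[OF _ _ W_int g2]) measurable
      show "AE x in M. (\<lambda>k. (\<Sum>n<N k. c n * e n x) * g x) \<longlonglongrightarrow> v x * g x"
        using S_fin by eventually_elim (auto intro!: tendsto_intros v_lim[unfolded F_def])
      show "AE x in M. norm ((\<Sum>n<N k. c n * e n x) * g x) \<le> W x * cmod (g x)" for k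
      proof -
        have "AE x in M. norm (F (N k) x * g x) \<le> W x * cmod (g x)"
          using S_fin by eventually_elim (auto simp: norm_mult W_def intro!: mult_right_mono Fb)
        then show ?thesis by (simp add: F_def)
      qed
    qed measurable
    show "v x = 0" if "\<And>n. e n x = 0" for x
      by (simp add: v_def F_def that)
  qed
qed

end

section \<open>Laguerre functions\<close>

text \<open>Expand \<open>X\<^sup>m = ((1 + X) - 1)\<^sup>m\<close>. Multiplying by \<open>(1 + X)\<^sup>k\<close> and reading off coefficients gives the two
  sums behind the orthogonality of the Laguerre functions.\<close>

lemma alternating_binomial_poly:
  "(\<Sum>j\<le>m. smult (of_nat (m choose j) * (- 1) ^ (m - j)) ([:1, 1:] ^ j)) = (monom 1 m :: real poly)"
proof -
  have "(monom 1 m :: real poly) = ([:1, 1:] + [:- 1:]) ^ m" by (simp add: monom_altdef)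
  also have "\<dots> = (\<Sum>j\<le>m. of_nat (m choose j) * [:1, 1:] ^ j * [:- 1:] ^ (m - j))"
    by (rule binomial_ring)
  also have "\<dots> = (\<Sum>j\<le>m. smult (of_nat (m choose j) * (- 1) ^ (m - j)) ([:1, 1:] ^ j))"
    by (intro sum.cong refl) (simp add: of_nat_poly poly_const_pow mult_ac)
  finally show ?thesis ..
qed

lemma coeff_one_plus_power: "coeff ([:1, 1:] ^ n) i = (of_nat (n choose i) :: real)"
proof (cases "i \<le> n")
  case True
  then show ?thesis by (simp add: coeff_linear_poly_power)
next
  case False
  have "degree ([:1, 1:] ^ n :: real poly) \<le> n" using degree_power_le[of "[:1, 1:] :: real poly" n] by simp
  then show ?thesis using False by (simp add: coeff_eq_0 binomial_eq_0)
qed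

lemma alternating_binomial_shift:
  "(\<Sum>j\<le>m. of_nat (m choose j) * (- 1) ^ (m - j) * of_nat ((k + j) choose k)) = (of_nat (k choose m) :: real)"
proof -
  have "(\<Sum>j\<le>m. of_nat (m choose j) * (- 1) ^ (m - j) * of_nat ((k + j) choose k))
     = coeff ([:1, 1:] ^ k * (\<Sum>j\<le>m. smult (of_nat (m choose j) * (- 1) ^ (m - j)) ([:1, 1:] ^ j)) :: real poly) k"
    by (simp add: sum_distrib_left coeff_sum coeff_one_plus_power flip: power_add)
  also have "\<dots> = coeff (monom 1 m * [:1, 1:] ^ k :: real poly) k" unfolding alternating_binomial_poly by (simp add: mult.commute)
  also have "\<dots> = of_nat (k choose m)"
    by (auto simp: coeff_monom_mult coeff_one_plus_power binomial_eq_0 binomial_symmetric[of m k])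
  finally show ?thesis .
qed

lemma alternating_binomial_inversion:
  "(\<Sum>k\<le>n. of_nat (n choose k) * (- 1) ^ (n - k) * of_nat (k choose m)) = (if m = n then 1 else 0 :: real)"
proof -
  have "(\<Sum>k\<le>n. of_nat (n choose k) * (- 1) ^ (n - k) * of_nat (k choose m))
     = coeff (\<Sum>j\<le>n. smult (of_nat (n choose j) * (- 1) ^ (n - j)) ([:1, 1:] ^ j) :: real poly) m"
    by (simp add: coeff_sum coeff_one_plus_power)
  then show ?thesis unfolding alternating_binomial_poly by simp
qed

definition lag_coeff :: "nat \<Rightarrow> nat \<Rightarrow> real" where
  "lag_coeff n k = sqrt 2 * (of_nat (n choose k) * (- 1) ^ (n - k)) * 2 ^ k / fact k"

text \<open>The Laguerre functions \<open>(- 1)\<^sup>n sqrt 2 exp (- t) L\<^sub>n (2 t)\<close>, where \<open>L\<^sub>n\<close> is the Laguerre polynomial. The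
  sign makes their image in the disk \<open>z\<^sup>n\<close> and not \<open>(- z)\<^sup>n\<close>.\<close>

definition lag :: "nat \<Rightarrow> real \<Rightarrow> complex" where
  "lag n t = (\<Sum>k\<le>n. of_real (lag_coeff n k) * texp k 1 t)"

lemma texp_1: "texp k 1 t = of_real (indicator {0..} t * (t ^ k * exp (- 1 * t)))"
proof -
  have "exp (- complex_of_real t) = of_real (exp (- t))" by (simp add: exp_of_real flip: of_real_minus)
  then show ?thesis by (simp add: texp_def indicator_def)
qed

lemma texp_inner: "(\<integral>t. texp k 1 t * texp j 1 t \<partial>lborel) = of_real (fact (k + j) / 2 ^ Suc (k + j))"
proof -
  have "texp k 1 t * texp j 1 t = of_real (indicator {0..} t * (t ^ (k + j) * exp (- 2 * t)))" for t
  proof -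
    have "exp (- t) * exp (- t) = exp (- 2 * t)" by (simp flip: exp_add)
    then show ?thesis unfolding texp_1 of_real_mult[symmetric]
      by (intro arg_cong[where f = of_real]) (auto simp: indicator_def power_add algebra_simps)
  qed
  then show ?thesis
    using has_bochner_integral_integral_eq[OF gamma_moment[of 2 "k + j"]] by (simp only: integral_complex_of_real)
qed

lemma lag_measurable [measurable]: "lag n \<in> borel_measurable borel"
  unfolding lag_def texp_def by measurable

lemma integrable_texp2: "integrable lborel (\<lambda>t. texp k 1 t * texp j 1 t)"
  by (rule integrable_texp[OF l2_half_texp]) auto

lemma cnj_lag: "cnj (lag n t) = lag n t"
  by (simp add: lag_def texp_1)

lemma lag_mult: "lag m t * lag n t = (\<Sum>k\<le>m. \<Sum>j\<le>n. of_real (lag_coeff m k * lag_coeff n j) * (texp k 1 t * texp j 1 t))"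
  unfolding lag_def sum_product by (simp add: mult_ac)

lemma integrable_lag_mult: "integrable lborel (\<lambda>t. lag m t * lag n t)"
  unfolding lag_mult by (intro Bochner_Integration.integrable_sum integrable_mult_right integrable_texp2)

lemma lag_orthonormal: "(\<integral>t. lag m t * lag n t \<partial>lborel) = (if m = n then 1 else 0)"
proof -
  have "(\<integral>t. lag m t * lag n t \<partial>lborel) = (\<Sum>k\<le>m. \<Sum>j\<le>n. of_real (lag_coeff m k * lag_coeff n j) * of_real (fact (k + j) / 2 ^ Suc (k + j)))"
    unfolding lag_mult texp_inner[symmetric] using integrable_texp2
    by (simp add: Bochner_Integration.integral_sum)
  also have "\<dots> = of_real (\<Sum>k\<le>m. \<Sum>j\<le>n. lag_coeff m k * lag_coeff n j * (fact (k + j) / 2 ^ Suc (k + j)))"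
    by simp
  also have "(\<Sum>k\<le>m. \<Sum>j\<le>n. lag_coeff m k * lag_coeff n j * (fact (k + j) / 2 ^ Suc (k + j)))
      = (\<Sum>k\<le>m. \<Sum>j\<le>n. real (m choose k) * (- 1) ^ (m - k) * (real (n choose j) * (- 1) ^ (n - j) * real (k + j choose k)))"
  proof (intro sum.cong refl)
    fix k j
    have b: "real ((k + j) choose k) = fact (k + j) / (fact k * fact j)"
      using binomial_fact[of k "k + j", where 'a = real] by simp
    have "lag_coeff m k * lag_coeff n j * (fact (k + j) / 2 ^ Suc (k + j))
       = (sqrt 2 * sqrt 2) / 2 * (real (m choose k) * (- 1) ^ (m - k) * (real (n choose j) * (- 1) ^ (n - j) * (fact (k + j) / (fact k * fact j))))"
      unfolding lag_coeff_def by (simp only: power_add power_Suc) (simp add: field_simps)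
    then show "lag_coeff m k * lag_coeff n j * (fact (k + j) / 2 ^ Suc (k + j))
      = real (m choose k) * (- 1) ^ (m - k) * (real (n choose j) * (- 1) ^ (n - j) * real (k + j choose k))"
      unfolding b by simp
  qed
  also have "(\<Sum>k\<le>m. \<Sum>j\<le>n. real (m choose k) * (- 1) ^ (m - k) * (real (n choose j) * (- 1) ^ (n - j) * real (k + j choose k)))
     = (\<Sum>k\<le>m. real (m choose k) * (- 1) ^ (m - k) * real (k choose n))"
    unfolding sum_distrib_left[symmetric] alternating_binomial_shift ..
  also have "\<dots> = (if n = m then 1 else 0)" by (rule alternating_binomial_inversion)
  finally show ?thesis by auto
qed

lemma l2_half_lag: "l2_half (lag n)"
proof -
  have "complex_of_real ((cmod (lag n t))\<^sup>2) = lag n t * lag n t" for t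
    unfolding complex_norm_square cnj_lag ..
  then have "integrable lborel (\<lambda>t. complex_of_real ((cmod (lag n t))\<^sup>2))"
    using integrable_lag_mult by simp
  then have "integrable lborel (\<lambda>t. (cmod (lag n t))\<^sup>2)" by (simp only: complex_of_real_integrable_eq)
  then show ?thesis by (auto simp: l2_half_def lag_def texp_def)
qed

interpretation lag: orthonormal_sequence lborel lag
  using l2_halfD(3)[OF l2_half_lag] lag_orthonormal by unfold_locales (auto simp: cnj_lag)

text \<open>On the positive reals this is \<open>gamma_moment\<close>; both sides are holomorphic in the half plane.\<close>

lemma laplace_texp_1:
  assumes z: "0 < Re z"
  shows "laplace (texp k 1) z = fact k / (1 + z) ^ Suc k"
proof -
  have l2: "l2_half (texp k 1)" by (rule l2_half_texp) simp
  have real: "laplace (texp k 1) (of_real x) = fact k / (1 + of_real x) ^ Suc k" if x: "0 < x" for x :: real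
  proof -
    have "texp k 1 t * exp (- of_real x * of_real t) = of_real (indicator {0..} t * (t ^ k * exp (- (1 + x) * t)))" for t
    proof -
      have "exp (- of_real x * complex_of_real t) = of_real (exp (- x * t))" by (simp add: exp_of_real flip: of_real_minus of_real_mult)
      moreover have "exp (- 1 * t) * exp (- x * t) = exp (- (1 + x) * t)" by (simp add: algebra_simps flip: exp_add)
      ultimately show ?thesis unfolding texp_1 by (simp add: mult.assoc flip: of_real_mult)
    qed
    then have "laplace (texp k 1) (of_real x) = of_real (fact k / (1 + x) ^ Suc k)"
      unfolding laplace_def using has_bochner_integral_integral_eq[OF gamma_moment[of "1 + x" k]] x
      by (simp only: integral_complex_of_real)
    then show ?thesis by simp
  qed
  have nz: "1 + w \<noteq> 0" if "0 < Re w" for w :: complex using that by (auto simp: complex_eq_iff)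
  let ?f = "\<lambda>z. laplace (texp k 1) z - fact k / (1 + z) ^ Suc k"
  have "?f z = 0"
  proof (rule analytic_continuation[where f = ?f and U = "of_real ` {0<..}" and \<xi> = 1])
    show "?f holomorphic_on {z. 0 < Re z}"
      using nz by (intro holomorphic_intros holomorphic_laplace[OF l2]) auto
    show "(1::complex) islimpt of_real ` {0<..}"
      unfolding islimpt_approachable
    proof (intro allI impI)
      fix e :: real assume "0 < e"
      then show "\<exists>x'\<in>of_real ` {0<..}. x' \<noteq> (1::complex) \<and> dist x' 1 < e"
        by (intro bexI[of _ "of_real (1 + e / 2)"] imageI) (auto simp: dist_norm norm_divide)
    qed
  qed (use z halfplane real in auto)
  then show ?thesis by simp
qed

lemma laplace_add:
  assumes "l2_half f" "l2_half g" "0 < Re z"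
  shows "laplace (\<lambda>t. f t + g t) z = laplace f z + laplace g z"
proof -
  have "integrable lborel (\<lambda>t. h t * exp (- z * of_real t))" if h: "l2_half h" for h
  proof -
    have "h t * texp 0 z t = h t * exp (- z * of_real t)" for t
      using l2_halfD(2)[OF h, of t] by (cases "t < 0") (auto simp: texp_def)
    then have "(\<lambda>t. h t * texp 0 z t) = (\<lambda>t. h t * exp (- z * of_real t))" by blast
    then show ?thesis using integrable_texp[OF h assms(3), of 0] by simp
  qed
  then show ?thesis using assms unfolding laplace_def by (simp add: distrib_right)
qed

lemma laplace_cmult: "laplace (\<lambda>t. c * f t) z = c * laplace f z"
  unfolding laplace_def by (simp add: mult.assoc)

lemma l2_half_cmult: "l2_half f \<Longrightarrow> l2_half (\<lambda>t. c * f t)"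
  by (auto simp: l2_half_def norm_mult power_mult_distrib)

lemma l2_half_add:
  assumes f: "l2_half f" and g: "l2_half g"
  shows "l2_half (\<lambda>t. f t + g t)"
proof -
  have [measurable]: "f \<in> borel_measurable borel" "g \<in> borel_measurable borel" using f g by (auto simp: l2_half_def)
  have "integrable lborel (\<lambda>t. (cmod (f t + g t))\<^sup>2)"
  proof (rule Bochner_Integration.integrable_bound)
    show "integrable lborel (\<lambda>t. 2 * (cmod (f t))\<^sup>2 + 2 * (cmod (g t))\<^sup>2)"
      using l2_halfD(3)[OF f] l2_halfD(3)[OF g] by auto
    have "(cmod (f t + g t))\<^sup>2 \<le> 2 * (cmod (f t))\<^sup>2 + 2 * (cmod (g t))\<^sup>2" for t
    proof -
      have "(cmod (f t + g t))\<^sup>2 \<le> (cmod (f t) + cmod (g t))\<^sup>2"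
        by (intro power_mono norm_triangle_ineq) auto
      also have "\<dots> \<le> 2 * (cmod (f t))\<^sup>2 + 2 * (cmod (g t))\<^sup>2"
        using sum_squares_bound[of "cmod (f t)" "cmod (g t)"] by (simp add: power2_sum)
      finally show ?thesis .
    qed
    then show "AE t in lborel. norm ((cmod (f t + g t))\<^sup>2) \<le> norm (2 * (cmod (f t))\<^sup>2 + 2 * (cmod (g t))\<^sup>2)" by auto
  qed measurable
  then show ?thesis using f g by (auto simp: l2_half_def)
qed

lemma laplace_sum:
  fixes n :: nat
  assumes "\<And>i. l2_half (F i)" "0 < Re z"
  shows "l2_half (\<lambda>t. \<Sum>i<n. c i * F i t) \<and> laplace (\<lambda>t. \<Sum>i<n. c i * F i t) z = (\<Sum>i<n. c i * laplace (F i) z)"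
proof (induction n)
  case 0
  then show ?case by (simp add: l2_half_def laplace_def)
next
  case (Suc n)
  then show ?case using laplace_add[OF conjunct1[OF Suc] l2_half_cmult[OF assms(1)] assms(2)] assms(1)
    by (simp add: l2_half_add l2_half_cmult laplace_cmult)
qed

lemma laplace_lag:
  assumes z: "0 < Re z"
  shows "laplace (lag n) z = of_real (sqrt 2) * (1 - z) ^ n / (1 + z) ^ Suc n"
proof -
  have nz: "1 + z \<noteq> 0" using z by (auto simp: complex_eq_iff)
  have "laplace (lag n) z = (\<Sum>k<Suc n. of_real (lag_coeff n k) * laplace (texp k 1) z)"
    unfolding lag_def[abs_def] lessThan_Suc_atMost[symmetric]
    by (rule conjunct2[OF laplace_sum[OF l2_half_texp z]]) simp
  also have "\<dots> = (\<Sum>k\<le>n. of_real (sqrt 2) / (1 + z) * (of_nat (n choose k) * (2 / (1 + z)) ^ k * (- 1) ^ (n - k)))"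
    unfolding lessThan_Suc_atMost laplace_texp_1[OF z]
  proof (intro sum.cong refl)
    fix k
    have "complex_of_real (lag_coeff n k) * fact k = of_real (sqrt 2) * (of_nat (n choose k) * (- 1) ^ (n - k)) * 2 ^ k"
      by (simp add: lag_coeff_def)
    then show "complex_of_real (lag_coeff n k) * (fact k / (1 + z) ^ Suc k)
       = of_real (sqrt 2) / (1 + z) * (of_nat (n choose k) * (2 / (1 + z)) ^ k * (- 1) ^ (n - k))"
      unfolding times_divide_eq_right by (simp only: power_divide) simp
  qed
  also have "\<dots> = of_real (sqrt 2) / (1 + z) * (2 / (1 + z) + (- 1)) ^ n"
    unfolding binomial_ring sum_distrib_left ..
  also have "2 / (1 + z) + (- 1) = (1 - z) / (1 + z)" using nz by (simp add: field_simps)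
  finally show ?thesis by (simp add: power_divide)
qed

lemma lag_complete:
  assumes f: "l2_half f" and z: "\<And>n. (\<integral>t. f t * lag n t \<partial>lborel) = 0"
  shows "AE t in lborel. f t = 0"
proof (rule moments_unique[OF f])
  fix k
  show "(\<integral>t. f t * texp k 1 t \<partial>lborel) = 0"
  proof (induction k rule: less_induct)
    case (less n)
    have it: "integrable lborel (\<lambda>t. f t * texp k 1 t)" for k by (rule integrable_texp[OF f]) simp
    have "(\<integral>t. f t * lag n t \<partial>lborel) = (\<integral>t. (\<Sum>k\<le>n. of_real (lag_coeff n k) * (f t * texp k 1 t)) \<partial>lborel)"
      by (simp add: lag_def sum_distrib_left mult.left_commute)
    also have "\<dots> = (\<Sum>k\<le>n. of_real (lag_coeff n k) * (\<integral>t. f t * texp k 1 t \<partial>lborel))"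
      using it by (simp add: Bochner_Integration.integral_sum)
    also have "\<dots> = of_real (lag_coeff n n) * (\<integral>t. f t * texp n 1 t \<partial>lborel)"
      using less by (simp flip: lessThan_Suc_atMost)
    finally show ?case using z[of n] by (simp add: lag_coeff_def)
  qed
qed

section \<open>Plancherel's inequality\<close>

lemma fubini_bounded:
  fixes v :: "real \<Rightarrow> complex" and h :: "real \<Rightarrow> real \<Rightarrow> complex"
  assumes N: "prob_space N" and sN [measurable_cong]: "sets N = sets borel"
    and v: "integrable lborel v" and h [measurable]: "case_prod h \<in> borel_measurable (borel \<Otimes>\<^sub>M borel)"
    and B: "\<And>s y. cmod (h s y) \<le> B"
  shows "(\<integral>y. (\<integral>s. v s * h s y \<partial>lborel) \<partial>N) = (\<integral>s. v s * (\<integral>y. h s y \<partial>N) \<partial>lborel)"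
proof -
  interpret N: prob_space N by (rule N)
  interpret P: pair_sigma_finite lborel N ..
  have [measurable]: "v \<in> borel_measurable borel" using v by auto
  have B0: "0 \<le> B" using order_trans[OF norm_ge_zero B] .
  have ih: "integrable N (h s)" for s
    by (rule N.integrable_const_bound[where B = B]) (use B in auto)
  have "integrable (lborel \<Otimes>\<^sub>M N) (\<lambda>(s, y). v s * h s y)"
  proof (rule P.Fubini_integrable)
    show "integrable lborel (\<lambda>s. \<integral>y. norm (case (s, y) of (s, y) \<Rightarrow> v s * h s y) \<partial>N)"
    proof (rule Bochner_Integration.integrable_bound)
      show "integrable lborel (\<lambda>s. B * cmod (v s))" using v by auto
      show "AE s in lborel. norm (\<integral>y. norm (case (s, y) of (s, y) \<Rightarrow> v s * h s y) \<partial>N) \<le> norm (B * cmod (v s))"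
      proof (rule AE_I2)
        fix s
        have "(\<integral>y. norm (v s * h s y) \<partial>N) \<le> (\<integral>y. cmod (v s) * B \<partial>N)"
          using ih[of s] by (intro integral_mono) (auto simp: norm_mult intro!: mult_left_mono B)
        then show "norm (\<integral>y. norm (case (s, y) of (s, y) \<Rightarrow> v s * h s y) \<partial>N) \<le> norm (B * cmod (v s))"
          using B0 by (simp add: N.prob_space mult.commute)
      qed
    qed measurable
    show "AE s in lborel. integrable N (\<lambda>y. case (s, y) of (s, y) \<Rightarrow> v s * h s y)"
      using ih by (intro AE_I2) auto
  qed measurable
  then have "(\<integral>y. (\<integral>s. v s * h s y \<partial>lborel) \<partial>N) = (\<integral>s. (\<integral>y. v s * h s y \<partial>N) \<partial>lborel)"
    by (rule P.Fubini_integral)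
  then show ?thesis using ih by simp
qed

text \<open>Schur's test for a symmetric positive kernel whose rows have integral 1.\<close>

lemma gaussian_form_bound:
  fixes v :: "real \<Rightarrow> complex"
  assumes v: "integrable lborel v" and v2: "integrable lborel (\<lambda>t. (cmod (v t))\<^sup>2)" and \<sigma>: "0 < \<sigma>"
  shows "cmod (\<integral>s. v s * (\<integral>t. cnj (v t) * of_real (normal_density s \<sigma> t) \<partial>lborel) \<partial>lborel) \<le> (\<integral>t. (cmod (v t))\<^sup>2 \<partial>lborel)"
proof -
  have [measurable]: "v \<in> borel_measurable borel" using v by auto
  let ?k = "\<lambda>s t. normal_density s \<sigma> t"
  have km [measurable]: "(\<lambda>(s, t). ?k s t) \<in> borel_measurable (borel \<Otimes>\<^sub>M borel)"
    unfolding normal_density_def by measurable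
  have ksym: "?k s t = ?k t s" for s t by (simp add: normal_density_def power2_commute)
  have kint: "(\<integral>\<^sup>+t. ennreal (?k s t) \<partial>lborel) = 1" for s
    using \<sigma> integral_normal_density[of \<sigma> s] integrable_normal_density[of \<sigma> s] by (subst nn_integral_eq_integral) auto
  define I where "I = (\<integral>\<^sup>+t. ennreal ((cmod (v t))\<^sup>2) \<partial>lborel)"
  have I: "I = ennreal (\<integral>t. (cmod (v t))\<^sup>2 \<partial>lborel)" unfolding I_def using v2 by (intro nn_integral_eq_integral) auto
  have nb: "ennreal (norm (\<integral>x. g x \<partial>lborel)) \<le> (\<integral>\<^sup>+x. ennreal (norm (g x)) \<partial>lborel)" for g :: "real \<Rightarrow> complex"
    by (cases "integrable lborel g") (auto simp: integral_norm_bound_ennreal not_integrable_integral_eq)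
  have "ennreal (cmod (\<integral>s. v s * (\<integral>t. cnj (v t) * of_real (?k s t) \<partial>lborel) \<partial>lborel))
     \<le> (\<integral>\<^sup>+s. ennreal (cmod (v s * (\<integral>t. cnj (v t) * of_real (?k s t) \<partial>lborel))) \<partial>lborel)" by (rule nb)
  also have "\<dots> \<le> (\<integral>\<^sup>+s. \<integral>\<^sup>+t. ennreal (1 / 2 * (cmod (v s))\<^sup>2 * ?k s t) + ennreal (1 / 2 * (cmod (v t))\<^sup>2 * ?k s t) \<partial>lborel \<partial>lborel)"
  proof (rule nn_integral_mono)
    fix s
    have "ennreal (cmod (v s * (\<integral>t. cnj (v t) * of_real (?k s t) \<partial>lborel)))
       = ennreal (cmod (v s)) * ennreal (cmod (\<integral>t. cnj (v t) * of_real (?k s t) \<partial>lborel))"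
      by (simp add: norm_mult ennreal_mult)
    also have "\<dots> \<le> ennreal (cmod (v s)) * (\<integral>\<^sup>+t. ennreal (cmod (cnj (v t) * of_real (?k s t))) \<partial>lborel)"
      by (intro mult_left_mono nb) simp
    also have "\<dots> = (\<integral>\<^sup>+t. ennreal (cmod (v s)) * ennreal (cmod (cnj (v t) * of_real (?k s t))) \<partial>lborel)"
      by (rule nn_integral_cmult[symmetric]) measurable
    also have "\<dots> \<le> (\<integral>\<^sup>+t. ennreal (1 / 2 * (cmod (v s))\<^sup>2 * ?k s t) + ennreal (1 / 2 * (cmod (v t))\<^sup>2 * ?k s t) \<partial>lborel)"
    proof (rule nn_integral_mono)
      fix t
      have "cmod (v s) * cmod (cnj (v t) * of_real (?k s t)) = cmod (v s) * cmod (v t) * ?k s t"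
        using \<sigma> by (simp add: norm_mult)
      also have "\<dots> \<le> (1 / 2 * (cmod (v s))\<^sup>2 + 1 / 2 * (cmod (v t))\<^sup>2) * ?k s t"
        using sum_squares_bound[of "cmod (v s)" "cmod (v t)"] by (intro mult_right_mono) auto
      finally show "ennreal (cmod (v s)) * ennreal (cmod (cnj (v t) * of_real (?k s t)))
         \<le> ennreal (1 / 2 * (cmod (v s))\<^sup>2 * ?k s t) + ennreal (1 / 2 * (cmod (v t))\<^sup>2 * ?k s t)"
        by (simp add: distrib_right ennreal_leI flip: ennreal_mult ennreal_plus)
    qed
    finally show "ennreal (cmod (v s * (\<integral>t. cnj (v t) * of_real (?k s t) \<partial>lborel)))
      \<le> (\<integral>\<^sup>+t. ennreal (1 / 2 * (cmod (v s))\<^sup>2 * ?k s t) + ennreal (1 / 2 * (cmod (v t))\<^sup>2 * ?k s t) \<partial>lborel)" .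
  qed
  also have "\<dots> = (\<integral>\<^sup>+s. (\<integral>\<^sup>+t. ennreal (1 / 2 * (cmod (v s))\<^sup>2 * ?k s t) \<partial>lborel) + (\<integral>\<^sup>+t. ennreal (1 / 2 * (cmod (v t))\<^sup>2 * ?k s t) \<partial>lborel) \<partial>lborel)"
    by (intro nn_integral_cong nn_integral_add) auto
  also have "\<dots> = (\<integral>\<^sup>+s. \<integral>\<^sup>+t. ennreal (1 / 2 * (cmod (v s))\<^sup>2 * ?k s t) \<partial>lborel \<partial>lborel)
     + (\<integral>\<^sup>+s. \<integral>\<^sup>+t. ennreal (1 / 2 * (cmod (v t))\<^sup>2 * ?k s t) \<partial>lborel \<partial>lborel)"
    by (intro nn_integral_add) measurable
  also have "(\<integral>\<^sup>+s. \<integral>\<^sup>+t. ennreal (1 / 2 * (cmod (v t))\<^sup>2 * ?k s t) \<partial>lborel \<partial>lborel)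
     = (\<integral>\<^sup>+t. \<integral>\<^sup>+s. ennreal (1 / 2 * (cmod (v t))\<^sup>2 * ?k s t) \<partial>lborel \<partial>lborel)"
    by (rule lborel_pair.Fubini') measurable
  also have "\<dots> = (\<integral>\<^sup>+t. \<integral>\<^sup>+s. ennreal (1 / 2 * (cmod (v t))\<^sup>2 * ?k t s) \<partial>lborel \<partial>lborel)"
    by (simp add: ksym)
  also have "(\<integral>\<^sup>+s. \<integral>\<^sup>+t. ennreal (1 / 2 * (cmod (v s))\<^sup>2 * ?k s t) \<partial>lborel \<partial>lborel) = ennreal (1 / 2) * I"
  proof -
    have "(\<integral>\<^sup>+t. ennreal (1 / 2 * (cmod (v s))\<^sup>2 * ?k s t) \<partial>lborel) = ennreal (1 / 2) * ennreal ((cmod (v s))\<^sup>2)" for s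
    proof -
      have "(\<integral>\<^sup>+t. ennreal (1 / 2 * (cmod (v s))\<^sup>2 * ?k s t) \<partial>lborel) = (\<integral>\<^sup>+t. ennreal (1 / 2 * (cmod (v s))\<^sup>2) * ennreal (?k s t) \<partial>lborel)"
        by (intro nn_integral_cong ennreal_mult) auto
      also have "\<dots> = ennreal (1 / 2 * (cmod (v s))\<^sup>2) * 1"
        by (subst nn_integral_cmult) (auto simp: kint)
      also have "\<dots> = ennreal (1 / 2) * ennreal ((cmod (v s))\<^sup>2)" by (simp only: mult_1_right) (rule ennreal_mult, auto)
      finally show ?thesis .
    qed
    then show ?thesis by (simp add: I_def nn_integral_cmult)
  qed
  also have "ennreal (1 / 2) * I + ennreal (1 / 2) * I = I"
  proof -
    have "ennreal (1 / 2) * I + ennreal (1 / 2) * I = (ennreal (1 / 2) + ennreal (1 / 2)) * I" by (simp only: distrib_right)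
    also have "ennreal (1 / 2) + ennreal (1 / 2) = ennreal (1 / 2 + 1 / 2)" by (rule ennreal_plus[symmetric]) auto
    also have "\<dots> = 1" by simp
    finally show ?thesis by simp
  qed
  finally show ?thesis unfolding I by simp
qed

text \<open>Damping \<open>|F|\<^sup>2\<close> by a Gaussian of width \<open>c\<close> turns its integral into the quadratic form of
  \<open>gaussian_form_bound\<close> with deviation \<open>1 / c\<close>, because the Gaussian is its own Fourier transform. The
  bound does not depend on \<open>c\<close>, and Fatou's lemma removes the damping.\<close>

lemma plancherel_bound:
  assumes v: "integrable lborel v" and v2: "integrable lborel (\<lambda>t. (cmod (v t))\<^sup>2)"
  shows "(\<integral>\<^sup>+y. ennreal ((cmod (\<integral>t. v t * iexp (- y * t) \<partial>lborel))\<^sup>2) \<partial>lborel) \<le> ennreal (2 * pi * (\<integral>t. (cmod (v t))\<^sup>2 \<partial>lborel))"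
proof -
  have [measurable]: "v \<in> borel_measurable borel" using v by auto
  define F where "F = (\<lambda>y. \<integral>t. v t * iexp (- y * t) \<partial>lborel)"
  have [measurable]: "F \<in> borel_measurable borel" unfolding F_def by measurable
  define B where "B = (\<integral>t. cmod (v t) \<partial>lborel)"
  have FB: "cmod (F y) \<le> B" for y
  proof -
    have "cmod (F y) \<le> (\<integral>t. cmod (v t * iexp (- y * t)) \<partial>lborel)" unfolding F_def by (rule integral_norm_bound)
    also have "\<dots> = B" by (simp add: B_def norm_mult)
    finally show ?thesis .
  qed
  define A where "A = (\<integral>t. (cmod (v t))\<^sup>2 \<partial>lborel)"
  have prob_space_std_normal_distribution: "prob_space std_normal_distribution"
    by (rule prob_space_normal_density) simp
  interpret N: prob_space std_normal_distribution by (rule prob_space_std_normal_distribution)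
  have key: "(\<integral>\<^sup>+y. ennreal ((cmod (F y))\<^sup>2) * ennreal (exp (- (y / c)\<^sup>2 / 2)) \<partial>lborel) \<le> ennreal (2 * pi * A)" if c: "0 < c" for c
  proof -
    define E where "E = (\<integral>y. (cmod (F (c * y)))\<^sup>2 \<partial>std_normal_distribution)"
    have iE: "integrable std_normal_distribution (\<lambda>y. (cmod (F (c * y)))\<^sup>2)"
      by (rule N.integrable_const_bound[where B = "B\<^sup>2"]) (auto intro!: power_mono FB)
    have cnjF: "cnj (F y) = (\<integral>t. cnj (v t) * iexp (y * t) \<partial>lborel)" for y
      unfolding F_def Bochner_Integration.integral_cnj[symmetric] by (simp add: exp_cnj)
    have inner: "(\<integral>y. cnj (F (c * y)) * iexp (- (c * y) * s) \<partial>std_normal_distribution)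
       = (\<integral>t. cnj (v t) * of_real (sqrt (2 * pi) / c * normal_density s (1 / c) t) \<partial>lborel)" for s
    proof -
      have "(\<integral>y. cnj (F (c * y)) * iexp (- (c * y) * s) \<partial>std_normal_distribution)
         = (\<integral>y. (\<integral>t. cnj (v t) * (iexp (c * y * t) * iexp (- (c * y) * s)) \<partial>lborel) \<partial>std_normal_distribution)"
        unfolding cnjF by (simp add: mult.assoc flip: integral_mult_left_zero)
      also have "\<dots> = (\<integral>t. cnj (v t) * (\<integral>y. iexp (c * y * t) * iexp (- (c * y) * s) \<partial>std_normal_distribution) \<partial>lborel)"
        by (rule fubini_bounded[where B = 1]) (use v in \<open>auto simp: norm_mult prob_space_std_normal_distribution\<close>)
      finally have swap: "(\<integral>y. cnj (F (c * y)) * iexp (- (c * y) * s) \<partial>std_normal_distribution)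
         = (\<integral>t. cnj (v t) * (\<integral>y. iexp (c * y * t) * iexp (- (c * y) * s) \<partial>std_normal_distribution) \<partial>lborel)" .
      have "(\<integral>y. iexp (c * y * t) * iexp (- (c * y) * s) \<partial>std_normal_distribution) = of_real (sqrt (2 * pi) / c * normal_density s (1 / c) t)" for t
      proof -
        have "(\<integral>y. iexp (c * y * t) * iexp (- (c * y) * s) \<partial>std_normal_distribution) = char std_normal_distribution (c * (t - s))"
          unfolding char_def by (intro Bochner_Integration.integral_cong refl) (simp add: algebra_simps flip: exp_add)
        also have "\<dots> = of_real (exp (- (c * (t - s))\<^sup>2 / 2))" by (simp add: char_std_normal_distribution)
        also have "exp (- (c * (t - s))\<^sup>2 / 2) = sqrt (2 * pi) / c * normal_density s (1 / c) t"
        proof -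
          have "sqrt (2 * pi * (1 / c)\<^sup>2) = sqrt (2 * pi) / c" using c by (simp add: real_sqrt_mult real_sqrt_divide power_divide)
          moreover have "- (t - s)\<^sup>2 / (2 * (1 / c)\<^sup>2) = - (c * (t - s))\<^sup>2 / 2" unfolding power_mult_distrib power_divide using c by simp
          ultimately show ?thesis using c by (simp add: normal_density_def)
        qed
        finally show ?thesis .
      qed
      then show ?thesis unfolding swap by (simp only:)
    qed
    have "complex_of_real E = (\<integral>y. of_real ((cmod (F (c * y)))\<^sup>2) \<partial>std_normal_distribution)"
      unfolding E_def by (rule integral_complex_of_real[symmetric])
    also have "\<dots> = (\<integral>y. (\<integral>s. v s * (cnj (F (c * y)) * iexp (- (c * y) * s)) \<partial>lborel) \<partial>std_normal_distribution)"
    proof (intro Bochner_Integration.integral_cong refl)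
      fix y
      have "complex_of_real ((cmod (F (c * y)))\<^sup>2) = (\<integral>s. v s * iexp (- (c * y) * s) \<partial>lborel) * cnj (F (c * y))"
        unfolding complex_norm_square by (simp add: F_def)
      also have "\<dots> = (\<integral>s. v s * (cnj (F (c * y)) * iexp (- (c * y) * s)) \<partial>lborel)"
        unfolding integral_mult_left_zero[symmetric] by (simp only: mult_ac)
      finally show "complex_of_real ((cmod (F (c * y)))\<^sup>2) = (\<integral>s. v s * (cnj (F (c * y)) * iexp (- (c * y) * s)) \<partial>lborel)" .
    qed
    also have "\<dots> = (\<integral>s. v s * (\<integral>y. cnj (F (c * y)) * iexp (- (c * y) * s) \<partial>std_normal_distribution) \<partial>lborel)"
      by (rule fubini_bounded[where B = B]) (use v FB in \<open>auto simp: norm_mult prob_space_std_normal_distribution\<close>)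
    also have "\<dots> = (\<integral>s. v s * (\<integral>t. cnj (v t) * of_real (sqrt (2 * pi) / c * normal_density s (1 / c) t) \<partial>lborel) \<partial>lborel)"
      unfolding inner ..
    also have "\<dots> = of_real (sqrt (2 * pi) / c) * (\<integral>s. v s * (\<integral>t. cnj (v t) * of_real (normal_density s (1 / c) t) \<partial>lborel) \<partial>lborel)"
      unfolding of_real_mult by (simp only: mult.left_commute[of _ "of_real (sqrt (2 * pi) / c)"] integral_mult_right_zero)
    finally have "cmod (of_real E) = sqrt (2 * pi) / c * cmod (\<integral>s. v s * (\<integral>t. cnj (v t) * of_real (normal_density s (1 / c) t) \<partial>lborel) \<partial>lborel)"
      using c by (simp only: norm_mult norm_of_real) simp
    also have "\<dots> \<le> sqrt (2 * pi) / c * A"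
      unfolding A_def using c by (intro mult_left_mono gaussian_form_bound v v2) auto
    finally have E: "E \<le> sqrt (2 * pi) / c * A" by simp
    have "(\<integral>\<^sup>+y. ennreal ((cmod (F y))\<^sup>2) * ennreal (exp (- (y / c)\<^sup>2 / 2)) \<partial>lborel)
       = ennreal \<bar>c\<bar> * (\<integral>\<^sup>+y. ennreal ((cmod (F (0 + c * y)))\<^sup>2) * ennreal (exp (- ((0 + c * y) / c)\<^sup>2 / 2)) \<partial>lborel)"
      using c by (intro nn_integral_real_affine) auto
    also have "(\<integral>\<^sup>+y. ennreal ((cmod (F (0 + c * y)))\<^sup>2) * ennreal (exp (- ((0 + c * y) / c)\<^sup>2 / 2)) \<partial>lborel)
       = (\<integral>\<^sup>+y. ennreal (sqrt (2 * pi)) * (ennreal (std_normal_density y) * ennreal ((cmod (F (c * y)))\<^sup>2)) \<partial>lborel)"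
      using c by (intro nn_integral_cong) (simp add: std_normal_density_def mult_ac flip: ennreal_mult)
    also have "\<dots> = ennreal (sqrt (2 * pi)) * (\<integral>\<^sup>+y. ennreal (std_normal_density y) * ennreal ((cmod (F (c * y)))\<^sup>2) \<partial>lborel)"
      by (rule nn_integral_cmult) measurable
    also have "(\<integral>\<^sup>+y. ennreal (std_normal_density y) * ennreal ((cmod (F (c * y)))\<^sup>2) \<partial>lborel)
       = (\<integral>\<^sup>+y. ennreal ((cmod (F (c * y)))\<^sup>2) \<partial>std_normal_distribution)"
      by (subst nn_integral_density) auto
    also have "\<dots> = ennreal E" unfolding E_def by (rule nn_integral_eq_integral[OF iE]) simp
    also have "ennreal \<bar>c\<bar> * (ennreal (sqrt (2 * pi)) * ennreal E) = ennreal (c * (sqrt (2 * pi) * E))"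
      using c by (simp add: E_def flip: ennreal_mult)
    also have "\<dots> \<le> ennreal (2 * pi * A)"
    proof (rule ennreal_leI)
      have "c * (sqrt (2 * pi) * E) \<le> c * (sqrt (2 * pi) * (sqrt (2 * pi) / c * A))"
        using c by (intro mult_left_mono E) auto
      also have "\<dots> = sqrt (2 * pi) * sqrt (2 * pi) * A" using c by simp
      also have "sqrt (2 * pi) * sqrt (2 * pi) = 2 * pi" by (rule real_sqrt_mult_self[THEN trans]) simp
      finally show "c * (sqrt (2 * pi) * E) \<le> 2 * pi * A" .
    qed
    finally show ?thesis .
  qed
  have "(\<integral>\<^sup>+y. ennreal ((cmod (F y))\<^sup>2) \<partial>lborel) \<le> (\<integral>\<^sup>+y. liminf (\<lambda>n. ennreal ((cmod (F y))\<^sup>2) * ennreal (exp (- (y / real (Suc n))\<^sup>2 / 2))) \<partial>lborel)"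
  proof (rule nn_integral_mono)
    fix y
    have "(\<lambda>n. (cmod (F y))\<^sup>2 * exp (- (y * (1 / real (Suc n)))\<^sup>2 / 2)) \<longlonglongrightarrow> (cmod (F y))\<^sup>2 * exp (- (y * 0)\<^sup>2 / 2)"
      by (intro tendsto_intros LIMSEQ_Suc[OF lim_const_over_n]) auto
    then have "(\<lambda>n. ennreal ((cmod (F y))\<^sup>2 * exp (- (y * (1 / real (Suc n)))\<^sup>2 / 2))) \<longlonglongrightarrow> ennreal ((cmod (F y))\<^sup>2)"
      using tendsto_ennrealI by fastforce
    then have "(\<lambda>n. ennreal ((cmod (F y))\<^sup>2) * ennreal (exp (- (y / real (Suc n))\<^sup>2 / 2))) \<longlonglongrightarrow> ennreal ((cmod (F y))\<^sup>2)"
      by (simp add: ennreal_mult)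
    then show "ennreal ((cmod (F y))\<^sup>2) \<le> liminf (\<lambda>n. ennreal ((cmod (F y))\<^sup>2) * ennreal (exp (- (y / real (Suc n))\<^sup>2 / 2)))"
      by (subst lim_imp_Liminf) auto
  qed
  also have "\<dots> \<le> liminf (\<lambda>n. \<integral>\<^sup>+y. ennreal ((cmod (F y))\<^sup>2) * ennreal (exp (- (y / real (Suc n))\<^sup>2 / 2)) \<partial>lborel)"
    by (rule nn_integral_liminf) measurable
  also have "\<dots> \<le> liminf (\<lambda>n. ennreal (2 * pi * A))"
    by (intro Liminf_mono always_eventually allI key) simp
  also have "\<dots> = ennreal (2 * pi * A)" by (simp add: Liminf_const)
  finally show ?thesis by (simp add: F_def A_def)
qed

theorem hardy_halfplane_fourier_laplace: "fourier_laplace u \<in> hardy_halfplane"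
proof -
  obtain f where f: "l2_half f" and u: "u = abs_L2 f" using L2_cases by blast
  define A where "A = (\<integral>t. (cmod (f t))\<^sup>2 \<partial>lborel)"
  have fl: "fourier_laplace u = (\<lambda>z. 1 / of_real (sqrt (2 * pi)) * laplace f z)"
    using fourier_laplace_abs[OF f] by (auto simp: u)
  have hol: "fourier_laplace u holomorphic_on {z. 0 < Re z}"
    unfolding fl by (intro holomorphic_intros holomorphic_laplace f)
  have bound: "(\<integral>\<^sup>+y. ennreal ((cmod (fourier_laplace u (Complex x y)))\<^sup>2) \<partial>lborel) \<le> ennreal A" if x: "0 < x" for x
  proof -
    define v where "v = (\<lambda>t. f t * texp 0 (of_real x) t)"
    have xR: "0 < Re (of_real x)" using x by simp
    have vm: "v \<in> borel_measurable borel"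
      unfolding v_def using l2_halfD(1)[OF f] l2_halfD(1)[OF l2_half_texp[OF xR]] by measurable
    have v: "integrable lborel v" unfolding v_def by (rule integrable_texp[OF f xR])
    have vf: "(cmod (v t))\<^sup>2 \<le> (cmod (f t))\<^sup>2" for t
    proof -
      have "cmod (texp 0 (of_real x) t) \<le> 1" using x by (auto simp: texp_def indicator_def)
      then have "cmod (v t) \<le> cmod (f t)" unfolding v_def norm_mult by (intro mult_left_le) auto
      then show ?thesis by (intro power_mono) auto
    qed
    have v2: "integrable lborel (\<lambda>t. (cmod (v t))\<^sup>2)"
      by (rule Bochner_Integration.integrable_bound[OF l2_halfD(3)[OF f]]) (use vm vf in auto)
    have vA: "(\<integral>t. (cmod (v t))\<^sup>2 \<partial>lborel) \<le> A" unfolding A_def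
      by (intro integral_mono v2 l2_halfD(3)[OF f] vf)
    have lap: "laplace f (Complex x y) = (\<integral>t. v t * iexp (- y * t) \<partial>lborel)" for y
      unfolding laplace_texp[OF f]
    proof (intro Bochner_Integration.integral_cong refl)
      fix t
      have "- Complex x y * of_real t = - of_real x * of_real t + \<i> * of_real (- y * t)" by (simp add: complex_eq_iff)
      then show "f t * texp 0 (Complex x y) t = v t * iexp (- y * t)"
        unfolding v_def texp_def by (simp only: exp_add) simp
    qed
    have "(\<integral>\<^sup>+y. ennreal ((cmod (fourier_laplace u (Complex x y)))\<^sup>2) \<partial>lborel)
       = (\<integral>\<^sup>+y. ennreal (1 / (2 * pi)) * ennreal ((cmod (\<integral>t. v t * iexp (- y * t) \<partial>lborel))\<^sup>2) \<partial>lborel)"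
    proof (intro nn_integral_cong)
      fix y
      have "(cmod (fourier_laplace u (Complex x y)))\<^sup>2 = 1 / (2 * pi) * (cmod (\<integral>t. v t * iexp (- y * t) \<partial>lborel))\<^sup>2"
        unfolding fl lap by (simp add: norm_mult norm_divide power_mult_distrib power_divide)
      then show "ennreal ((cmod (fourier_laplace u (Complex x y)))\<^sup>2) = ennreal (1 / (2 * pi)) * ennreal ((cmod (\<integral>t. v t * iexp (- y * t) \<partial>lborel))\<^sup>2)"
        by (simp only:) (rule ennreal_mult, auto)
    qed
    also have "\<dots> = ennreal (1 / (2 * pi)) * (\<integral>\<^sup>+y. ennreal ((cmod (\<integral>t. v t * iexp (- y * t) \<partial>lborel))\<^sup>2) \<partial>lborel)"
    proof (rule nn_integral_cmult)
      note [measurable] = vm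
      show "(\<lambda>y. ennreal ((cmod (\<integral>t. v t * iexp (- y * t) \<partial>lborel))\<^sup>2)) \<in> borel_measurable lborel" by measurable
    qed
    also have "\<dots> \<le> ennreal (1 / (2 * pi)) * ennreal (2 * pi * (\<integral>t. (cmod (v t))\<^sup>2 \<partial>lborel))"
      by (intro mult_left_mono plancherel_bound v v2) simp
    also have "\<dots> = ennreal (\<integral>t. (cmod (v t))\<^sup>2 \<partial>lborel)" by (simp flip: ennreal_mult)
    also have "\<dots> \<le> ennreal A" by (intro ennreal_leI vA)
    finally show ?thesis .
  qed
  have "(SUP x\<in>{0<..}. \<integral>\<^sup>+y. ennreal ((cmod (fourier_laplace u (Complex x y)))\<^sup>2) \<partial>lborel) \<le> ennreal A"
    by (rule SUP_least) (auto intro: bound)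
  then show ?thesis unfolding hardy_halfplane_def using hol by (auto intro: le_less_trans)
qed

section \<open>From the half line to the Hardy space of the disk\<close>

definition disk_transform :: "L2 \<Rightarrow> complex \<Rightarrow> complex" where
  "disk_transform u z = 2 * of_real (sqrt pi) / (1 + z) * fourier_laplace u ((1 - z) / (1 + z))"

lemma minimum_phase_iff: "minimum_phase u \<longleftrightarrow> outer_disk (disk_transform u)"
  unfolding minimum_phase_def outer_halfplane_def disk_transform_def[abs_def]
  by (simp add: hardy_halfplane_fourier_laplace)

lemma cayley_Re:
  assumes "z \<in> ball 0 1"
  shows "0 < Re ((1 - z) / (1 + z))" "1 + z \<noteq> 0"
proof -
  show nz: "1 + z \<noteq> 0" using assms by (auto simp: add_eq_0_iff)
  have "(1 - z) / (1 + z) = (1 - z) * cnj (1 + z) / of_real ((cmod (1 + z))\<^sup>2)"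
    unfolding complex_div_cnj[of "1 - z"] by simp
  then have "Re ((1 - z) / (1 + z)) = Re ((1 - z) * cnj (1 + z)) / (cmod (1 + z))\<^sup>2"
    by (simp only: Re_divide_of_real)
  also have "Re ((1 - z) * cnj (1 + z)) = 1 - (cmod z)\<^sup>2"
    by (simp add: cmod_def algebra_simps power2_eq_square)
  finally show "0 < Re ((1 - z) / (1 + z))" using nz assms by (simp add: abs_square_less_1)
qed

lemma cayley_inverse:
  assumes w: "0 < Re w"
  shows "(1 - w) / (1 + w) \<in> ball 0 1" "(1 - (1 - w) / (1 + w)) / (1 + (1 - w) / (1 + w)) = w"
proof -
  have nz: "1 + w \<noteq> 0" using w by (auto simp: complex_eq_iff)
  have "(cmod (1 - w))\<^sup>2 < (cmod (1 + w))\<^sup>2"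
    using w by (simp add: cmod_power2) (simp add: power2_eq_square algebra_simps)
  then have "cmod (1 - w) < cmod (1 + w)" by (rule power2_less_imp_less) simp
  then show "(1 - w) / (1 + w) \<in> ball 0 1" using nz by (simp add: norm_divide)
  have "1 - (1 - w) / (1 + w) = 2 * w / (1 + w)" "1 + (1 - w) / (1 + w) = 2 / (1 + w)"
    using nz by (simp_all add: field_simps)
  then show "(1 - (1 - w) / (1 + w)) / (1 + (1 - w) / (1 + w)) = w" using nz by simp
qed

lemma disk_transform_abs:
  assumes "l2_half f"
  shows "disk_transform (abs_L2 f) z = of_real (sqrt 2) / (1 + z) * laplace f ((1 - z) / (1 + z))"
proof -
  have "complex_of_real (2 * sqrt pi / sqrt (2 * pi)) = of_real (sqrt 2)"
  proof -
    have "2 * sqrt pi / sqrt (2 * pi) = 2 / sqrt 2" by (simp add: real_sqrt_mult)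
    also have "\<dots> = sqrt 2" by (rule real_div_sqrt) simp
    finally show ?thesis by simp
  qed
  then have "of_real (sqrt 2) / (1 + z) * laplace f ((1 - z) / (1 + z))
     = of_real (2 * sqrt pi / sqrt (2 * pi)) / (1 + z) * laplace f ((1 - z) / (1 + z))" by simp
  then show ?thesis unfolding disk_transform_def fourier_laplace_abs[OF assms] by simp
qed

lemma disk_transform_lag:
  assumes z: "z \<in> ball 0 1"
  shows "of_real (sqrt 2) / (1 + z) * laplace (lag n) ((1 - z) / (1 + z)) = z ^ n"
proof -
  note nz = cayley_Re(2)[OF z]
  have e: "1 - (1 - z) / (1 + z) = 2 * z / (1 + z)" "1 + (1 - z) / (1 + z) = 2 / (1 + z)"
    using nz by (simp_all add: field_simps)
  have s2: "complex_of_real (sqrt 2) * of_real (sqrt 2) = 2"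
    by (simp flip: of_real_mult)
  have "of_real (sqrt 2) / (1 + z) * laplace (lag n) ((1 - z) / (1 + z))
     = (complex_of_real (sqrt 2) * of_real (sqrt 2)) / (1 + z) * (2 * z / (1 + z)) ^ n / (2 / (1 + z)) ^ Suc n"
    unfolding laplace_lag[OF cayley_Re(1)[OF z]] e by simp
  also have "\<dots> = (2 / (1 + z)) / (2 / (1 + z)) * ((2 * z / (1 + z)) / (2 / (1 + z))) ^ n"
    unfolding s2 by (simp add: power_divide)
  also have "\<dots> = z ^ n" using nz by simp
  finally show ?thesis .
qed

text \<open>The transform at a point \<open>z\<close> integrates against a square-integrable exponential, so it commutes with the
  limit in the Riesz-Fischer theorem.\<close>

lemma synthesis:
  assumes c: "summable (\<lambda>n. (cmod (c n))\<^sup>2)"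
  obtains v where "l2_half v" "\<And>n. (\<integral>t. v t * lag n t \<partial>lborel) = c n"
    "\<And>z. z \<in> ball 0 1 \<Longrightarrow> (\<lambda>n. c n * z ^ n) sums disk_transform (abs_L2 v) z"
proof -
  obtain v N where v: "v \<in> borel_measurable lborel" "integrable lborel (\<lambda>x. (cmod (v x))\<^sup>2)" and N: "strict_mono (N :: nat \<Rightarrow> nat)"
    and lim: "\<And>g. g \<in> borel_measurable lborel \<Longrightarrow> integrable lborel (\<lambda>x. (cmod (g x))\<^sup>2) \<Longrightarrow>
       (\<lambda>k. \<integral>x. (\<Sum>n<N k. c n * lag n x) * g x \<partial>lborel) \<longlonglongrightarrow> (\<integral>x. v x * g x \<partial>lborel)"
    and z0: "\<And>x. (\<And>n. lag n x = 0) \<Longrightarrow> v x = 0"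
    by (rule lag.riesz_fischer[OF c]) blast
  have vl: "l2_half v"
    using v z0 by (auto simp: l2_half_def lag_def texp_def)
  have s: "(\<integral>x. (\<Sum>n<N k. c n * lag n x) * g x \<partial>lborel) = (\<Sum>n<N k. c n * (\<integral>x. lag n x * g x \<partial>lborel))" 
    if "\<And>n. integrable lborel (\<lambda>x. lag n x * g x)" for g k
  proof -
    have "(\<integral>x. (\<Sum>n<N k. c n * lag n x) * g x \<partial>lborel) = (\<integral>x. (\<Sum>n<N k. c n * (lag n x * g x)) \<partial>lborel)"
      by (simp add: sum_distrib_right mult.assoc)
    also have "\<dots> = (\<Sum>n<N k. c n * (\<integral>x. lag n x * g x \<partial>lborel))"
      using that by (subst Bochner_Integration.integral_sum) auto
    finally show ?thesis .
  qed
  have "(\<integral>t. v t * lag m t \<partial>lborel) = c m" for m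
  proof (rule LIMSEQ_unique[OF lim])
    show "(\<lambda>k. \<integral>x. (\<Sum>n<N k. c n * lag n x) * lag m x \<partial>lborel) \<longlonglongrightarrow> c m"
    proof (rule tendsto_eventually)
      show "\<forall>\<^sub>F k in sequentially. (\<integral>x. (\<Sum>n<N k. c n * lag n x) * lag m x \<partial>lborel) = c m"
        using eventually_gt_at_top[of m]
      proof eventually_elim
        case (elim k)
        then have "m < N k" using seq_suble[OF N, of k] by simp
        then show ?case
          unfolding s[OF integrable_lag_mult] lag_orthonormal by (simp add: if_distrib cong: if_cong)
      qed
    qed
  qed (use l2_halfD(3)[OF l2_half_lag] in auto)
  moreover have "(\<lambda>n. c n * z ^ n) sums disk_transform (abs_L2 v) z" if z: "z \<in> ball 0 1" for z
  proof -
    let ?w = "(1 - z) / (1 + z)"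
    note w = cayley_Re(1)[OF z]
    have tl: "l2_half (texp 0 ?w)" by (rule l2_half_texp[OF w])
    have "(\<lambda>k. \<integral>x. (\<Sum>n<N k. c n * lag n x) * texp 0 ?w x \<partial>lborel) \<longlonglongrightarrow> (\<integral>x. v x * texp 0 ?w x \<partial>lborel)"
      using l2_halfD(1,3)[OF tl] by (intro lim) auto
    then have "(\<lambda>k. \<Sum>n<N k. c n * laplace (lag n) ?w) \<longlonglongrightarrow> laplace v ?w"
      using s[OF integrable_texp[OF l2_half_lag w]] by (simp add: laplace_texp vl l2_half_lag)
    then have "(\<lambda>k. of_real (sqrt 2) / (1 + z) * (\<Sum>n<N k. c n * laplace (lag n) ?w)) \<longlonglongrightarrow> of_real (sqrt 2) / (1 + z) * laplace v ?w"
      by (rule tendsto_mult_left)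
    moreover have "of_real (sqrt 2) / (1 + z) * (\<Sum>n<N k. c n * laplace (lag n) ?w) = (\<Sum>n<N k. c n * z ^ n)" for k
      unfolding disk_transform_lag[OF z, symmetric] sum_distrib_left by (simp add: mult_ac)
    ultimately have 1: "(\<lambda>k. \<Sum>n<N k. c n * z ^ n) \<longlonglongrightarrow> disk_transform (abs_L2 v) z"
      by (simp add: disk_transform_abs[OF vl])
    have "summable (\<lambda>n. c n * z ^ n)"
    proof (rule summable_comparison_test)
      have "summable (\<lambda>n. ((cmod z)\<^sup>2) ^ n)" using z by (intro summable_geometric) (simp add: abs_square_less_1)
      then show "summable (\<lambda>n. (cmod (c n))\<^sup>2 + ((cmod z)\<^sup>2) ^ n)" by (intro summable_add c)
      have "norm (c n * z ^ n) \<le> (cmod (c n))\<^sup>2 + ((cmod z)\<^sup>2) ^ n" for n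
      proof -
        have "2 * (cmod (c n) * cmod z ^ n) \<le> (cmod (c n))\<^sup>2 + (cmod z ^ n)\<^sup>2"
          using sum_squares_bound[of "cmod (c n)" "cmod z ^ n"] by (simp add: mult.assoc)
        moreover have "0 \<le> cmod (c n) * cmod z ^ n" by simp
        moreover have "(cmod z ^ n)\<^sup>2 = ((cmod z)\<^sup>2) ^ n" by (simp add: mult.commute flip: power_mult)
        ultimately show ?thesis unfolding norm_mult norm_power by linarith
      qed
      then show "\<exists>N. \<forall>n\<ge>N. norm (c n * z ^ n) \<le> (cmod (c n))\<^sup>2 + ((cmod z)\<^sup>2) ^ n" by blast
    qed
    then have 2: "(\<lambda>k. \<Sum>n<k. c n * z ^ n) \<longlonglongrightarrow> (\<Sum>n. c n * z ^ n)" by (rule summable_LIMSEQ)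
    from LIMSEQ_subseq_LIMSEQ[OF this N] have "(\<lambda>k. \<Sum>n<N k. c n * z ^ n) \<longlonglongrightarrow> (\<Sum>n. c n * z ^ n)" by (simp add: o_def)
    with 1 have "disk_transform (abs_L2 v) z = (\<Sum>n. c n * z ^ n)" by (rule LIMSEQ_unique)
    with 2 show ?thesis by (simp add: sums_def)
  qed
  ultimately show thesis using that vl by blast
qed

theorem disk_transform_surj:
  assumes "h \<in> hardy_disk"
  obtains u where "\<And>z. z \<in> ball 0 1 \<Longrightarrow> disk_transform u z = h z"
proof -
  obtain c where s: "\<And>z. z \<in> ball 0 1 \<Longrightarrow> (\<lambda>n. c n * z ^ n) sums h z" and c: "summable (\<lambda>n. (cmod (c n))\<^sup>2)"
    using hardy_disk_seriesE[OF assms] by blast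
  obtain v where "l2_half v" "\<And>n. (\<integral>t. v t * lag n t \<partial>lborel) = c n"
    and v: "\<And>z. z \<in> ball 0 1 \<Longrightarrow> (\<lambda>n. c n * z ^ n) sums disk_transform (abs_L2 v) z"
    using synthesis[OF c] by blast
  show thesis
    by (rule that[of "abs_L2 v"]) (rule sums_unique2[OF v s])
qed

lemma l2_half_diff:
  assumes "l2_half f" "l2_half g"
  shows "l2_half (\<lambda>t. f t + (- 1) * g t)"
  by (intro l2_half_add l2_half_cmult assms)

text \<open>By completeness of the Laguerre functions, \<open>u\<close> is the element synthesised from its own Laguerre
  coefficients.\<close>

theorem disk_transform_hardy: "disk_transform u \<in> hardy_disk"
proof -
  obtain f where f: "l2_half f" and u: "u = abs_L2 f" using L2_cases by blast
  define c where "c = (\<lambda>n. \<integral>t. f t * lag n t \<partial>lborel)"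
  have "(\<Sum>n<N. (cmod (c n))\<^sup>2) \<le> (\<integral>t. (cmod (f t))\<^sup>2 \<partial>lborel)" for N
    using bessel_inequality[of f lborel lag N] l2_halfD(1,3)[OF f] lag.e2 lag.orth by (simp add: cnj_lag c_def)
  then have c: "summable (\<lambda>n. (cmod (c n))\<^sup>2)"
    by (intro bounded_imp_summable[where B = "\<integral>t. (cmod (f t))\<^sup>2 \<partial>lborel"]) (auto simp only: lessThan_Suc_atMost[symmetric] zero_le_power2)
  obtain v where v: "l2_half v" "\<And>n. (\<integral>t. v t * lag n t \<partial>lborel) = c n"
    "\<And>z. z \<in> ball 0 1 \<Longrightarrow> (\<lambda>n. c n * z ^ n) sums disk_transform (abs_L2 v) z"
    using synthesis[OF c] by blast
  have i: "integrable lborel (\<lambda>t. g t * lag n t)" if "l2_half g" for g n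
    using l2_halfD(1,3)[OF that] l2_halfD(1,3)[OF l2_half_lag[of n]] by (intro integrable_mult_L2) auto
  have "AE t in lborel. f t + (- 1) * v t = 0"
  proof (rule lag_complete[OF l2_half_diff[OF f v(1)]])
    fix n
    have "(\<integral>t. (f t + (- 1) * v t) * lag n t \<partial>lborel) = (\<integral>t. f t * lag n t - v t * lag n t \<partial>lborel)"
      by (simp add: left_diff_distrib)
    also have "\<dots> = 0" using i[OF f] i[OF v(1)] v(2)[of n] by (simp add: c_def)
    finally show "(\<integral>t. (f t + (- 1) * v t) * lag n t \<partial>lborel) = 0" .
  qed
  then have "u = abs_L2 v"
    unfolding u abs_L2_eq_iff[OF f v(1)] by eventually_elim simp
  then show ?thesis using hardy_disk_seriesI[OF v(3) c] by simp
qed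

theorem disk_transform_inj:
  assumes eq: "\<And>z. z \<in> ball 0 1 \<Longrightarrow> disk_transform u z = disk_transform v z"
  shows "u = v"
proof -
  obtain f where f: "l2_half f" and u: "u = abs_L2 f" using L2_cases by blast
  obtain g where g: "l2_half g" and v: "v = abs_L2 g" using L2_cases by blast
  have "AE t in lborel. f t + (- 1) * g t = 0"
  proof (rule laplace_unique[OF l2_half_diff[OF f g]])
    fix w :: complex assume w: "0 < Re w"
    have "laplace f w = laplace g w"
      using eq[OF cayley_inverse(1)[OF w]] cayley_Re(2)[OF cayley_inverse(1)[OF w]]
      unfolding u v disk_transform_abs[OF f] disk_transform_abs[OF g] cayley_inverse(2)[OF w] by simp
    then show "laplace (\<lambda>t. f t + (- 1) * g t) w = 0"
      unfolding laplace_add[OF f l2_half_cmult[OF g] w] laplace_cmult by simp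
  qed
  then show ?thesis unfolding u v abs_L2_eq_iff[OF f g] by eventually_elim simp
qed

lemma L2_rel_refl: "l2_half f \<Longrightarrow> L2_rel f f"
  using L2_rel_l2_half by auto

lemma disk_transform_add:
  assumes z: "z \<in> ball 0 1"
  shows "disk_transform (u + v) z = disk_transform u z + disk_transform v z"
proof -
  obtain f where f: "l2_half f" and u: "u = abs_L2 f" using L2_cases by blast
  obtain g where g: "l2_half g" and v: "v = abs_L2 g" using L2_cases by blast
  have "u + v = abs_L2 (\<lambda>t. f t + g t)"
    unfolding u v by (rule plus_L2.abs_eq[OF L2_rel_refl[OF f] L2_rel_refl[OF g]])
  then show ?thesis
    unfolding u v by (simp add: disk_transform_abs f g l2_half_add laplace_add[OF f g cayley_Re(1)[OF z]] distrib_left)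
qed

lemma disk_transform_scale: "disk_transform (scale_L2 c u) z = c * disk_transform u z"
proof -
  obtain f where f: "l2_half f" and u: "u = abs_L2 f" using L2_cases by blast
  have "scale_L2 c u = abs_L2 (\<lambda>t. c * f t)"
    unfolding u by (rule scale_L2.abs_eq[OF L2_rel_refl[OF f]])
  then show ?thesis
    unfolding u by (simp add: disk_transform_abs f l2_half_cmult laplace_cmult)
qed

section \<open>Minimum phase preserving operators\<close>

text \<open>The operator is a weighted composition operator. To see this, transport the functional
  \<open>u \<mapsto> disk_transform (A u) a\<close> to the Hardy space: outer functions come from minimum phase elements, and
  the images of these have outer transforms, which do not vanish at \<open>a\<close>.\<close>

theorem minimum_phase_preserving_pointwise:
  assumes A: "minimum_phase_preserving A" and a: "a \<in> ball 0 1"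
  obtains c w where "w \<in> ball 0 1" "c \<noteq> 0" "\<And>u. disk_transform (A u) a = c * disk_transform u w"
proof -
  have lin: "Vector_Spaces.linear scale_L2 scale_L2 A" and mp: "\<And>f. minimum_phase f \<Longrightarrow> minimum_phase (A f)"
    using A by (auto simp: minimum_phase_preserving_def)
  interpret A: Vector_Spaces.linear scale_L2 scale_L2 A by (rule lin)
  define R where "R = (\<lambda>h. SOME u. \<forall>z\<in>ball 0 1. disk_transform u z = h z)"
  have R: "disk_transform (R h) z = h z" if h: "h \<in> hardy_disk" and z: "z \<in> ball 0 1" for h z
  proof -
    have "\<exists>u. \<forall>z\<in>ball 0 1. disk_transform u z = h z" using disk_transform_surj[OF h] by metis
    from someI_ex[OF this] show ?thesis using z by (simp add: R_def)
  qed
  have R_eq: "R h = u" if "h \<in> hardy_disk" "\<And>z. z \<in> ball 0 1 \<Longrightarrow> disk_transform u z = h z" for h u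
    by (rule disk_transform_inj) (simp add: R that del: mem_ball)
  define \<Lambda> where "\<Lambda> = (\<lambda>h. disk_transform (A (R h)) a)"
  obtain w where w: "w \<in> ball 0 1" "\<And>h. h \<in> hardy_disk \<Longrightarrow> \<Lambda> h = \<Lambda> (\<lambda>_. 1) * h w" "\<Lambda> (\<lambda>_. 1) \<noteq> 0"
  proof (rule outer_functional[of \<Lambda>])
    show "\<Lambda> f = \<Lambda> g" if "f \<in> hardy_disk" "\<And>z. z \<in> ball 0 1 \<Longrightarrow> f z = g z" for f g
    proof -
      have "g \<in> hardy_disk" using hardy_disk_cong[of f g] that by blast
      then have "R f = R g" by (intro R_eq that) (simp add: R that del: mem_ball)
      then show ?thesis by (simp add: \<Lambda>_def)
    qed
    show "\<Lambda> (\<lambda>z. f z + g z) = \<Lambda> f + \<Lambda> g" if "f \<in> hardy_disk" "g \<in> hardy_disk" for f g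
    proof -
      have "R (\<lambda>z. f z + g z) = R f + R g"
        by (intro R_eq hardy_disk_add that) (simp add: R that disk_transform_add del: mem_ball)
      then show ?thesis by (simp add: \<Lambda>_def A.add disk_transform_add[OF a])
    qed
    show "\<Lambda> (\<lambda>z. c * f z) = c * \<Lambda> f" if "f \<in> hardy_disk" for f c
    proof -
      have "R (\<lambda>z. c * f z) = scale_L2 c (R f)"
        by (intro R_eq hardy_disk_cmult that) (simp add: R that disk_transform_scale del: mem_ball)
      then show ?thesis by (simp add: \<Lambda>_def A.scale disk_transform_scale)
    qed
    show "\<Lambda> f \<noteq> 0" if f: "outer_disk f" for f
    proof -
      have "f \<in> hardy_disk" using f by (simp add: outer_disk_def)
      then have "outer_disk (disk_transform (R f))" using outer_disk_cong[of "disk_transform (R f)" f] R f by blast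
      then have "minimum_phase (A (R f))" by (intro mp) (simp add: minimum_phase_iff)
      then show ?thesis unfolding \<Lambda>_def minimum_phase_iff by (intro outer_disk_nonzero a)
    qed
  qed blast
  have "disk_transform (A u) a = \<Lambda> (\<lambda>_. 1) * disk_transform u w" for u
  proof -
    have "R (disk_transform u) = u" by (rule R_eq[OF disk_transform_hardy]) simp
    then have "disk_transform (A u) a = \<Lambda> (disk_transform u)" by (simp add: \<Lambda>_def)
    also have "\<dots> = \<Lambda> (\<lambda>_. 1) * disk_transform u w" by (rule w(2)[OF disk_transform_hardy])
    finally show ?thesis .
  qed
  then show thesis using w that by blast
qed

section \<open>Two compactly supported functions\<close>

definition window :: "complex \<Rightarrow> real \<Rightarrow> complex" where
  "window b t = indicator {0..1} t * exp (- b * of_real t)"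

lemma l2_half_window: "l2_half (window b)"
proof -
  have "window b \<in> borel_measurable borel" unfolding window_def by measurable
  moreover have "integrable lborel (\<lambda>t. (cmod (window b t))\<^sup>2)"
  proof -
    have "set_integrable lborel {0..1} (\<lambda>t. (cmod (exp (- b * of_real t)))\<^sup>2)"
      by (intro borel_integrable_atLeastAtMost' continuous_intros)
    moreover have "indicat_real {0..1} t *\<^sub>R (cmod (exp (- b * of_real t)))\<^sup>2 = (cmod (window b t))\<^sup>2" for t
      by (auto simp: window_def indicator_def)
    ultimately show ?thesis by (simp add: set_integrable_def)
  qed
  ultimately show ?thesis by (auto simp: l2_half_def window_def)
qed

lemma compactly_supported_window: "compactly_supported (abs_L2 (window b))"
  unfolding compactly_supported.abs_eq[OF L2_rel_refl[OF l2_half_window]]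
  by (intro exI[of _ "{0..1}"]) (auto simp: window_def)

lemma laplace_window:
  assumes "z + b \<noteq> 0"
  shows "laplace (window b) z = (1 - exp (- (z + b))) / (z + b)"
proof -
  define F where "F = (\<lambda>t. - exp (- (z + b) * complex_of_real t) / (z + b))"
  have "has_bochner_integral lborel (\<lambda>t. indicator {0..1} t *\<^sub>R exp (- (z + b) * complex_of_real t)) (F 1 - F 0)"
  proof (rule has_bochner_integral_FTC_Icc)
    show "(F has_vector_derivative exp (- (z + b) * complex_of_real t)) (at t within {0..1})" for t
    proof -
      define c where "c = z + b"
      have "((\<lambda>x. - exp (- c * x) / c) has_field_derivative exp (- c * complex_of_real t)) (at (of_real t))"
        using assms by (auto intro!: derivative_eq_intros simp: c_def[symmetric])
      then show ?thesis
        unfolding F_def c_def[symmetric] by (rule has_vector_derivative_real_field)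
    qed
  qed (auto intro!: continuous_intros)
  then have "(\<integral>t. indicator {0..1} t *\<^sub>R exp (- (z + b) * complex_of_real t) \<partial>lborel) = F 1 - F 0"
    by (rule has_bochner_integral_integral_eq)
  moreover have "indicator {0..1} t *\<^sub>R exp (- (z + b) * complex_of_real t) = window b t * exp (- z * of_real t)" for t
    by (auto simp: window_def indicator_def algebra_simps simp flip: exp_add)
  ultimately show ?thesis by (simp add: laplace_def F_def diff_divide_distrib)
qed

theorem mainTheorem2:
  "\<exists>f g :: L2. compactly_supported f \<and> compactly_supported g \<and>
     (\<forall>A\<^sub>1 A\<^sub>2 :: L2 \<Rightarrow> L2.
        minimum_phase_preserving A\<^sub>1 \<and> minimum_phase_preserving A\<^sub>2 \<and>
        A\<^sub>1 f = A\<^sub>2 f \<and> A\<^sub>1 g = A\<^sub>2 g \<longrightarrow> A\<^sub>1 = A\<^sub>2)"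
proof -
  \<comment> \<open>A period of the exponential function, so that the transforms of \<open>f\<close> and \<open>g\<close> have the same numerator.\<close>
  define b :: complex where "b = 2 * of_real pi * \<i>"
  define f where "f = abs_L2 (window 0)"
  define g where "g = abs_L2 (window b)"
  define \<zeta> where "\<zeta> = (\<lambda>w::complex. (1 - w) / (1 + w))"
  have \<zeta>_eq: "(1 - w) / (1 + w) = \<zeta> w" for w by (simp add: \<zeta>_def)
  have b0: "b \<noteq> 0" by (simp add: b_def)
  have \<zeta>b: "\<zeta> w + b \<noteq> 0" "\<zeta> w \<noteq> 0" if "w \<in> ball 0 1" for w
    using cayley_Re(1)[OF that] by (auto simp: \<zeta>_def b_def complex_eq_iff)
  have ratio: "disk_transform g w = disk_transform f w * (\<zeta> w / (\<zeta> w + b))" if w: "w \<in> ball 0 1" for w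
  proof -
    have "exp (- (\<zeta> w + b)) = exp (- \<zeta> w)"
    proof -
      have "exp (- b) = 1" by (simp add: b_def exp_minus exp_two_pi_i)
      moreover have "- (\<zeta> w + b) = - \<zeta> w + - b" by simp
      ultimately show ?thesis by (simp only: exp_add) simp
    qed
    then show ?thesis
      unfolding f_def g_def disk_transform_abs[OF l2_half_window] \<zeta>_eq
      using laplace_window[of "\<zeta> w" b] laplace_window[of "\<zeta> w" 0] \<zeta>b[OF w] by simp
  qed
  have nonzero: "disk_transform f w \<noteq> 0" if w: "w \<in> ball 0 1" for w
  proof -
    have "cmod (exp (- \<zeta> w)) < 1" using cayley_Re(1)[OF w] by (simp add: \<zeta>_def)
    then have "exp (- \<zeta> w) \<noteq> 1" by (metis norm_one less_irrefl)
    then have "1 - exp (- \<zeta> w) \<noteq> 0" by simp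
    then show ?thesis
      unfolding f_def disk_transform_abs[OF l2_half_window] \<zeta>_eq
      using laplace_window[of "\<zeta> w" 0] \<zeta>b[OF w] cayley_Re(2)[OF w] by simp
  qed
  have "A1 = A2" if A: "minimum_phase_preserving A1" "minimum_phase_preserving A2" "A1 f = A2 f" "A1 g = A2 g" for A1 A2
  proof (rule ext, rule disk_transform_inj)
    fix u and a :: complex assume a: "a \<in> ball 0 1"
    obtain c1 w1 where 1: "w1 \<in> ball 0 1" "c1 \<noteq> 0" "\<And>u. disk_transform (A1 u) a = c1 * disk_transform u w1"
      using minimum_phase_preserving_pointwise[OF A(1) a] by blast
    obtain c2 w2 where 2: "w2 \<in> ball 0 1" "c2 \<noteq> 0" "\<And>u. disk_transform (A2 u) a = c2 * disk_transform u w2"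
      using minimum_phase_preserving_pointwise[OF A(2) a] by blast
    have f: "c1 * disk_transform f w1 = c2 * disk_transform f w2" using 1(3)[of f] 2(3)[of f] A(3) by simp
    have "c1 * disk_transform g w1 = c2 * disk_transform g w2" using 1(3)[of g] 2(3)[of g] A(4) by simp
    then have "(c1 * disk_transform f w1) * (\<zeta> w1 / (\<zeta> w1 + b)) = (c1 * disk_transform f w1) * (\<zeta> w2 / (\<zeta> w2 + b))"
      unfolding ratio[OF 1(1)] ratio[OF 2(1)] mult.assoc[symmetric] f .
    then have "\<zeta> w1 / (\<zeta> w1 + b) = \<zeta> w2 / (\<zeta> w2 + b)"
      using 1(2) nonzero[OF 1(1)] unfolding mult_cancel_left by simp
    then have "\<zeta> w1 = \<zeta> w2" using \<zeta>b[OF 1(1)] \<zeta>b[OF 2(1)] b0 by (simp add: field_simps)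
    then have "w1 = w2" using cayley_Re(2)[OF 1(1)] cayley_Re(2)[OF 2(1)] by (simp add: \<zeta>_def field_simps)
    moreover from this have "c1 = c2" using f nonzero[OF 1(1)] by simp
    ultimately show "disk_transform (A1 u) a = disk_transform (A2 u) a" by (simp add: 1(3) 2(3))
  qed
  moreover have "compactly_supported f" "compactly_supported g" by (simp_all add: f_def g_def compactly_supported_window)
  ultimately show ?thesis by blast
qed

end
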